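(* There exists some $\delta>0$ such that the number of $n\times n$ $\{\pm1\}$-valued normal matrices is at most $2^{(c_{DV}-\delta+o(1))n^2}$ as $n\to\infty$, where $c_{DV}<0.698$ denotes the constant of Deneanu and Vu.
   Context: A real square matrix $M$ is normal if $MM^T=M^TM$. The constant $c_{DV}$ is the exponent in the bound of Deneanu and Vu ("Random matrices: probability of normality"), who proved that the number of $n\times n$ $\{\pm1\}$-valued normal matrices is at most $2^{(c_{DV}+o(1))n^2}$ with $c_{DV}<0.698$. It is the value produced by the following optimization (written with $n$ normalized to $1$). For real $\alpha,s,t$ let $$f(\alpha,s,t)=(1-\alpha)t^2-\tfrac{s^2}{2}-1+s,$$ $$g(s,t)=\begin{cases}t^2-3s^2+2s+st-2t & \text{if } s\le \tfrac12,\\ 1+s^2+t^2+st-2s-2t & \text{if } s\ge\tfrac12 .\end{cases}$$ Then $c_{DV}=1-\alpha^*$, where $\alpha^*$ is the supremum of all $\alpha>0$ such that $\min(f(\alpha,s,t),g(s,t))\le-\alpha$ for all $(s,t)$ with $0\le s\le \tfrac23$, $s\le t$ and $\tfrac s2\le 1-t\le s$ (numerically $\alpha^*\approx 0.302$). *)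

theory Defs
  imports Complex_Main "Jordan_Normal_Form.Matrix"
begin

definition normal_mat :: "real mat \<Rightarrow> bool" where
  "normal_mat M \<longleftrightarrow>
     square_mat M \<and> M * transpose_mat M = transpose_mat M * M"

definition sign_mats :: "nat \<Rightarrow> real mat set" where
  "sign_mats n = {M \<in> carrier_mat n n. elements_mat M \<subseteq> {-1, 1}}"

definition dv_f :: "real \<Rightarrow> real \<Rightarrow> real \<Rightarrow> real" where
  "dv_f \<alpha> s t = (1 - \<alpha>) * t\<^sup>2 - s\<^sup>2 / 2 - 1 + s"

text \<open>The two branches agree at \<open>s = 1/2\<close>.\<close>

definition dv_g :: "real \<Rightarrow> real \<Rightarrow> real" where
  "dv_g s t =
     (if s \<le> 1/2 then t\<^sup>2 - 3 * s\<^sup>2 + 2 * s + s * t - 2 * t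
      else 1 + s\<^sup>2 + t\<^sup>2 + s * t - 2 * s - 2 * t)"

text \<open>
  The set of admissible \<open>\<alpha>\<close> is nonempty and bounded above (for instance by
  \<open>1/3\<close>, from \<open>s = t = 2/3\<close>), so its \<open>Sup\<close> is a genuine supremum.
\<close>

definition dv_alpha :: real where
  "dv_alpha = Sup {\<alpha>. \<alpha> > 0 \<and>
     (\<forall>s t. 0 \<le> s \<and> s \<le> 2/3 \<and> s \<le> t \<and> s/2 \<le> 1 - t \<and> 1 - t \<le> s \<longrightarrow>
        min (dv_f \<alpha> s t) (dv_g s t) \<le> - \<alpha>)}"

definition c_DV :: real where
  "c_DV = 1 - dv_alpha"

end

theory Submission
  imports Defs "HOL-Analysis.Convex" "HOL-Library.FuncSet" "HOL-Real_Asymp.Real_Asymp"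
begin

text \<open>
  Counting is by induction over quasi-normal matrices, those with \<open>M M\<^sup>T - M\<^sup>T M\<close> prescribed, which
  are stable under restriction to principal blocks. When the rows and columns with index in a set
  \<open>P\<close> are known, the equations between \<open>P\<close> and a further index \<open>k\<close> are linear in the remaining
  entries of row and column \<open>k\<close>, so a system of rank \<open>\<rho>\<close> saves \<open>\<rho>\<close> bits. If the rank stalls at
  \<open>s n\<close>, the further rows lie in a space of dimension \<open>s n\<close>; exposing in this order gives the
  exponent \<open>1 + dv_g\<close>. Exposing first the low-rank part outside a block of size \<open>t n\<close>, then this block
  by induction, gives \<open>1 + dv_f\<close>. So far this is the Deneanu-Vu exponent.

  The improvement comes from the first few percent of the rows. If their rank survives the removal
  of few indices, the linear systems contain three disjoint bases, and Cauchy-Schwarz saves more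
  than one bit per equation, which lowers \<open>dv_g\<close> by a constant. If not, these rows and columns take
  so few bits that induction on the complementary block already gives a better exponent. Since at the
  optimum both terms of the minimum are needed, lowering \<open>dv_g\<close> alone lowers the exponent.
\<close>

text \<open>Three bases are the least number that helps. With two invertible blocks a system such as
  x = y has exactly 2^m sign solutions, so linear algebra alone is already sharp; with a third block
  the trivial 4^m drops to 12^(m/2). The factor (3/4)^(m/2), earned on about n/40 rows with m about
  n/80, is at most 2^(-n^2/25000), whence the constant 1/25000.

  For the exponent from \<open>dv_f\<close> the obstacle is that row and column of an index are
  unknown together, while a rank relation may control only one combination of the two. The value of
  x + \<beta> y reveals both signs unless \<beta> is 0, 1 or -1; the exceptional directions cost an
  additional bit per row and are treated separately.

  All auxiliary choices (orderings, index sets, directions, witness rows) have only 2^(O(n log n))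
  values. Matrices can therefore be sorted by them beforehand, and the loss is absorbed by a strict
  gain \<eta> n^2 in the recursion, which leaves the multiplicative constant of the induction
  unchanged.\<close>

section \<open>Linear independence of rows on a set of columns\<close>

text \<open>Rows \<open>R\<close> are independent on columns \<open>C\<close>; independence of columns is
  \<open>indep\<close> of the transposed array.\<close>

definition indep :: "('r \<Rightarrow> 'c \<Rightarrow> real) \<Rightarrow> 'r set \<Rightarrow> 'c set \<Rightarrow> bool" where
  "indep A R C \<longleftrightarrow>
     (\<forall>f. (\<forall>c\<in>C. (\<Sum>r\<in>R. f r * A r c) = 0) \<longrightarrow> (\<forall>r\<in>R. f r = 0))"

definition tr :: "('r \<Rightarrow> 'c \<Rightarrow> real) \<Rightarrow> 'c \<Rightarrow> 'r \<Rightarrow> real" where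
  "tr A c r = A r c"

lemma tr_tr [simp]: "tr (tr A) = A"
  by (intro ext) (simp add: tr_def)

lemma indepI:
  assumes "\<And>f r. (\<And>c. c \<in> C \<Longrightarrow> (\<Sum>r\<in>R. f r * A r c) = 0) \<Longrightarrow> r \<in> R \<Longrightarrow> f r = 0"
  shows "indep A R C"
  using assms unfolding indep_def by blast

lemma indepD:
  assumes "indep A R C" "\<And>c. c \<in> C \<Longrightarrow> (\<Sum>r\<in>R. f r * A r c) = 0" "r \<in> R"
  shows "f r = 0"
  using assms unfolding indep_def by blast

lemma indep_mono_cols: "indep A R C \<Longrightarrow> C \<subseteq> C' \<Longrightarrow> indep A R C'"
  unfolding indep_def by blast

lemma indep_subset_rows:
  assumes "indep A R C" "R' \<subseteq> R" "finite R"
  shows "indep A R' C"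
proof (rule indepI)
  fix f r assume h: "\<And>c. c \<in> C \<Longrightarrow> (\<Sum>r\<in>R'. f r * A r c) = 0" and r: "r \<in> R'"
  define g where "g r = (if r \<in> R' then f r else 0)" for r
  have "(\<Sum>r\<in>R. g r * A r c) = (\<Sum>r\<in>R'. f r * A r c)" for c
    using assms(2,3) by (intro sum.mono_neutral_cong_right) (auto simp: g_def)
  then have "g r = 0" using indepD[OF assms(1), of g r] h r assms(2) by auto
  then show "f r = 0" using r by (simp add: g_def)
qed

lemma indep_empty [simp]: "indep A {} C"
  by (simp add: indep_def)

text \<open>Gaussian elimination: a pivot row \<open>p\<close> for the column \<open>z\<close> is
  eliminated from the other rows, which removes one equation and one unknown. Every rank statement
  below rests on this count.\<close>

lemma ex_kernel_vector:
  fixes A :: "'r \<Rightarrow> 'c \<Rightarrow> real"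
  assumes "finite C" "finite R" "card C < card R"
  shows "\<exists>f. (\<exists>r\<in>R. f r \<noteq> 0) \<and> (\<forall>c\<in>C. (\<Sum>r\<in>R. f r * A r c) = 0)"
  using assms
proof (induction C arbitrary: A R rule: finite_induct)
  case empty
  then have "R \<noteq> {}" by auto
  then show ?case by (intro exI[of _ "\<lambda>_. 1"]) auto
next
  case (insert z C)
  show ?case
  proof (cases "\<forall>r\<in>R. A r z = 0")
    case True
    from insert.IH[of R A] insert.prems insert.hyps obtain f where
      "\<exists>r\<in>R. f r \<noteq> 0" "\<forall>c\<in>C. (\<Sum>r\<in>R. f r * A r c) = 0" by auto
    with True show ?thesis by (intro exI[of _ f]) auto
  next
    case False
    then obtain p where p: "p \<in> R" "A p z \<noteq> 0" by blast
    define B where "B r c = A r c - A r z / A p z * A p c" for r c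
    have "card C < card (R - {p})" using insert p by simp
    from insert.IH[OF _ this, of B] insert.prems obtain f where
      f: "\<exists>r\<in>R - {p}. f r \<noteq> 0" "\<forall>c\<in>C. (\<Sum>r\<in>R - {p}. f r * B r c) = 0" by auto
    define g where "g r = (if r = p then - (\<Sum>r\<in>R - {p}. f r * (A r z / A p z)) else f r)" for r
    have eq: "(\<Sum>r\<in>R. g r * A r c) = (\<Sum>r\<in>R - {p}. f r * B r c)" for c
    proof -
      have "(\<Sum>r\<in>R. g r * A r c) = g p * A p c + (\<Sum>r\<in>R - {p}. g r * A r c)"
        using p insert.prems by (simp add: sum.remove)
      also have "(\<Sum>r\<in>R - {p}. g r * A r c) = (\<Sum>r\<in>R - {p}. f r * A r c)"
        by (intro sum.cong) (auto simp: g_def)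
      also have "g p * A p c = - (\<Sum>r\<in>R - {p}. f r * (A r z / A p z) * A p c)"
        by (simp add: g_def sum_distrib_right)
      finally show ?thesis
        by (simp add: B_def right_diff_distrib sum_subtractf mult.assoc)
    qed
    have "B r z = 0" for r using p by (simp add: B_def)
    then have "\<forall>c\<in>insert z C. (\<Sum>r\<in>R. g r * A r c) = 0" using f(2) unfolding eq by simp
    moreover have "\<exists>r\<in>R. g r \<noteq> 0" using f(1) unfolding g_def by (metis DiffD1 DiffD2 singletonI)
    ultimately show ?thesis by blast
  qed
qed

lemma indep_card_le:
  assumes "indep A R C" "finite R" "finite C"
  shows "card R \<le> card C"
proof (rule ccontr)
  assume "\<not> ?thesis"
  with ex_kernel_vector[of C R A] assms obtain f where
    "\<exists>r\<in>R. f r \<noteq> 0" "\<forall>c\<in>C. (\<Sum>r\<in>R. f r * A r c) = 0" by (auto simp: not_le)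
  with indepD[OF assms(1), of f] show False by blast
qed

lemma indep_insert_comb:
  assumes "indep A R C" "\<not> indep A (insert k R) C" "finite R"
  shows "\<exists>l. \<forall>c\<in>C. A k c = (\<Sum>r\<in>R. l r * A r c)"
proof -
  have k: "k \<notin> R" using assms by (metis insert_absorb)
  from assms(2) obtain f where f: "\<forall>c\<in>C. (\<Sum>r\<in>insert k R. f r * A r c) = 0"
    and nz: "\<exists>r\<in>insert k R. f r \<noteq> 0" unfolding indep_def by blast
  have e: "f k * A k c + (\<Sum>r\<in>R. f r * A r c) = 0" if "c \<in> C" for c
    using f that k assms(3) by simp
  have "f k \<noteq> 0"
  proof
    assume 0: "f k = 0"
    then have "\<forall>r\<in>R. f r = 0" using indepD[OF assms(1), of f] e by auto
    with nz 0 show False by auto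
  qed
  then have "A k c = (\<Sum>r\<in>R. (- f r / f k) * A r c)" if "c \<in> C" for c
  proof -
    have "(\<Sum>r\<in>R. (- f r / f k) * A r c) = - (\<Sum>r\<in>R. f r * A r c) / f k"
      by (simp add: sum_divide_distrib sum_negf)
    also have "\<dots> = A k c" using e[OF that] \<open>f k \<noteq> 0\<close> by (simp add: field_simps)
    finally show ?thesis by simp
  qed
  then show ?thesis by (intro exI[of _ "\<lambda>r. - f r / f k"] ballI)
qed

lemma ex_maximal_subset:
  assumes "finite C" "S0 \<subseteq> C" "P S0"
  obtains Q where "S0 \<subseteq> Q" "Q \<subseteq> C" "P Q" "\<And>z. z \<in> C - Q \<Longrightarrow> \<not> P (insert z Q)"
proof -
  let ?P = "\<lambda>Q. S0 \<subseteq> Q \<and> Q \<subseteq> C \<and> P Q"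
  have "finite {Q. ?P Q}" using assms(1) by (auto intro: finite_subset[of _ "Pow C"])
  moreover have "{Q. ?P Q} \<noteq> {}" using assms by auto
  ultimately obtain Q where Q: "?P Q" "\<forall>Q'\<in>{Q. ?P Q}. Q \<subseteq> Q' \<longrightarrow> Q = Q'"
    using finite_has_maximal[of "{Q. ?P Q}"] by auto
  show ?thesis
  proof (rule that[of Q])
    fix z assume "z \<in> C - Q"
    then have z: "z \<in> C" "z \<notin> Q" by auto
    show "\<not> P (insert z Q)"
    proof
      assume "P (insert z Q)"
      with Q(1) z have "?P (insert z Q)" by blast
      with Q(2) have "Q = insert z Q" by blast
      with z show False by blast
    qed
  qed (use Q in auto)
qed

lemma ex_maximal_indep:
  assumes "finite C" "S0 \<subseteq> C" "indep B S0 R"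
  obtains Q where "S0 \<subseteq> Q" "Q \<subseteq> C" "indep B Q R" "\<And>z. z \<in> C - Q \<Longrightarrow> \<not> indep B (insert z Q) R"
  by (rule ex_maximal_subset[of C S0 "\<lambda>Q. indep B Q R"]) (use assms that in blast)+

text \<open>A row combination that vanishes on the columns \<open>Q\<close> vanishes on every column
  in their span.\<close>

lemma indep_of_spanning:
  assumes "indep A R C" "\<And>z. z \<in> C \<Longrightarrow> \<exists>l. \<forall>r\<in>R. A r z = (\<Sum>q\<in>Q. l q * A r q)"
  shows "indep A R Q"
proof (rule indepI)
  fix f r assume h: "\<And>c. c \<in> Q \<Longrightarrow> (\<Sum>r\<in>R. f r * A r c) = 0" and r: "r \<in> R"
  have "(\<Sum>r\<in>R. f r * A r z) = 0" if "z \<in> C" for z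
  proof -
    obtain l where l: "\<forall>r\<in>R. A r z = (\<Sum>q\<in>Q. l q * A r q)" using assms(2)[OF \<open>z \<in> C\<close>] by blast
    have "(\<Sum>r\<in>R. f r * A r z) = (\<Sum>r\<in>R. \<Sum>q\<in>Q. f r * (l q * A r q))"
      using l by (intro sum.cong) (auto simp: sum_distrib_left)
    also have "\<dots> = (\<Sum>q\<in>Q. l q * (\<Sum>r\<in>R. f r * A r q))"
      by (subst sum.swap) (simp add: sum_distrib_left mult_ac)
    also have "\<dots> = 0" using h by simp
    finally show ?thesis .
  qed
  then show "f r = 0" using indepD[OF assms(1)] r by blast
qed

lemma maximal_cols_span:
  assumes "finite Q" "indep (tr A) Q R" "\<not> indep (tr A) (insert z Q) R"
  shows "\<exists>l. \<forall>r\<in>R. A r z = (\<Sum>q\<in>Q. l q * A r q)"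
  using indep_insert_comb[OF assms(2,3,1)] by (simp add: tr_def)

lemma indep_self_span:
  fixes A :: "'r \<Rightarrow> 'c \<Rightarrow> real"
  assumes "finite Q" "z \<in> Q"
  shows "\<exists>l. \<forall>r\<in>R. A r z = (\<Sum>q\<in>Q. l q * A r q)"
proof (rule exI[of _ "\<lambda>q. if q = z then 1 else 0"], intro ballI)
  fix r
  have "(\<Sum>q\<in>Q. (if q = z then 1 else 0) * A r q) = (\<Sum>q\<in>Q. if q = z then A r q else 0)"
    by (intro sum.cong) auto
  then show "A r z = (\<Sum>q\<in>Q. (if q = z then 1 else 0) * A r q)"
    using assms by simp
qed

text \<open>Row rank equals column rank: a maximal independent set of columns spans all of
  \<open>C\<close>, so the rows stay independent on it and the two cardinality bounds meet.\<close>

lemma ex_square_subset: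
  assumes "indep A R C" "finite R" "finite C"
  obtains Q where "Q \<subseteq> C" "card Q = card R" "indep A R Q" "indep (tr A) Q R"
proof -
  obtain Q where Q: "Q \<subseteq> C" "indep (tr A) Q R"
    "\<And>z. z \<in> C - Q \<Longrightarrow> \<not> indep (tr A) (insert z Q) R"
    using ex_maximal_indep[OF assms(3), of "{}" "tr A" R] by auto
  have fQ: "finite Q" using Q assms finite_subset by auto
  have "indep A R Q"
  proof (rule indep_of_spanning[OF assms(1)])
    fix z assume "z \<in> C"
    then show "\<exists>l. \<forall>r\<in>R. A r z = (\<Sum>q\<in>Q. l q * A r q)"
      using maximal_cols_span[OF fQ Q(2)] Q(3) indep_self_span[OF fQ] by (cases "z \<in> Q") auto
  qed
  moreover from this have "card Q = card R"
    using indep_card_le[of A R Q] indep_card_le[OF Q(2)] assms fQ by auto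
  ultimately show ?thesis using that Q by blast
qed

lemma indep_square:
  assumes "indep A R C" "finite R" "finite C" "card R = card C"
  shows "indep (tr A) C R"
proof -
  obtain Q where "Q \<subseteq> C" "card Q = card R" "indep (tr A) Q R"
    using ex_square_subset[OF assms(1-3)] by metis
  then show ?thesis using assms by (metis card_subset_eq)
qed

lemma indep_square':
  assumes "indep (tr A) C R" "finite R" "finite C" "card R = card C"
  shows "indep A R C"
  using indep_square[OF assms(1)] assms by simp

text \<open>One column more than there are rows is always dependent. The column \<open>z\<close> is
  arbitrary, so the coordinates can be used for columns chosen later.\<close>

lemma square_cols_span:
  assumes "indep A R Q" "finite R" "finite Q" "card Q = card R"
  shows "\<exists>l. \<forall>r\<in>R. A r z = (\<Sum>q\<in>Q. l q * A r q)"
proof (cases "z \<in> Q")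
  case True then show ?thesis by (rule indep_self_span[OF assms(3)])
next
  case False
  have i: "indep (tr A) Q R" using indep_square[OF assms(1-3)] assms(4) by simp
  have "\<not> indep (tr A) (insert z Q) R"
    using indep_card_le[of "tr A" "insert z Q" R] assms False by auto
  from maximal_cols_span[OF assms(3) i this] show ?thesis .
qed

section \<open>Counting by restriction to cells\<close>

definition agree :: "'a set \<Rightarrow> ('a \<Rightarrow> real) \<Rightarrow> ('a \<Rightarrow> real) \<Rightarrow> bool" where
  "agree C M M' \<longleftrightarrow> (\<forall>c\<in>C. M c = M' c)"

text \<open>The number of distinct restrictions to \<open>C\<close>: exposing the cells of a matrix in stages
  multiplies these numbers by bounds on the fibres.\<close>

definition cnt :: "'a set \<Rightarrow> ('a \<Rightarrow> real) set \<Rightarrow> nat" where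
  "cnt C \<M> = card ((\<lambda>M. restrict M C) ` \<M>)"

abbreviation signs :: "'a set \<Rightarrow> ('a \<Rightarrow> real) set" where
  "signs C \<equiv> PiE C (\<lambda>_. {-1, 1})"

lemma agree_Un: "agree (C \<union> D) M M' \<longleftrightarrow> agree C M M' \<and> agree D M M'"
  by (auto simp: agree_def)

lemma restrict_eq_iff_agree: "restrict M C = restrict M' C \<longleftrightarrow> agree C M M'"
  by (auto simp: agree_def fun_eq_iff restrict_def)

lemma card_signs: "finite C \<Longrightarrow> card (signs C) = 2 ^ card C"
  by (simp add: card_PiE numeral_2_eq_2)

lemma finite_signs: "finite C \<Longrightarrow> finite (signs C)"
  by (simp add: finite_PiE)

lemma cnt_full: "\<M> \<subseteq> signs C \<Longrightarrow> cnt C \<M> = card \<M>"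
proof -
  assume "\<M> \<subseteq> signs C"
  then have "restrict M C = M" if "M \<in> \<M>" for M
    using that by (metis PiE_restrict subsetD)
  then have "(\<lambda>M. restrict M C) ` \<M> = \<M>" by simp
  then show ?thesis by (simp add: cnt_def)
qed

text \<open>The fibres are those of members \<open>M0\<close> of the class, so a fibre bound may use
  bases that are read off from \<open>M0\<close>.\<close>

lemma cnt_step:
  assumes fin: "finite \<M>" and "C \<subseteq> C'"
    and fib: "\<And>M0. M0 \<in> \<M> \<Longrightarrow> real (cnt C' {M \<in> \<M>. agree C M M0}) \<le> B"
  shows "real (cnt C' \<M>) \<le> real (cnt C \<M>) * B"
proof -
  define I where "I = (\<lambda>M. restrict M C) ` \<M>"
  define F where "F y = (\<lambda>M. restrict M C') ` {M \<in> \<M>. restrict M C = y}" for y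
  have I: "finite I" using fin by (simp add: I_def)
  have "(\<lambda>M. restrict M C') ` \<M> = (\<Union>y\<in>I. F y)" by (auto simp: I_def F_def)
  then have "cnt C' \<M> = card (\<Union>y\<in>I. F y)" by (simp add: cnt_def)
  also have "\<dots> \<le> (\<Sum>y\<in>I. card (F y))" using I by (rule card_UN_le)
  finally have "real (cnt C' \<M>) \<le> (\<Sum>y\<in>I. real (card (F y)))"
    by (metis of_nat_le_iff of_nat_sum)
  also have "\<dots> \<le> (\<Sum>y\<in>I. B)"
  proof (intro sum_mono)
    fix y assume "y \<in> I"
    then obtain M0 where M0: "M0 \<in> \<M>" "y = restrict M0 C" by (auto simp: I_def)
    have "F y = (\<lambda>M. restrict M C') ` {M \<in> \<M>. agree C M M0}"
      by (simp add: F_def M0 restrict_eq_iff_agree)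
    then show "real (card (F y)) \<le> B" using fib[OF M0(1)] by (simp add: cnt_def)
  qed
  finally show ?thesis by (simp add: I_def cnt_def)
qed

text \<open>The code \<open>h M\<close> may depend on more of \<open>M\<close> than its restriction
  to \<open>C\<close>. Fixing one representative for each restriction makes the code injective on
  restrictions.\<close>

lemma cnt_le_inj:
  fixes \<M> :: "('a \<Rightarrow> real) set"
  assumes "finite \<N>" "\<And>M. M \<in> \<M> \<Longrightarrow> h M \<in> \<N>"
    and "\<And>M M'. M \<in> \<M> \<Longrightarrow> M' \<in> \<M> \<Longrightarrow> h M = h M' \<Longrightarrow> agree C M M'"
  shows "cnt C \<M> \<le> card \<N>"
proof -
  define r where "r = (\<lambda>M :: 'a \<Rightarrow> real. restrict M C)"
  define g where "g y = h (SOME M. M \<in> \<M> \<and> r M = y)" for y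
  have g: "\<exists>M'\<in>\<M>. r M' = r M \<and> g (r M) = h M'" if "M \<in> \<M>" for M
  proof -
    have "(SOME M'. M' \<in> \<M> \<and> r M' = r M) \<in> \<M> \<and> r (SOME M'. M' \<in> \<M> \<and> r M' = r M) = r M"
      by (rule someI[of _ M]) (use that in simp)
    then show ?thesis unfolding g_def by blast
  qed
  have "inj_on g (r ` \<M>)"
  proof (rule inj_onI)
    fix x y assume "x \<in> r ` \<M>" "y \<in> r ` \<M>" and e: "g x = g y"
    then obtain M M' where "M \<in> \<M>" "x = r M" "M' \<in> \<M>" "y = r M'" by auto
    with g obtain N N' where "N \<in> \<M>" "N' \<in> \<M>" "r N = x" "r N' = y" "g x = h N" "g y = h N'"
      by metis
    with assms(3)[of N N'] e show "x = y"
      by (auto simp: r_def restrict_eq_iff_agree)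
  qed
  moreover have "g ` (r ` \<M>) \<subseteq> \<N>" using g assms(2) by force
  ultimately have "card (r ` \<M>) \<le> card \<N>" using assms(1) by (metis card_inj_on_le)
  then show ?thesis by (simp add: cnt_def r_def)
qed

lemma cnt_le_determined:
  assumes "finite D" "card D \<le> d" "\<And>M c. M \<in> \<M> \<Longrightarrow> c \<in> D \<Longrightarrow> M c \<in> {-1, 1}"
    and "\<And>M M'. M \<in> \<M> \<Longrightarrow> M' \<in> \<M> \<Longrightarrow> agree D M M' \<Longrightarrow> agree C M M'"
  shows "real (cnt C \<M>) \<le> 2 ^ d"
proof -
  have "cnt C \<M> \<le> card (signs D)"
  proof (rule cnt_le_inj[where h = "\<lambda>M. restrict M D"])
    show "restrict M D \<in> signs D" if "M \<in> \<M>" for M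
      using assms(3)[OF that] by (intro restrict_PiE_iff[THEN iffD2]) auto
  qed (use assms finite_signs in \<open>auto simp: restrict_eq_iff_agree\<close>)
  also have "\<dots> \<le> 2 ^ d" using assms by (simp add: card_signs power_increasing)
  finally have "real (cnt C \<M>) \<le> real (2 ^ d)" by (rule of_nat_mono)
  then show ?thesis by simp
qed

section \<open>A Halasz type bound from three disjoint bases\<close>

lemma card_collisions:
  assumes "finite A" "finite B" "finite V" "\<phi> ` A \<subseteq> V"
  shows "card {p \<in> A \<times> B. \<phi> (fst p) = \<psi> (snd p)}
       = (\<Sum>v\<in>V. card {a \<in> A. \<phi> a = v} * card {b \<in> B. \<psi> b = v})"
proof -
  have "{p \<in> A \<times> B. \<phi> (fst p) = \<psi> (snd p)}
      = (\<Union>v\<in>V. {a \<in> A. \<phi> a = v} \<times> {b \<in> B. \<psi> b = v})"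
    using assms(4) by auto
  then have "card {p \<in> A \<times> B. \<phi> (fst p) = \<psi> (snd p)}
      = (\<Sum>v\<in>V. card ({a \<in> A. \<phi> a = v} \<times> {b \<in> B. \<psi> b = v}))"
    using assms by (simp add: card_UN_disjoint disjoint_iff)
  then show ?thesis by (simp add: card_cartesian_product)
qed

text \<open>Collisions are inner products of the vectors of fibre sizes, indexed by the common
  value.\<close>

lemma collisions_Cauchy_Schwarz:
  assumes "finite A" "finite B"
  shows "(real (card {p \<in> A \<times> B. \<phi> (fst p) = \<psi> (snd p)}))\<^sup>2
       \<le> real (card {p \<in> A \<times> A. \<phi> (fst p) = \<phi> (snd p)})
         * real (card {p \<in> B \<times> B. \<psi> (fst p) = \<psi> (snd p)})"
proof -
  let ?V = "\<phi> ` A \<union> \<psi> ` B"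
  let ?a = "\<lambda>v. real (card {a \<in> A. \<phi> a = v})" and ?b = "\<lambda>v. real (card {b \<in> B. \<psi> b = v})"
  have V: "finite ?V" using assms by simp
  have 1: "real (card {p \<in> A \<times> B. \<phi> (fst p) = \<psi> (snd p)}) = (\<Sum>v\<in>?V. ?a v * ?b v)"
    using card_collisions[OF assms V, of \<phi> \<psi>] by simp
  have 2: "real (card {p \<in> A \<times> A. \<phi> (fst p) = \<phi> (snd p)}) = (\<Sum>v\<in>?V. (?a v)\<^sup>2)"
    using card_collisions[OF assms(1,1) V, of \<phi> \<phi>] by (simp add: power2_eq_square)
  have 3: "real (card {p \<in> B \<times> B. \<psi> (fst p) = \<psi> (snd p)}) = (\<Sum>v\<in>?V. (?b v)\<^sup>2)"
    using card_collisions[OF assms(2,2) V, of \<psi> \<psi>] by (simp add: power2_eq_square)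
  show ?thesis unfolding 1 2 3 by (rule Cauchy_Schwarz_ineq_sum)
qed

text \<open>Six of the sixteen sign patterns are possible at each coordinate: a difference of two
  signs takes the values -2, 0, 2 in 1, 2, 1 ways, and 1 + 4 + 1 = 6.\<close>

lemma sign_quadruples:
  assumes "finite Q" "card Q = m"
  shows "card {p \<in> (signs Q \<times> signs Q) \<times> (signs Q \<times> signs Q).
            \<forall>z\<in>Q. fst (fst p) z - snd (fst p) z = fst (snd p) z - snd (snd p) z} \<le> 6 ^ m"
    (is "card ?L \<le> _")
proof -
  define T :: "((real \<times> real) \<times> real \<times> real) set" where
    "T = {((-1,-1),(-1,-1)), ((-1,-1),(1,1)), ((1,1),(-1,-1)), ((1,1),(1,1)),
          ((1,-1),(1,-1)), ((-1,1),(-1,1))}"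
  have T: "finite T" "card T = 6" by (simp_all add: T_def)
  define h where "h p = restrict (\<lambda>z. ((fst (fst p) z, snd (fst p) z), (fst (snd p) z, snd (snd p) z))) Q"
    for p :: "(('a \<Rightarrow> real) \<times> ('a \<Rightarrow> real)) \<times> (('a \<Rightarrow> real) \<times> ('a \<Rightarrow> real))"
  have "h ` ?L \<subseteq> PiE Q (\<lambda>_. T)"
  proof (intro image_subsetI PiE_I)
    fix p z assume p: "p \<in> ?L" and z: "z \<in> Q"
    obtain a b c d where pe: "p = ((a,b),(c,d))" by (metis prod.collapse)
    have "a z \<in> {-1,1}" "b z \<in> {-1,1}" "c z \<in> {-1,1}" "d z \<in> {-1,1}" "a z - b z = c z - d z"
      using p z unfolding pe by (auto dest: PiE_mem)
    then show "h p z \<in> T" using z unfolding pe by (auto simp: h_def T_def)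
  qed (simp add: h_def)
  moreover have "inj_on h ?L"
  proof (rule inj_onI)
    fix p q assume p: "p \<in> ?L" and q: "q \<in> ?L" and e: "h p = h q"
    obtain a b c d where pe: "p = ((a,b),(c,d))" by (metis prod.collapse)
    obtain a' b' c' d' where qe: "q = ((a',b'),(c',d'))" by (metis prod.collapse)
    have "a z = a' z \<and> b z = b' z \<and> c z = c' z \<and> d z = d' z" if "z \<in> Q" for z
      using fun_cong[OF e, of z] that by (simp add: h_def pe qe)
    then show "p = q" using p q unfolding pe qe by (auto intro: PiE_ext)
  qed
  ultimately have "card ?L \<le> card (PiE Q (\<lambda>_. T))"
    using assms T by (intro card_inj_on_le finite_PiE) auto
  then show ?thesis using assms T by (simp add: card_PiE)
qed

text \<open>A purely combinatorial substitute for Halasz's inequality: three invertible blocks give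
  \<open>\<surd>12 ^ m\<close> solutions instead of the trivial \<open>4 ^ m\<close>.\<close>

lemma three_blocks:
  fixes A :: "'r \<Rightarrow> 'c \<Rightarrow> real"
  assumes fin: "finite S" "finite Q1" "finite Q2" "finite Q3"
    and card: "card Q1 = m" "card Q2 = m" "card Q3 = m"
    and disj: "Q1 \<inter> Q2 = {}" "Q1 \<inter> Q3 = {}" "Q2 \<inter> Q3 = {}"
    and ind: "indep (tr A) Q1 S" "indep (tr A) Q2 S" "indep (tr A) Q3 S"
    and X: "X \<subseteq> signs (Q1 \<union> Q2 \<union> Q3)"
    and eq: "\<And>x i. x \<in> X \<Longrightarrow> i \<in> S \<Longrightarrow> (\<Sum>z\<in>Q1 \<union> Q2 \<union> Q3. A i z * x z) = c i"
  shows "(real (card X))\<^sup>2 \<le> 12 ^ m"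
proof -
  have inj: "\<forall>z\<in>Q. x z = 0"
    if "indep (tr A) Q S" "\<forall>i\<in>S. (\<Sum>z\<in>Q. A i z * x z) = 0" for Q x
    using indepD[OF that(1), of x] that(2) by (simp add: tr_def mult.commute)
  define \<phi>1 where "\<phi>1 p = restrict (\<lambda>i. \<Sum>z\<in>Q1. A i z * (fst p z - snd p z)) S" for p :: "('c \<Rightarrow> real) \<times> ('c \<Rightarrow> real)"
  define \<phi>2 where "\<phi>2 p = restrict (\<lambda>i. \<Sum>z\<in>Q2. A i z * (fst p z - snd p z)) S" for p :: "('c \<Rightarrow> real) \<times> ('c \<Rightarrow> real)"
  define \<phi> where "\<phi> p = restrict (\<lambda>i. (\<Sum>z\<in>Q1. A i z * fst p z) + (\<Sum>z\<in>Q2. A i z * snd p z)) S"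
    for p :: "('c \<Rightarrow> real) \<times> ('c \<Rightarrow> real)"
  define \<psi> where "\<psi> x = restrict (\<lambda>i. c i - (\<Sum>z\<in>Q3. A i z * x z)) S" for x :: "'c \<Rightarrow> real"
  let ?P1 = "signs Q1" and ?P2 = "signs Q2" and ?P3 = "signs Q3"
  have finP: "finite ?P1" "finite ?P2" "finite ?P3" using fin finite_signs by auto
  have quad: "card {p \<in> (signs Q \<times> signs Q) \<times> (signs Q \<times> signs Q). g (fst p) = g (snd p)} \<le> 6 ^ m"
    if "finite Q" "card Q = m" "indep (tr A) Q S"
      and g: "\<And>p. g p = restrict (\<lambda>i. \<Sum>z\<in>Q. A i z * (fst p z - snd p z)) S"
    for Q and g :: "('c \<Rightarrow> real) \<times> ('c \<Rightarrow> real) \<Rightarrow> 'r \<Rightarrow> real"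
  proof -
    have "fst (fst p) z - snd (fst p) z = fst (snd p) z - snd (snd p) z"
      if e: "g (fst p) = g (snd p)" and z: "z \<in> Q" for p z
    proof -
      define y where "y z = (fst (fst p) z - snd (fst p) z) - (fst (snd p) z - snd (snd p) z)" for z
      have "(\<Sum>z\<in>Q. A i z * y z) = 0" if "i \<in> S" for i
        using fun_cong[OF e, of i] that unfolding g y_def
        by (simp add: right_diff_distrib sum_subtractf)
      then have "\<forall>z\<in>Q. y z = 0" by (intro inj \<open>indep (tr A) Q S\<close>) auto
      then show ?thesis using z by (simp add: y_def)
    qed
    then have sub: "{p \<in> (signs Q \<times> signs Q) \<times> (signs Q \<times> signs Q). g (fst p) = g (snd p)}
      \<subseteq> {p \<in> (signs Q \<times> signs Q) \<times> (signs Q \<times> signs Q).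
            \<forall>z\<in>Q. fst (fst p) z - snd (fst p) z = fst (snd p) z - snd (snd p) z}" (is "?L \<subseteq> ?R")
      by blast
    have "card ?L \<le> card ?R"
      by (rule card_mono[OF _ sub]) (simp add: \<open>finite Q\<close> finite_signs)
    also have "\<dots> \<le> 6 ^ m" by (rule sign_quadruples) fact+
    finally show ?thesis .
  qed
  \<comment> \<open>Self-collisions of the pair map. Moving terms across the equation separates the
    blocks \<open>Q1\<close> and \<open>Q2\<close>, and a second use of Cauchy-Schwarz bounds the
    result by the geometric mean of 6^m and 6^m.\<close>
  define W where "W = {p \<in> (?P1 \<times> ?P2) \<times> (?P1 \<times> ?P2). \<phi> (fst p) = \<phi> (snd p)}"
  define W' where "W' = {p \<in> (?P1 \<times> ?P1) \<times> (?P2 \<times> ?P2). \<phi>1 (fst p) = \<phi>2 (snd p)}"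
  have "card W \<le> card W'"
  proof (rule card_inj_on_le)
    let ?h = "\<lambda>p :: (('c \<Rightarrow> real) \<times> ('c \<Rightarrow> real)) \<times> (('c \<Rightarrow> real) \<times> ('c \<Rightarrow> real)).
      ((fst (fst p), fst (snd p)), (snd (snd p), snd (fst p)))"
    show "inj_on ?h W" by (auto simp: inj_on_def)
    show "?h ` W \<subseteq> W'"
    proof (intro image_subsetI)
      fix p assume p: "p \<in> W"
      have "\<phi>1 (fst (fst p), fst (snd p)) = \<phi>2 (snd (snd p), snd (fst p))"
      proof
        fix i
        show "\<phi>1 (fst (fst p), fst (snd p)) i = \<phi>2 (snd (snd p), snd (fst p)) i"
        proof (cases "i \<in> S")
          case True
          have "\<phi> (fst p) i = \<phi> (snd p) i" using p by (simp add: W_def)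
          then show ?thesis using True
            by (simp add: \<phi>_def \<phi>1_def \<phi>2_def right_diff_distrib sum_subtractf)
        qed (simp add: \<phi>1_def \<phi>2_def)
      qed
      then show "?h p \<in> W'" using p by (auto simp: W_def W'_def)
    qed
    show "finite W'" using finP by (simp add: W'_def)
  qed
  then have "(real (card W))\<^sup>2 \<le> (real (card W'))\<^sup>2" by simp
  also have "\<dots> \<le> real (card {p \<in> (?P1 \<times> ?P1) \<times> (?P1 \<times> ?P1). \<phi>1 (fst p) = \<phi>1 (snd p)})
     * real (card {p \<in> (?P2 \<times> ?P2) \<times> (?P2 \<times> ?P2). \<phi>2 (fst p) = \<phi>2 (snd p)})"
    unfolding W'_def using finP by (intro collisions_Cauchy_Schwarz) auto
  also have "\<dots> \<le> real (6 ^ m) * real (6 ^ m)"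
    using quad[OF fin(2) card(1) ind(1) \<phi>1_def] quad[OF fin(3) card(2) ind(2) \<phi>2_def]
    by (intro mult_mono of_nat_mono) auto
  finally have "(real (card W))\<^sup>2 \<le> (6 ^ m)\<^sup>2" by (simp add: power2_eq_square)
  then have W: "real (card W) \<le> 6 ^ m" by (rule power2_le_imp_le) simp
  \<comment> \<open>Solutions are collisions of the block \<open>Q3\<close> with the pair of the
    other two. By invertibility \<open>\<psi>\<close> has only the 2^m diagonal self-collisions, so
    2^m * 6^m bounds the square.\<close>
  define Y where "Y = {p \<in> ?P3 \<times> (?P1 \<times> ?P2). \<psi> (fst p) = \<phi> (snd p)}"
  have "card X \<le> card Y"
  proof (rule card_inj_on_le)
    let ?h = "\<lambda>x. (restrict x Q3, (restrict x Q1, restrict x Q2))"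
    show "inj_on ?h X"
    proof (rule inj_onI)
      fix x y assume x: "x \<in> X" and y: "y \<in> X" and e: "?h x = ?h y"
      have "x z = y z" if "z \<in> Q1 \<union> Q2 \<union> Q3" for z
        using that e by (auto simp: restrict_eq_iff_agree agree_def)
      then show "x = y" by (rule PiE_ext[OF subsetD[OF X x] subsetD[OF X y]])
    qed
    show "?h ` X \<subseteq> Y"
    proof (intro image_subsetI)
      fix x assume x: "x \<in> X"
      have "restrict x Q \<in> signs Q" if "Q \<subseteq> Q1 \<union> Q2 \<union> Q3" for Q
        using X x that by (auto simp: PiE_iff extensional_def)
      moreover have "\<psi> (restrict x Q3) = \<phi> (restrict x Q1, restrict x Q2)"
      proof
        fix i
        show "\<psi> (restrict x Q3) i = \<phi> (restrict x Q1, restrict x Q2) i"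
        proof (cases "i \<in> S")
          case True
          have "(\<Sum>z\<in>Q1 \<union> Q2 \<union> Q3. A i z * x z)
              = (\<Sum>z\<in>Q1. A i z * x z) + (\<Sum>z\<in>Q2. A i z * x z) + (\<Sum>z\<in>Q3. A i z * x z)"
            using fin disj by (subst sum.union_disjoint, auto)+
          with eq[OF x True] True show ?thesis by (simp add: \<psi>_def \<phi>_def)
        qed (simp add: \<psi>_def \<phi>_def)
      qed
      ultimately show "?h x \<in> Y" by (auto simp: Y_def)
    qed
    show "finite Y" using finP by (simp add: Y_def)
  qed
  then have "(real (card X))\<^sup>2 \<le> (real (card Y))\<^sup>2" by simp
  also have "\<dots> \<le> real (card {p \<in> ?P3 \<times> ?P3. \<psi> (fst p) = \<psi> (snd p)}) * real (card W)"
    unfolding Y_def W_def using finP by (intro collisions_Cauchy_Schwarz) auto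
  also have "\<dots> \<le> 2 ^ m * 6 ^ m"
  proof (intro mult_mono W)
    have "{p \<in> ?P3 \<times> ?P3. \<psi> (fst p) = \<psi> (snd p)} \<subseteq> (\<lambda>x. (x, x)) ` ?P3"
    proof
      fix p assume p: "p \<in> {p \<in> ?P3 \<times> ?P3. \<psi> (fst p) = \<psi> (snd p)}"
      have "(\<Sum>z\<in>Q3. A i z * (fst p z - snd p z)) = 0" if "i \<in> S" for i
      proof -
        have "\<psi> (fst p) i = \<psi> (snd p) i" using p by simp
        then show ?thesis using that by (simp add: \<psi>_def right_diff_distrib sum_subtractf)
      qed
      then have "\<forall>z\<in>Q3. fst p z - snd p z = 0" by (intro inj ind) auto
      then have "fst p = snd p" using p by (intro PiE_ext[of "fst p" Q3 "\<lambda>_. {-1, 1}" "snd p"]) auto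
      then have "p = (fst p, fst p)" by (simp add: prod_eq_iff)
      moreover have "fst p \<in> ?P3" using p by auto
      ultimately show "p \<in> (\<lambda>x. (x, x)) ` ?P3" by (rule image_eqI)
    qed
    then have "card {p \<in> ?P3 \<times> ?P3. \<psi> (fst p) = \<psi> (snd p)} \<le> card ((\<lambda>x. (x, x)) ` ?P3)"
      using finP by (intro card_mono) auto
    also have "\<dots> \<le> card ?P3" using finP by (intro card_image_le) auto
    also have "\<dots> = 2 ^ m" using fin card by (simp add: card_signs)
    finally have "real (card {p \<in> ?P3 \<times> ?P3. \<psi> (fst p) = \<psi> (snd p)}) \<le> real (2 ^ m)"
      by (rule of_nat_mono)
    then show "real (card {p \<in> ?P3 \<times> ?P3. \<psi> (fst p) = \<psi> (snd p)}) \<le> 2 ^ m" by simp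
  qed auto
  finally show ?thesis by (simp add: power_mult_distrib[symmetric])
qed

text \<open>A change of basis reduces the system to three invertible blocks. In coordinates with
  respect to a column basis \<open>W\<close> made of \<open>Q3\<close> and a part \<open>Q0\<close>
  of \<open>Q1\<close>, the equations indexed by \<open>Q3\<close> do not involve the unknowns
  \<open>Q0\<close>, and each of \<open>Q1\<close>, \<open>Q2\<close>, \<open>Q3\<close> contains an
  invertible block for them. The remaining unknowns \<open>Y\<close> are free, the blocks are
  counted by \<open>three_blocks\<close>, and \<open>Q0\<close> is then determined.\<close>

lemma halasz_count:
  fixes A :: "'r \<Rightarrow> 'c \<Rightarrow> real"
  assumes fin: "finite Z" "finite I"
    and Q1: "Q1 \<subseteq> Z" "card Q1 = card I" "indep A I Q1"
    and Q2: "Q2 \<subseteq> Z - Q1"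
    and Q3: "Q3 \<subseteq> Z - Q1 - Q2" "card Q3 = m" "indep (tr A) Q3 I"
    and span: "\<And>z. z \<in> Q3 \<Longrightarrow> \<exists>l. \<forall>i\<in>I. A i z = (\<Sum>q\<in>Q2. l q * A i q)"
    and X: "X \<subseteq> signs Z"
    and eq: "\<And>x y i. x \<in> X \<Longrightarrow> y \<in> X \<Longrightarrow> i \<in> I \<Longrightarrow> (\<Sum>z\<in>Z. A i z * (x z - y z)) = 0"
  shows "real (card X) \<le> 2 ^ (card Z - card I) * sqrt ((3/4) ^ m)"
proof -
  have finQ: "finite Q1" "finite Q2" "finite Q3" using Q1 Q2 Q3 fin by (auto intro: finite_subset)
  obtain W where W: "Q3 \<subseteq> W" "W \<subseteq> Q3 \<union> Q1" "indep (tr A) W I"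
    "\<And>z. z \<in> Q3 \<union> Q1 - W \<Longrightarrow> \<not> indep (tr A) (insert z W) I"
    using ex_maximal_indep[of "Q3 \<union> Q1" Q3 "tr A" I] finQ Q3 by auto
  have finW: "finite W" using W(2) finQ by (meson finite_UnI finite_subset)
  define Q0 where "Q0 = W - Q3"
  have Q0: "Q0 \<subseteq> Q1" "W = Q3 \<union> Q0" "Q3 \<inter> Q0 = {}" using W by (auto simp: Q0_def)
  have indW: "indep A I W"
  proof (rule indep_of_spanning[OF Q1(3)])
    fix z assume "z \<in> Q1"
    then show "\<exists>l. \<forall>r\<in>I. A r z = (\<Sum>q\<in>W. l q * A r q)"
      using maximal_cols_span[OF finW W(3)] W(4) indep_self_span[OF finW] by (cases "z \<in> W") auto
  qed
  have cW: "card W = card I"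
    using indep_card_le[OF indW fin(2) finW] indep_card_le[OF W(3) finW fin(2)] by simp
  have "\<exists>\<kappa>. \<forall>z. \<forall>i\<in>I. A i z = (\<Sum>w\<in>W. \<kappa> z w * A i w)"
    using square_cols_span[OF indW fin(2) finW cW] by (intro choice) blast
  then obtain \<kappa> where \<kappa>: "\<And>z i. i \<in> I \<Longrightarrow> A i z = (\<Sum>w\<in>W. \<kappa> z w * A i w)" by blast
  have uniq: "g w = 0" if "\<And>i. i \<in> I \<Longrightarrow> (\<Sum>w\<in>W. g w * A i w) = 0" "w \<in> W" for g w
    using indepD[OF W(3), of g] that by (simp add: tr_def)
  have \<kappa>W: "\<kappa> v w = (if w = v then 1 else 0)" if "v \<in> W" "w \<in> W" for v w
  proof -
    have "\<kappa> v w - (if w = v then 1 else 0) = 0"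
    proof (rule uniq[OF _ that(2)])
      fix i assume "i \<in> I"
      have "(\<Sum>w\<in>W. (if w = v then 1 else 0) * A i w) = (\<Sum>w\<in>W. if w = v then A i w else 0)"
        by (intro sum.cong) auto
      also have "\<dots> = A i v" using finW that by simp
      finally show "(\<Sum>w\<in>W. (\<kappa> v w - (if w = v then 1 else 0)) * A i w) = 0"
        using \<kappa>[OF \<open>i \<in> I\<close>, of v] by (simp add: left_diff_distrib sum_subtractf)
    qed
    then show ?thesis by simp
  qed
  \<comment> \<open>Row \<open>w\<close> of \<open>B\<close> is the system solved for the unknown
    \<open>w\<close>; on the columns \<open>W\<close> it is the identity matrix.\<close>
  define B where "B w z = \<kappa> z w" for w z
  have kill: "(\<Sum>z\<in>Z. B w z * d z) = 0"
    if d: "\<And>i. i \<in> I \<Longrightarrow> (\<Sum>z\<in>Z. A i z * d z) = 0" and w: "w \<in> W" for d w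
  proof (rule uniq[OF _ w])
    fix i assume i: "i \<in> I"
    have "(\<Sum>w\<in>W. (\<Sum>z\<in>Z. B w z * d z) * A i w) = (\<Sum>w\<in>W. \<Sum>z\<in>Z. \<kappa> z w * A i w * d z)"
      by (simp add: B_def sum_distrib_left sum_distrib_right mult_ac)
    also have "\<dots> = (\<Sum>z\<in>Z. \<Sum>w\<in>W. \<kappa> z w * A i w * d z)" by (rule sum.swap)
    also have "\<dots> = (\<Sum>z\<in>Z. A i z * d z)"
      using \<kappa>[OF i, symmetric] by (simp add: sum_distrib_right[symmetric])
    finally show "(\<Sum>w\<in>W. (\<Sum>z\<in>Z. B w z * d z) * A i w) = 0" using d[OF i] by simp
  qed
  \<comment> \<open>Any set of columns that spans those of \<open>Q3\<close> has full rank for these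
    equations. This is applied to \<open>Q2\<close>, \<open>Q1\<close> and \<open>Q3\<close>
    itself.\<close>
  have indB: "indep B Q3 Q"
    if sp: "\<And>z. z \<in> Q3 \<Longrightarrow> \<exists>l. \<forall>i\<in>I. A i z = (\<Sum>q\<in>Q. l q * A i q)" for Q
  proof (rule indepI)
    fix f v assume h: "\<And>q. q \<in> Q \<Longrightarrow> (\<Sum>w\<in>Q3. f w * B w q) = 0" and v: "v \<in> Q3"
    obtain l where l: "\<forall>i\<in>I. A i v = (\<Sum>q\<in>Q. l q * A i q)" using sp[OF v] by blast
    have vW: "v \<in> W" using v Q0 by simp
    have k: "\<kappa> v w = (\<Sum>q\<in>Q. l q * \<kappa> q w)" if "w \<in> W" for w
    proof -
      have "\<kappa> v w - (\<Sum>q\<in>Q. l q * \<kappa> q w) = 0"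
      proof (rule uniq[OF _ that])
        fix i assume i: "i \<in> I"
        have "(\<Sum>w\<in>W. (\<Sum>q\<in>Q. l q * \<kappa> q w) * A i w) = (\<Sum>w\<in>W. \<Sum>q\<in>Q. l q * (\<kappa> q w * A i w))"
          by (simp add: sum_distrib_right mult.assoc)
        also have "\<dots> = (\<Sum>q\<in>Q. \<Sum>w\<in>W. l q * (\<kappa> q w * A i w))" by (rule sum.swap)
        also have "\<dots> = (\<Sum>q\<in>Q. l q * A i q)"
          using \<kappa>[OF i, symmetric] by (simp add: sum_distrib_left[symmetric])
        also have "\<dots> = A i v" using l i by simp
        finally show "(\<Sum>w\<in>W. (\<kappa> v w - (\<Sum>q\<in>Q. l q * \<kappa> q w)) * A i w) = 0"
          using \<kappa>[OF i, of v] by (simp add: left_diff_distrib sum_subtractf)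
      qed
      then show ?thesis by simp
    qed
    have "f v = (\<Sum>w\<in>Q3. f w * \<kappa> v w)"
    proof -
      have "(\<Sum>w\<in>Q3. f w * \<kappa> v w) = (\<Sum>w\<in>Q3. if w = v then f w else 0)"
        using \<kappa>W[OF vW] Q0 by (intro sum.cong) auto
      then show ?thesis using v finQ by simp
    qed
    also have "\<dots> = (\<Sum>w\<in>Q3. \<Sum>q\<in>Q. l q * (f w * \<kappa> q w))"
      using k Q0 by (intro sum.cong) (auto simp: sum_distrib_left mult_ac)
    also have "\<dots> = (\<Sum>q\<in>Q. l q * (\<Sum>w\<in>Q3. f w * B w q))"
      by (subst sum.swap) (simp add: sum_distrib_left B_def)
    also have "\<dots> = 0" using h by simp
    finally show "f v = 0" .
  qed
  obtain P2 where P2: "P2 \<subseteq> Q2" "card P2 = m" "indep (tr B) P2 Q3"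
    using ex_square_subset[OF indB[OF span] finQ(3,2)] Q3(2) by metis
  have "indep B Q3 Q1"
    by (rule indB, rule square_cols_span[OF Q1(3) fin(2) finQ(1) Q1(2)])
  then obtain P1 where P1: "P1 \<subseteq> Q1" "card P1 = m" "indep (tr B) P1 Q3"
    using ex_square_subset[OF _ finQ(3,1)] Q3(2) by metis
  have "indep B Q3 Q3"
    by (rule indB, rule indep_self_span[OF finQ(3)])
  then have P3: "indep (tr B) Q3 Q3" using indep_square finQ by blast
  have BQ0: "B w z = 0" if "w \<in> Q3" "z \<in> Q0" for w z
    using \<kappa>W[of z w] that Q0 by (auto simp: B_def)
  \<comment> \<open>The columns \<open>Q0\<close> are zero in the equations \<open>Q3\<close>, so an
    independent set of columns avoids them.\<close>
  have P1Q0: "P1 \<inter> Q0 = {}"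
  proof (rule ccontr)
    assume "P1 \<inter> Q0 \<noteq> {}"
    then obtain z where z: "z \<in> P1" "z \<in> Q0" by blast
    have fP1: "finite P1" using P1 finQ finite_subset by auto
    have "(if z = z then 1 else 0 :: real) = 0"
    proof (rule indepD[OF P1(3), of "\<lambda>r. if r = z then 1 else 0" z])
      fix c assume c: "c \<in> Q3"
      have "(\<Sum>r\<in>P1. (if r = z then 1 else 0) * tr B r c) = (\<Sum>r\<in>P1. if r = z then tr B r c else 0)"
        by (intro sum.cong) auto
      then show "(\<Sum>r\<in>P1. (if r = z then 1 else 0) * tr B r c) = 0"
        using fP1 z BQ0[OF c z(2)] by (simp add: tr_def)
    qed (use z in simp)
    then show False by simp
  qed
  have finP: "finite P1" "finite P2" "finite Q0" using P1 P2 Q0 finQ by (auto intro: finite_subset)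
  define U where "U = P1 \<union> P2 \<union> Q3"
  have finU: "finite U" using finP finQ by (simp add: U_def)
  have UQ0: "U \<inter> Q0 = {}" "U \<union> Q0 \<subseteq> Z" using P1Q0 P1 P2 Q0 Q1 Q2 Q3 by (auto simp: U_def)
  have cU: "card U = 3 * m"
  proof -
    have "card (P1 \<union> P2) = 2 * m" using P1 P2 Q2 finP by (subst card_Un_disjoint) auto
    then show ?thesis using P1 P2 Q3 finP finQ Q1 Q2 unfolding U_def by (subst card_Un_disjoint) auto
  qed
  have cQ0: "card Q0 + m = card I"
    using cW Q0 finQ finP Q3(2) by (simp add: card_Un_disjoint)
  define Y where "Y = Z - (U \<union> Q0)"
  have cY: "card Y + 2 * m + card I = card Z"
  proof -
    have "card Z = card Y + card (U \<union> Q0)"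
      using UQ0 fin(1) unfolding Y_def by (metis card_Diff_subset card_mono finite_subset le_add_diff_inverse2)
    also have "card (U \<union> Q0) = 3 * m + card Q0" using UQ0 finU finP cU by (simp add: card_Un_disjoint)
    finally show ?thesis using cQ0 by simp
  qed
  have finX: "finite X" using X finite_signs[OF fin(1)] finite_subset by blast
  have sgn: "x z \<in> {-1, 1}" if "x \<in> X" "z \<in> Z" for x z using X that by (auto dest!: subsetD PiE_mem)
  have "real (cnt Z X) \<le> real (cnt Y X) * sqrt (12 ^ m)"
  proof (rule cnt_step[OF finX])
    show "Y \<subseteq> Z" by (auto simp: Y_def)
    fix M0 assume M0: "M0 \<in> X"
    define N where "N = {M \<in> X. agree Y M M0}"
    have NX: "N \<subseteq> X" by (auto simp: N_def)
    have agY: "x z = y z" if "x \<in> N" "y \<in> N" "z \<in> Y" for x y z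
      using that by (auto simp: N_def agree_def)
    have split: "(\<Sum>z\<in>Z. F z) = (\<Sum>z\<in>U. F z) + (\<Sum>z\<in>Q0. F z) + (\<Sum>z\<in>Y. F z)" for F :: "'c \<Rightarrow> real"
    proof -
      have "Z = (U \<union> Q0) \<union> Y" using UQ0 by (auto simp: Y_def)
      then have "sum F Z = sum F ((U \<union> Q0) \<union> Y)" by simp
      also have "\<dots> = sum F (U \<union> Q0) + sum F Y"
        using finU finP fin by (intro sum.union_disjoint) (auto simp: Y_def)
      also have "sum F (U \<union> Q0) = sum F U + sum F Q0"
        using finU finP UQ0 by (intro sum.union_disjoint) auto
      finally show ?thesis .
    qed
    have eqB: "(\<Sum>z\<in>U. B w z * (x z - y z)) = 0" if "x \<in> N" "y \<in> N" "w \<in> Q3" for x y w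
    proof -
      have "(\<Sum>z\<in>Z. B w z * (x z - y z)) = 0"
        by (rule kill) (use eq that NX Q0 in auto)
      moreover have "(\<Sum>z\<in>Y. B w z * (x z - y z)) = 0" using agY[OF that(1,2)] by simp
      moreover have "(\<Sum>z\<in>Q0. B w z * (x z - y z)) = 0" using BQ0[OF that(3)] by simp
      ultimately show ?thesis using split[of "\<lambda>z. B w z * (x z - y z)"] by simp
    qed
    define h where "h = (\<lambda>x :: 'c \<Rightarrow> real. restrict x U)"
    have "cnt Z N \<le> card (h ` N)"
    proof (rule cnt_le_inj[where h = h])
      fix x y assume x: "x \<in> N" and y: "y \<in> N" and e: "h x = h y"
      then have U0: "x z = y z" if "z \<in> U" for z
        using that by (auto simp: h_def restrict_eq_iff_agree agree_def)
      have "x z - y z = 0" if z: "z \<in> Q0" for z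
      proof -
        have s0: "indep (tr A) Q0 I" by (rule indep_subset_rows[OF W(3)]) (use Q0 finW in auto)
        show ?thesis
        proof (rule indepD[OF s0, of "\<lambda>z. x z - y z" z])
          fix i assume i: "i \<in> I"
          have "(\<Sum>z\<in>Z. A i z * (x z - y z)) = 0" using eq x y i NX by auto
          moreover have "(\<Sum>z\<in>U. A i z * (x z - y z)) = 0" "(\<Sum>z\<in>Y. A i z * (x z - y z)) = 0"
            using U0 agY[OF x y] by simp_all
          ultimately show "(\<Sum>r\<in>Q0. (x r - y r) * tr A r i) = 0"
            using split[of "\<lambda>z. A i z * (x z - y z)"] by (simp add: tr_def mult.commute)
        qed (use z in simp)
      qed
      then show "agree Z x y" using U0 agY[OF x y] by (auto simp: agree_def Y_def)
    qed (use finX NX finite_subset in auto)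
    moreover have "(real (card (h ` N)))\<^sup>2 \<le> 12 ^ m"
    proof (rule three_blocks[of Q3 P1 P2 Q3 m B "h ` N" "\<lambda>w. \<Sum>z\<in>U. B w z * M0 z"])
      show "h ` N \<subseteq> signs (P1 \<union> P2 \<union> Q3)"
        unfolding h_def U_def[symmetric]
      proof (intro image_subsetI PiE_I)
        fix x z assume "x \<in> N" "z \<in> U"
        then show "restrict x U z \<in> {-1, 1}" using sgn[of x z] NX UQ0 by auto
      qed simp
      fix x w assume "x \<in> h ` N" and w: "w \<in> Q3"
      then obtain y where y: "y \<in> N" "x = h y" by blast
      have "M0 \<in> N" using M0 by (simp add: N_def agree_def)
      from eqB[OF y(1) this w] have "(\<Sum>z\<in>U. B w z * y z) = (\<Sum>z\<in>U. B w z * M0 z)"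
        by (simp add: right_diff_distrib sum_subtractf)
      then show "(\<Sum>z\<in>P1 \<union> P2 \<union> Q3. B w z * x z) = (\<Sum>z\<in>U. B w z * M0 z)"
        by (simp add: y h_def U_def[symmetric])
    qed (use finP finQ P1 P2 P3 Q1 Q2 Q3 in auto)
    ultimately have "(real (cnt Z N))\<^sup>2 \<le> 12 ^ m"
      by (meson of_nat_0_le_iff of_nat_mono order_trans power_mono)
    then have "real (cnt Z N) \<le> sqrt (12 ^ m)" by (rule real_le_rsqrt)
    then show "real (cnt Z {M \<in> X. agree Y M M0}) \<le> sqrt (12 ^ m)" by (simp add: N_def)
  qed
  also have "\<dots> \<le> 2 ^ card Y * sqrt (12 ^ m)"
  proof (rule mult_right_mono)
    show "real (cnt Y X) \<le> 2 ^ card Y"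
      by (rule cnt_le_determined[of Y]) (use fin sgn in \<open>auto simp: Y_def\<close>)
  qed simp
  \<comment> \<open>Since card Z - card I = card Y + 2 m, the trivial count for the blocks is 4^m,
    and sqrt 12 = 4 * sqrt (3/4).\<close>
  also have "\<dots> = 2 ^ (card Z - card I) * sqrt ((3/4) ^ m)"
  proof -
    have "card Z - card I = card Y + 2 * m" using cY by simp
    then have "(2::real) ^ (card Z - card I) = 2 ^ card Y * 4 ^ m" by (simp add: power_add power_mult)
    moreover have "(12::real) ^ m = (4 ^ m)\<^sup>2 * (3/4) ^ m"
      by (simp add: power_mult_distrib[symmetric] power2_eq_square)
    then have "sqrt (12 ^ m) = 4 ^ m * sqrt ((3/4) ^ m)" by (simp add: real_sqrt_mult)
    ultimately show ?thesis by simp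
  qed
  finally show ?thesis using cnt_full[OF X] by simp
qed

section \<open>Quasi-normal matrices and sequential exposure\<close>

text \<open>The right-hand side \<open>N\<close> is arbitrary because fixing all entries outside a principal block
  changes it; this makes the class stable under restriction to principal blocks.\<close>

definition QN :: "'v set \<Rightarrow> ('v \<Rightarrow> 'v \<Rightarrow> real) \<Rightarrow> ('v \<times> 'v \<Rightarrow> real) set" where
  "QN V N = {M \<in> signs (V \<times> V). \<forall>i\<in>V. \<forall>k\<in>V.
      (\<Sum>l\<in>V. M (i, l) * M (k, l) - M (l, i) * M (l, k)) = N i k}"

text \<open>\<open>row M i\<close> is row \<open>i\<close> (flag \<open>True\<close>) followed by column \<open>i\<close> (flag \<open>False\<close>) of \<open>M\<close>. The sign \<open>sg\<close>
  that the normality equations attach to the column half is irrelevant for ranks.\<close>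

definition cell :: "'v \<Rightarrow> 'v \<times> bool \<Rightarrow> 'v \<times> 'v" where
  "cell i z = (if snd z then (i, fst z) else (fst z, i))"

definition row :: "('v \<times> 'v \<Rightarrow> real) \<Rightarrow> 'v \<Rightarrow> 'v \<times> bool \<Rightarrow> real" where
  "row M i z = M (cell i z)"

definition sg :: "'v \<times> bool \<Rightarrow> real" where
  "sg z = (if snd z then 1 else - 1)"

text \<open>The diagonal is included from the start, at the price of n bits in all. Otherwise
  \<open>(k, True)\<close> and \<open>(k, False)\<close> would name the same unknown cell, and the
  equation between \<open>i\<close> and \<open>k\<close> would contain the unknown entry at
  \<open>(k, k)\<close>.\<close>

definition known :: "'v set \<Rightarrow> 'v set \<Rightarrow> ('v \<times> 'v) set" where
  "known V P = {p \<in> V \<times> V. fst p \<in> P \<or> snd p \<in> P \<or> fst p = snd p}"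

lemma sg_nz [simp]: "sg z \<noteq> 0"
  by (simp add: sg_def)

lemma cell_simps [simp]: "cell i (j, True) = (i, j)" "cell i (j, False) = (j, i)"
  by (simp_all add: cell_def)

lemma QN_sign: "M \<in> QN V N \<Longrightarrow> c \<in> V \<times> V \<Longrightarrow> M c \<in> {-1, 1}"
  by (cases c) (auto simp: QN_def dest: PiE_mem)

lemma finite_QN: "finite V \<Longrightarrow> finite (QN V N)"
  unfolding QN_def by (simp add: finite_signs)

lemma known_sub: "known V P \<subseteq> V \<times> V"
  by (auto simp: known_def)

lemma known_mono: "P \<subseteq> P' \<Longrightarrow> known V P \<subseteq> known V P'"
  by (auto simp: known_def)

lemma cell_known:
  assumes "i \<in> P" "P \<subseteq> V" "fst z \<in> V"
  shows "cell i z \<in> known V P"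
  using assms by (auto simp: known_def cell_def)

lemma known_insert:
  assumes "P \<subseteq> V" "k \<in> V"
  shows "known V (insert k P) = known V P \<union> cell k ` ((V - P - {k}) \<times> UNIV)"
proof
  show "known V (insert k P) \<subseteq> known V P \<union> cell k ` ((V - P - {k}) \<times> UNIV)"
  proof
    fix p assume p: "p \<in> known V (insert k P)"
    obtain i j where e: "p = (i, j)" by (cases p)
    show "p \<in> known V P \<union> cell k ` ((V - P - {k}) \<times> UNIV)"
    proof (cases "p \<in> known V P")
      case False
      with p e have ij: "i \<in> V" "j \<in> V" "i \<notin> P" "j \<notin> P" "i \<noteq> j" "i = k \<or> j = k"
        by (auto simp: known_def)
      then have "p = cell k (j, True) \<and> j \<in> V - P - {k} \<or> p = cell k (i, False) \<and> i \<in> V - P - {k}"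
        using e by auto
      then show ?thesis by blast
    qed simp
  qed
  show "known V P \<union> cell k ` ((V - P - {k}) \<times> UNIV) \<subseteq> known V (insert k P)"
    using assms by (auto simp: known_def cell_def)
qed

lemma sum_times_bool: "(\<Sum>z\<in>J \<times> (UNIV :: bool set). f z) = (\<Sum>l\<in>J. f (l, True) + f (l, False))"
  for f :: "'v \<times> bool \<Rightarrow> real"
proof -
  have "(\<Sum>z\<in>J \<times> (UNIV :: bool set). f z) = (\<Sum>l\<in>J. \<Sum>b\<in>UNIV. f (l, b))"
    by (simp add: sum.cartesian_product)
  then show ?thesis by (simp add: UNIV_bool add.commute)
qed

text \<open>With row and column \<open>i\<close> known, the equation for \<open>(i, k)\<close> is
  linear in row and column \<open>k\<close>. Indices outside \<open>V - P - {k}\<close> contribute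
  known terms, and subtracting the equations of \<open>M\<close> and \<open>M'\<close> removes these
  terms and \<open>N\<close>.\<close>

lemma linear_equations:
  assumes V: "finite V" "P \<subseteq> V" "k \<in> V" "i \<in> P"
    and M: "M \<in> QN V N" "M' \<in> QN V N" and ag: "agree (known V P) M M'"
  shows "(\<Sum>z\<in>(V - P - {k}) \<times> UNIV. sg z * row M i z * (row M k z - row M' k z)) = 0"
proof -
  let ?J = "V - P - {k}"
  let ?f = "\<lambda>M l. M (i, l) * M (k, l) - M (l, i) * M (l, k) :: real"
  have ikn: "M (i, l) = M' (i, l)" "M (l, i) = M' (l, i)" if "l \<in> V" for l
    using ag that V by (auto simp: agree_def known_def)
  have "?f M l = ?f M' l" if "l \<in> V - ?J" for l
  proof -
    have "M (k, l) = M' (k, l)" "M (l, k) = M' (l, k)"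
      using ag that V by (auto simp: agree_def known_def)
    then show ?thesis using ikn that by simp
  qed
  then have "(\<Sum>l\<in>V - ?J. ?f M l - ?f M' l) = 0" by simp
  moreover have "(\<Sum>l\<in>V. ?f M l - ?f M' l) = 0"
    using M V by (auto simp: QN_def sum_subtractf)
  moreover have "(\<Sum>l\<in>V. ?f M l - ?f M' l) = (\<Sum>l\<in>V - ?J. ?f M l - ?f M' l) + (\<Sum>l\<in>?J. ?f M l - ?f M' l)"
    using V by (intro sum.subset_diff) auto
  ultimately have "(\<Sum>l\<in>?J. ?f M l - ?f M' l) = 0" by simp
  also have "(\<Sum>l\<in>?J. ?f M l - ?f M' l)
      = (\<Sum>l\<in>?J. M (i, l) * (M (k, l) - M' (k, l)) + - (M (l, i) * (M (l, k) - M' (l, k))))"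
    using ikn by (intro sum.cong) (auto simp: algebra_simps)
  also have "\<dots> = (\<Sum>z\<in>?J \<times> UNIV. sg z * row M i z * (row M k z - row M' k z))"
    unfolding sum_times_bool by (simp add: sg_def row_def)
  finally show ?thesis .
qed

text \<open>Two candidates that agree off \<open>Q\<close> differ by a relation between the
  independent columns \<open>Q\<close>, so the entries at \<open>Q\<close> are determined by the
  others.\<close>

lemma step_odlyzko:
  assumes V: "finite V" "P \<subseteq> V" "k \<in> V - P" and MM: "\<M> \<subseteq> QN V N" and M0: "M0 \<in> \<M>"
    and I: "I \<subseteq> P" and Q: "Q \<subseteq> (V - P - {k}) \<times> UNIV" and ind: "indep (tr (row M0)) Q I"
  shows "real (cnt (known V (insert k P)) {M \<in> \<M>. agree (known V P) M M0})
          \<le> 2 ^ (2 * card (V - P - {k}) - card Q)"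
proof -
  let ?J = "V - P - {k}"
  let ?Z = "?J \<times> (UNIV :: bool set)"
  have fZ: "finite ?Z" using V by simp
  have fQ: "finite Q" using Q fZ finite_subset by blast
  let ?D = "cell k ` (?Z - Q)"
  show ?thesis
  proof (rule cnt_le_determined[of ?D])
    show "finite ?D" using fZ by simp
    have "card ?D \<le> card (?Z - Q)" using fZ by (intro card_image_le) simp
    also have "\<dots> = card ?Z - card Q" using Q fQ by (simp add: card_Diff_subset)
    finally show "card ?D \<le> 2 * card ?J - card Q" by (simp add: card_cartesian_product)
    show "M c \<in> {-1, 1}" if "M \<in> {M \<in> \<M>. agree (known V P) M M0}" "c \<in> ?D" for M c
      using that MM V by (intro QN_sign[of M V N]) (auto simp: cell_def)
    fix M M' assume M: "M \<in> {M \<in> \<M>. agree (known V P) M M0}"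
      and M': "M' \<in> {M \<in> \<M>. agree (known V P) M M0}" and ag: "agree ?D M M'"
    have agP: "agree (known V P) M M'" using M M' by (auto simp: agree_def)
    define d where "d z = row M k z - row M' k z" for z
    have d0: "d z = 0" if "z \<in> ?Z - Q" for z
    proof -
      have "\<forall>z\<in>?Z - Q. M (cell k z) = M' (cell k z)" using ag unfolding agree_def by (simp only: ball_simps)
      then show ?thesis using that by (simp only: d_def row_def diff_self)
    qed
    \<comment> \<open>The sign is moved from the column to the difference, so that independence of
      the unsigned columns suffices.\<close>
    have "sg z * d z = 0" if "z \<in> Q" for z
    proof (rule indepD[OF ind, of "\<lambda>z. sg z * d z"])
      fix i assume i: "i \<in> I"
      have "(\<Sum>z\<in>?Z. sg z * row M i z * d z) = 0"
        unfolding d_def by (rule linear_equations[where N = N]) (use V i I M M' MM agP in auto)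
      also have "(\<Sum>z\<in>?Z. sg z * row M i z * d z) = (\<Sum>z\<in>Q. sg z * row M i z * d z)"
        using Q fZ d0 by (intro sum.mono_neutral_right) auto
      also have "\<dots> = (\<Sum>z\<in>Q. sg z * d z * tr (row M0) z i)"
      proof (rule sum.cong[OF refl])
        fix z assume "z \<in> Q"
        then have "cell i z \<in> known V P" using Q i I V by (intro cell_known) auto
        then have "row M i z = row M0 i z" using M by (simp add: agree_def row_def)
        then show "sg z * row M i z * d z = sg z * d z * tr (row M0) z i" by (simp add: tr_def)
      qed
      finally show "(\<Sum>z\<in>Q. sg z * d z * tr (row M0) z i) = 0" .
    qed (use that in simp)
    then have "d z = 0" if "z \<in> ?Z" for z using d0 that by fastforce
    then have "agree (cell k ` ?Z) M M'" by (auto simp: agree_def d_def row_def)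
    then show "agree (known V (insert k P)) M M'"
      using agP V by (simp add: known_insert agree_Un)
  qed
qed

lemma indep_scale_cols:
  assumes "\<And>z. s z \<noteq> (0::real)"
  shows "indep (\<lambda>i z. s z * A i z) R C \<longleftrightarrow> indep A R C"
proof -
  have "(\<Sum>r\<in>R. f r * (s c * A r c)) = s c * (\<Sum>r\<in>R. f r * A r c)" for f c
    by (simp add: sum_distrib_left mult.left_commute)
  then show ?thesis using assms unfolding indep_def by simp
qed

text \<open>The bound 2 * card P on deleted indices is what two independent column sets can occupy.
  \<open>Q1\<close> is a basis, \<open>Q2\<close> a maximal independent set away from the indices of
  \<open>Q1\<close>. By maximality \<open>Q2\<close> spans every later column, so it need not be a
  basis itself, and \<open>rank\<close> supplies \<open>Q3\<close> away from both.\<close>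

lemma step_halasz:
  assumes V: "finite V" "P \<subseteq> V" "k \<in> V - P" and MM: "\<M> \<subseteq> QN V N" and M0: "M0 \<in> \<M>"
    and ind: "indep (row M0) P ((V - P - {k}) \<times> UNIV)"
    and rank: "\<And>J. J \<subseteq> V - P - {k} \<Longrightarrow> card J \<le> 2 * card P \<Longrightarrow>
        \<exists>S\<subseteq>P. card S = m \<and> indep (row M0) S ((V - P - {k} - J) \<times> UNIV)"
  shows "real (cnt (known V (insert k P)) {M \<in> \<M>. agree (known V P) M M0})
          \<le> 2 ^ (2 * card (V - P - {k}) - card P) * sqrt ((3/4) ^ m)"
proof -
  let ?J = "V - P - {k}"
  let ?Z = "?J \<times> (UNIV :: bool set)"
  let ?F = "{M \<in> \<M>. agree (known V P) M M0}"
  have fZ: "finite ?Z" and fP: "finite P" using V finite_subset by auto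
  define A where "A i z = sg z * row M0 i z" for i z
  have Aind: "indep A R C \<longleftrightarrow> indep (row M0) R C" for R C
    unfolding A_def by (rule indep_scale_cols) simp
  have "indep A P ?Z" using ind Aind by simp
  then obtain Q1 where Q1: "Q1 \<subseteq> ?Z" "card Q1 = card P" "indep A P Q1"
    using ex_square_subset[OF _ fP fZ] by metis
  have fQ1: "finite Q1" using Q1(1) fZ finite_subset by blast
  let ?C2 = "(?J - fst ` Q1) \<times> (UNIV :: bool set)"
  have "finite ?C2" using V by simp
  then obtain Q2 where Q2: "Q2 \<subseteq> ?C2" "indep (tr A) Q2 P"
    "\<And>z. z \<in> ?C2 - Q2 \<Longrightarrow> \<not> indep (tr A) (insert z Q2) P"
    using ex_maximal_indep[of ?C2 "{}" "tr A" P] by auto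
  have fQ2: "finite Q2" using Q2(1) \<open>finite ?C2\<close> finite_subset by blast
  define J where "J = fst ` Q1 \<union> fst ` Q2"
  have "card (fst ` Q1) \<le> card P" using card_image_le[OF fQ1, of fst] Q1(2) by simp
  moreover have "card (fst ` Q2) \<le> card P"
    using card_image_le[OF fQ2, of fst] indep_card_le[OF Q2(2) fQ2 fP] by simp
  ultimately have "card J \<le> 2 * card P"
    unfolding J_def using card_Un_le[of "fst ` Q1" "fst ` Q2"] by linarith
  moreover have "J \<subseteq> ?J" using Q1(1) Q2(1) by (auto simp: J_def)
  ultimately obtain S where S: "S \<subseteq> P" "card S = m" "indep A S ((?J - J) \<times> UNIV)"
    using rank[of J] Aind by blast
  have "finite S" "finite ((?J - J) \<times> (UNIV :: bool set))" using S(1) fP V finite_subset by auto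
  then obtain Q3 where Q3: "Q3 \<subseteq> (?J - J) \<times> UNIV" "card Q3 = m" "indep (tr A) Q3 S"
    using ex_square_subset[OF S(3)] S(2) by metis
  define X where "X = (\<lambda>M. restrict (row M k) ?Z) ` ?F"
  have "cnt (known V (insert k P)) ?F \<le> card X"
  proof (rule cnt_le_inj[where h = "\<lambda>M. restrict (row M k) ?Z"])
    have "finite \<M>" using MM finite_QN[OF V(1)] finite_subset by blast
    then show "finite X" by (simp add: X_def)
    fix M M' assume M: "M \<in> ?F" and M': "M' \<in> ?F" and e: "restrict (row M k) ?Z = restrict (row M' k) ?Z"
    have "row M k z = row M' k z" if "z \<in> ?Z" for z
      using fun_cong[OF e, of z] that by (simp only: restrict_apply' if_True)
    then have "agree (cell k ` ?Z) M M'" by (auto simp: agree_def row_def)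
    moreover have "agree (known V P) M M'" using M M' by (auto simp: agree_def)
    ultimately show "agree (known V (insert k P)) M M'"
      using V by (simp add: known_insert agree_Un)
  qed (auto simp: X_def)
  also have "real (card X) \<le> 2 ^ (card ?Z - card P) * sqrt ((3/4) ^ m)"
  proof (rule halasz_count[OF fZ fP Q1])
    show "Q2 \<subseteq> ?Z - Q1" using Q2(1) by force
    show "Q3 \<subseteq> ?Z - Q1 - Q2" using Q3(1) unfolding J_def by force
    show "card Q3 = m" by fact
    show "indep (tr A) Q3 P" by (rule indep_mono_cols[OF Q3(3) S(1)])
    show "\<exists>l. \<forall>i\<in>P. A i z = (\<Sum>q\<in>Q2. l q * A i q)" if "z \<in> Q3" for z
    proof (cases "z \<in> Q2")
      case False
      have "z \<in> ?C2" using that Q3(1) unfolding J_def by force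
      with False Q2(3) have "\<not> indep (tr A) (insert z Q2) P" by blast
      then show ?thesis by (rule maximal_cols_span[OF fQ2 Q2(2)])
    qed (rule indep_self_span[OF fQ2])
    show "X \<subseteq> signs ?Z"
      unfolding X_def
    proof (intro image_subsetI PiE_I)
      fix M z assume "M \<in> ?F" "z \<in> ?Z"
      then have "M (cell k z) \<in> {-1, 1}" using MM V by (intro QN_sign[of M V N]) (auto simp: cell_def)
      then show "restrict (row M k) ?Z z \<in> {-1, 1}" using \<open>z \<in> ?Z\<close> by (simp only: row_def restrict_apply' if_True)
    qed (simp only: restrict_apply if_False)
    fix x y i assume "x \<in> X" "y \<in> X" and i: "i \<in> P"
    then obtain M M' where M: "M \<in> ?F" "x = restrict (row M k) ?Z" "M' \<in> ?F" "y = restrict (row M' k) ?Z"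
      unfolding X_def by blast
    have agP: "agree (known V P) M M'" using M by (auto simp: agree_def)
    have "(\<Sum>z\<in>?Z. sg z * row M i z * (row M k z - row M' k z)) = 0"
      by (rule linear_equations[where N = N]) (use V i M MM agP in auto)
    also have "(\<Sum>z\<in>?Z. sg z * row M i z * (row M k z - row M' k z)) = (\<Sum>z\<in>?Z. A i z * (x z - y z))"
    proof (rule sum.cong[OF refl])
      fix z assume z: "z \<in> ?Z"
      then have "cell i z \<in> known V P" using i V by (intro cell_known) auto
      then have "row M i z = row M0 i z" using M(1) by (simp add: agree_def row_def)
      moreover have "x z = row M k z" "y z = row M' k z"
        unfolding M(2,4) using z by (simp_all only: restrict_apply' if_True)
      ultimately show "sg z * row M i z * (row M k z - row M' k z) = A i z * (x z - y z)"
        by (simp add: A_def)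
    qed
    finally show "(\<Sum>z\<in>?Z. A i z * (x z - y z)) = 0" .
  qed
  finally show ?thesis by (simp add: card_cartesian_product mult.commute)
qed

lemma cnt_chain:
  assumes fin: "finite \<M>"
    and step: "\<And>i M0. i < length ks \<Longrightarrow> M0 \<in> \<M> \<Longrightarrow>
      real (cnt (known V (insert (ks ! i) (P \<union> set (take i ks))))
             {M \<in> \<M>. agree (known V (P \<union> set (take i ks))) M M0}) \<le> B i"
    and B: "\<And>i. i < length ks \<Longrightarrow> 0 \<le> B i"
  shows "real (cnt (known V (P \<union> set ks)) \<M>) \<le> real (cnt (known V P) \<M>) * (\<Prod>i<length ks. B i)"
proof -
  have "n \<le> length ks \<Longrightarrow>
    real (cnt (known V (P \<union> set (take n ks))) \<M>) \<le> real (cnt (known V P) \<M>) * (\<Prod>i<n. B i)" for n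
  proof (induction n)
    case (Suc n)
    have e: "P \<union> set (take (Suc n) ks) = insert (ks ! n) (P \<union> set (take n ks))"
      using Suc.prems by (simp add: take_Suc_conv_app_nth)
    have "real (cnt (known V (P \<union> set (take (Suc n) ks))) \<M>)
        \<le> real (cnt (known V (P \<union> set (take n ks))) \<M>) * B n"
      unfolding e using Suc.prems by (intro cnt_step fin step known_mono) auto
    also have "\<dots> \<le> real (cnt (known V P) \<M>) * (\<Prod>i<n. B i) * B n"
      using Suc B by (intro mult_right_mono) auto
    finally show ?case by (simp add: mult.assoc)
  qed simp
  from this[of "length ks"] show ?thesis by simp
qed

text \<open>With the cells between \<open>T\<close> and its complement fixed, the terms
  \<open>l\<close> outside \<open>T\<close> are constants in the equations for indices in
  \<open>T\<close>; moving them to the right-hand side gives \<open>N'\<close>.\<close>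

lemma cnt_block:
  assumes V: "finite V" "T \<subseteq> V" and MM: "\<M> \<subseteq> QN V N" and M0: "M0 \<in> \<M>"
    and C: "T \<times> (V - T) \<union> (V - T) \<times> T \<subseteq> C"
    and B: "\<And>N. real (card (QN T N)) \<le> B"
  shows "real (cnt (C \<union> T \<times> T) {M \<in> \<M>. agree C M M0}) \<le> B"
proof -
  define N' where "N' i k = N i k - (\<Sum>l\<in>V - T. M0 (i, l) * M0 (k, l) - M0 (l, i) * M0 (l, k))" for i k
  have "cnt (C \<union> T \<times> T) {M \<in> \<M>. agree C M M0} \<le> card (QN T N')"
  proof (rule cnt_le_inj[where h = "\<lambda>M. restrict M (T \<times> T)"])
    show "finite (QN T N')" using V finite_QN finite_subset by blast
    show "restrict M (T \<times> T) \<in> QN T N'" if M: "M \<in> {M \<in> \<M>. agree C M M0}" for M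
    proof -
      let ?f = "\<lambda>M i k l. M (i, l) * M (k, l) - M (l, i) * M (l, k) :: real"
      have MQ: "M \<in> QN V N" using M MM by blast
      have "restrict M (T \<times> T) \<in> signs (T \<times> T)"
        using QN_sign[OF MQ] V(2) by (intro restrict_PiE_iff[THEN iffD2]) blast
      moreover have "(\<Sum>l\<in>T. ?f (restrict M (T \<times> T)) i k l) = N' i k" if "i \<in> T" "k \<in> T" for i k
      proof -
        have "(\<Sum>l\<in>T. ?f (restrict M (T \<times> T)) i k l) = (\<Sum>l\<in>T. ?f M i k l)"
          using that by (intro sum.cong) auto
        moreover have "(\<Sum>l\<in>V. ?f M i k l) = (\<Sum>l\<in>V - T. ?f M i k l) + (\<Sum>l\<in>T. ?f M i k l)"
          using V by (intro sum.subset_diff) auto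
        moreover have "(\<Sum>l\<in>V. ?f M i k l) = N i k" using MQ that V(2) by (auto simp: QN_def)
        moreover have "(\<Sum>l\<in>V - T. ?f M i k l) = (\<Sum>l\<in>V - T. ?f M0 i k l)"
        proof (rule sum.cong[OF refl])
          fix l assume "l \<in> V - T"
          then have "(i, l) \<in> C" "(k, l) \<in> C" "(l, i) \<in> C" "(l, k) \<in> C" using that C by auto
          then show "?f M i k l = ?f M0 i k l" using M by (simp add: agree_def)
        qed
        ultimately show ?thesis by (simp add: N'_def)
      qed
      ultimately show ?thesis by (auto simp: QN_def)
    qed
    show "agree (C \<union> T \<times> T) M M'"
      if "M \<in> {M \<in> \<M>. agree C M M0}" "M' \<in> {M \<in> \<M>. agree C M M0}"
        "restrict M (T \<times> T) = restrict M' (T \<times> T)" for M M'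
      using that by (auto simp: restrict_eq_iff_agree agree_Un) (auto simp: agree_def)
  qed
  then show ?thesis using B[of N'] by (meson of_nat_mono order_trans)
qed

section \<open>Rank structure of a matrix\<close>

text \<open>What is used of a largest set \<open>I\<close> of indices whose rows are independent on the complement,
  and of a minimal set \<open>U\<close> of indices on which they stay independent. Maximality of \<open>I\<close> puts the
  other rows into the span of those of \<open>I\<close>; minimality of \<open>U\<close> confines the \<open>j\<close>-part of every
  column relation to the line \<open>p j * x + q j * y = 0\<close>.\<close>

definition frame ::
  "'v set \<Rightarrow> ('v \<times> 'v \<Rightarrow> real) \<Rightarrow> 'v set \<Rightarrow> 'v set \<Rightarrow> ('v \<Rightarrow> real) \<Rightarrow> ('v \<Rightarrow> real) \<Rightarrow> bool" where
  "frame V M I U p q \<longleftrightarrow> I \<subseteq> V \<and> U \<subseteq> V - I \<and> indep (row M) I (U \<times> UNIV) \<and>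
     (\<forall>j\<in>V - I - U. \<exists>l. \<forall>z\<in>(V - I - {j}) \<times> UNIV. row M j z = (\<Sum>i\<in>I. l i * row M i z)) \<and>
     (\<forall>j\<in>U. (p j \<noteq> 0 \<or> q j \<noteq> 0) \<and>
        (\<forall>c. (\<forall>i\<in>I. (\<Sum>z\<in>U \<times> UNIV. c z * row M i z) = 0) \<longrightarrow>
             p j * c (j, True) + q j * c (j, False) = 0))"

lemma ex_frame:
  assumes V: "finite V"
  shows "\<exists>I U p q. frame V M I U p q"
proof -
  let ?P = "\<lambda>I. I \<subseteq> V \<and> indep (row M) I ((V - I) \<times> UNIV)"
  have "\<exists>I. ?P I \<and> (\<forall>I'. ?P I' \<longrightarrow> card I' \<le> card I)"
  proof (rule ex_has_greatest_nat[of ?P "{}" card "Suc (card V)"])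
    show "\<forall>y. ?P y \<longrightarrow> card y < Suc (card V)" using V by (auto simp: less_Suc_eq_le intro: card_mono)
  qed simp
  then obtain I where I: "I \<subseteq> V" "indep (row M) I ((V - I) \<times> UNIV)" and Imax: "\<And>I'. ?P I' \<Longrightarrow> card I' \<le> card I"
    by blast
  have fI: "finite I" using I(1) V finite_subset by blast
  let ?R = "\<lambda>U. U \<subseteq> V - I \<and> indep (row M) I (U \<times> UNIV)"
  have "\<exists>U. ?R U \<and> (\<forall>U'. ?R U' \<longrightarrow> card U \<le> card U')"
    by (rule ex_has_least_nat[of ?R "V - I" card]) (use I in simp)
  then obtain U where U: "U \<subseteq> V - I" "indep (row M) I (U \<times> UNIV)" and Umin: "\<And>U'. ?R U' \<Longrightarrow> card U \<le> card U'"
    by blast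
  have fU: "finite U" using U(1) V by (meson finite_Diff finite_subset)
  \<comment> \<open>For \<open>j\<close> outside \<open>U\<close> the rows \<open>I\<close> remain
    independent without the columns of \<open>j\<close>, so by maximality of \<open>I\<close> it is
    row \<open>j\<close> that depends on them.\<close>
  have R: "\<exists>l. \<forall>z\<in>(V - I - {j}) \<times> UNIV. row M j z = (\<Sum>i\<in>I. l i * row M i z)" if j: "j \<in> V - I - U" for j
  proof (rule indep_insert_comb[OF _ _ fI])
    show "indep (row M) I ((V - I - {j}) \<times> UNIV)"
      by (rule indep_mono_cols[OF U(2)]) (use U(1) j in auto)
    show "\<not> indep (row M) (insert j I) ((V - I - {j}) \<times> UNIV)"
    proof
      assume a: "indep (row M) (insert j I) ((V - I - {j}) \<times> UNIV)"
      have "V - I - {j} = V - insert j I" by auto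
      with a have "?P (insert j I)" using I(1) j by simp
      from Imax[OF this] show False using fI j by simp
    qed
  qed
  \<comment> \<open>Minimality of \<open>U\<close> gives a combination \<open>g\<close> of the rows
    \<open>I\<close> that is supported, within \<open>U\<close>, on the two columns of
    \<open>j\<close>; its values there serve as \<open>p j\<close> and \<open>q j\<close>. Pairing
    \<open>g\<close> with a column relation leaves only the terms at \<open>j\<close>.\<close>
  have "\<exists>pq. (fst pq \<noteq> 0 \<or> snd pq \<noteq> 0) \<and>
        (\<forall>c. (\<forall>i\<in>I. (\<Sum>z\<in>U \<times> UNIV. c z * row M i z) = 0) \<longrightarrow>
             fst pq * c (j, True) + snd pq * c (j, False) = 0)" if j: "j \<in> U" for j
  proof -
    have "\<not> indep (row M) I ((U - {j}) \<times> UNIV)"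
    proof
      assume "indep (row M) I ((U - {j}) \<times> UNIV)"
      then have "card U \<le> card (U - {j})" using U(1) by (intro Umin) auto
      moreover have "card (U - {j}) < card U" using fU j by (rule card_Diff1_less)
      ultimately show False by simp
    qed
    then obtain f where f: "\<And>z. z \<in> (U - {j}) \<times> UNIV \<Longrightarrow> (\<Sum>i\<in>I. f i * row M i z) = 0"
      and nz: "\<exists>i\<in>I. f i \<noteq> 0" unfolding indep_def by blast
    define g where "g z = (\<Sum>i\<in>I. f i * row M i z)" for z
    have g0: "g (l, b) = 0" if "l \<in> U - {j}" for l b using f[of "(l, b)"] that by (simp add: g_def)
    have "g (j, True) \<noteq> 0 \<or> g (j, False) \<noteq> 0"
    proof (rule ccontr)
      assume "\<not> ?thesis"
      then have gj: "g (j, b) = 0" for b by (cases b) auto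
      have "g z = 0" if "z \<in> U \<times> UNIV" for z
      proof -
        obtain l b where e: "z = (l, b)" by (cases z)
        show ?thesis using g0[of l b] gj[of b] that e by (cases "l = j") auto
      qed
      then have "f i = 0" if "i \<in> I" for i using indepD[OF U(2), of f i] that unfolding g_def by blast
      with nz show False by blast
    qed
    moreover have "g (j, True) * c (j, True) + g (j, False) * c (j, False) = 0"
      if c: "\<forall>i\<in>I. (\<Sum>z\<in>U \<times> UNIV. c z * row M i z) = 0" for c
    proof -
      have "0 = (\<Sum>i\<in>I. f i * (\<Sum>z\<in>U \<times> UNIV. c z * row M i z))" using c by simp
      also have "\<dots> = (\<Sum>i\<in>I. \<Sum>z\<in>U \<times> UNIV. c z * (f i * row M i z))"
        by (simp add: sum_distrib_left mult.left_commute)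
      also have "\<dots> = (\<Sum>z\<in>U \<times> UNIV. c z * g z)"
        unfolding g_def sum_distrib_left by (rule sum.swap)
      also have "\<dots> = (\<Sum>l\<in>U. c (l, True) * g (l, True) + c (l, False) * g (l, False))"
        by (rule sum_times_bool)
      also have "\<dots> = c (j, True) * g (j, True) + c (j, False) * g (j, False)
          + (\<Sum>l\<in>U - {j}. c (l, True) * g (l, True) + c (l, False) * g (l, False))"
        using fU j by (rule sum.remove)
      also have "(\<Sum>l\<in>U - {j}. c (l, True) * g (l, True) + c (l, False) * g (l, False)) = 0"
        using g0 by simp
      finally show ?thesis by (simp add: mult.commute)
    qed
    ultimately show ?thesis by (intro exI[of _ "(g (j, True), g (j, False))"]) simp
  qed
  then have "\<forall>j\<in>U. \<exists>pq. (fst pq \<noteq> 0 \<or> snd pq \<noteq> 0) \<and>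
        (\<forall>c. (\<forall>i\<in>I. (\<Sum>z\<in>U \<times> UNIV. c z * row M i z) = 0) \<longrightarrow>
             fst pq * c (j, True) + snd pq * c (j, False) = 0)" by blast
  from bchoice[OF this] obtain pq where pq: "\<forall>j\<in>U. (fst (pq j) \<noteq> 0 \<or> snd (pq j) \<noteq> 0) \<and>
        (\<forall>c. (\<forall>i\<in>I. (\<Sum>z\<in>U \<times> UNIV. c z * row M i z) = 0) \<longrightarrow>
             fst (pq j) * c (j, True) + snd (pq j) * c (j, False) = 0)" by blast
  show ?thesis
    by (rule exI[of _ I], rule exI[of _ U], rule exI[of _ "\<lambda>j. fst (pq j)"], rule exI[of _ "\<lambda>j. snd (pq j)"])
       (use I U R pq in \<open>simp add: frame_def\<close>)
qed

section \<open>Relations between the columns of a frame\<close>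

lemma frame_rel:
  assumes fr: "frame V M I U p q" and V: "finite V" and Q: "Q \<subseteq> U \<times> UNIV"
    and rel: "\<And>i. i \<in> I \<Longrightarrow> (\<Sum>z\<in>Q. c z * row M i z) = 0" and j: "j \<in> U"
  shows "p j * (if (j, True) \<in> Q then c (j, True) else 0)
       + q j * (if (j, False) \<in> Q then c (j, False) else 0) = 0"
proof -
  define c' where "c' z = (if z \<in> Q then c z else 0)" for z
  have fU: "finite U" using fr V unfolding frame_def by (meson finite_Diff finite_subset)
  have "(\<Sum>z\<in>U \<times> UNIV. c' z * row M i z) = 0" if "i \<in> I" for i
  proof -
    have "(\<Sum>z\<in>U \<times> UNIV. c' z * row M i z) = (\<Sum>z\<in>Q. c z * row M i z)"
      using fU Q by (intro sum.mono_neutral_cong_right) (auto simp: c'_def)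
    then show ?thesis using rel that by simp
  qed
  moreover have "(\<forall>i\<in>I. (\<Sum>z\<in>U \<times> UNIV. c' z * row M i z) = 0) \<longrightarrow>
             p j * c' (j, True) + q j * c' (j, False) = 0"
    using fr j unfolding frame_def by simp
  ultimately show ?thesis unfolding c'_def by blast
qed

text \<open>For these slopes the combination of the two columns of index \<open>j\<close> that enters column relations has
  one of the four directions in \<open>dirs\<close> below. For any other slope its value on a row determines
  both entries, since they are signs.\<close>

definition special :: "real \<Rightarrow> real \<Rightarrow> bool" where
  "special p q \<longleftrightarrow> p = 0 \<or> q = 0 \<or> p = q \<or> p = - q"

lemma frame_finite:
  assumes "frame V M I U p q" "finite V"
  shows "finite U" "finite I"
  using assms unfolding frame_def by (meson finite_Diff finite_subset)+

text \<open>\<open>B\<close> collects indices that contribute both of their columns to a column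
  basis; any other index of \<open>U\<close> contributes one, because the \<open>j\<close>-part of a
  relation lies on a line. Special indices enter \<open>B\<close> first, so that a special index
  left out already depends on special indices alone, as \<open>frame_special\<close>
  requires.\<close>

lemma ex_frame_basis:
  assumes fr: "frame V M I U p q" and V: "finite V"
  obtains B where "B \<subseteq> U" "indep (tr (row M)) (B \<times> UNIV) I"
    "\<And>j. j \<in> U - B \<Longrightarrow> \<not> indep (tr (row M)) (insert j B \<times> UNIV) I"
    "\<And>j. j \<in> U - B \<Longrightarrow> special (p j) (q j) \<Longrightarrow>
       \<not> indep (tr (row M)) (insert j (B \<inter> {l. special (p l) (q l)}) \<times> UNIV) I"
    "indep (tr (row M)) (B \<times> UNIV \<union> (\<lambda>j. (j, p j \<noteq> 0)) ` (U - B)) I"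
    "card I = card (U - B) + 2 * card B"
proof -
  let ?A = "tr (row M)"
  let ?P = "\<lambda>B. indep ?A (B \<times> UNIV) I"
  note fU = frame_finite(1)[OF fr V] and fI = frame_finite(2)[OF fr V]
  define Sp where "Sp = {l. special (p l) (q l)}"
  obtain Bs where Bs: "Bs \<subseteq> U \<inter> Sp" "?P Bs" "\<And>z. z \<in> U \<inter> Sp - Bs \<Longrightarrow> \<not> ?P (insert z Bs)"
    using ex_maximal_subset[of "U \<inter> Sp" "{}" ?P] fU by auto
  have "Bs \<subseteq> U" using Bs(1) by blast
  then obtain B where B: "Bs \<subseteq> B" "B \<subseteq> U" "?P B" "\<And>z. z \<in> U - B \<Longrightarrow> \<not> ?P (insert z B)"
    using ex_maximal_subset[of U Bs ?P] fU Bs(2) by blast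
  have fB: "finite B" using B(2) fU finite_subset by blast
  \<comment> \<open>The chosen column is one whose coefficient on the line
    \<open>p j * x + q j * y = 0\<close> is nonzero; a relation that uses only this column of
    \<open>j\<close> has coefficient 0 there.\<close>
  let ?pk = "\<lambda>j. (j, p j \<noteq> 0)"
  let ?Q = "B \<times> UNIV \<union> ?pk ` (U - B)"
  have QU: "?Q \<subseteq> U \<times> UNIV" using B(2) by auto
  have fQ: "finite ?Q" using fB fU by simp
  have iQ: "indep ?A ?Q I"
  proof (rule indepI)
    fix f z assume h: "\<And>i. i \<in> I \<Longrightarrow> (\<Sum>z\<in>?Q. f z * ?A z i) = 0" and z: "z \<in> ?Q"
    have pk0: "f (?pk j) = 0" if j: "j \<in> U - B" for j
    proof -
      have m: "(j, True) \<in> ?Q \<longleftrightarrow> p j \<noteq> 0" "(j, False) \<in> ?Q \<longleftrightarrow> p j = 0" using j by auto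
      have r: "p j * (if (j, True) \<in> ?Q then f (j, True) else 0)
          + q j * (if (j, False) \<in> ?Q then f (j, False) else 0) = 0"
      proof (rule frame_rel[OF fr V QU])
        show "(\<Sum>z\<in>?Q. f z * row M i z) = 0" if "i \<in> I" for i using h[OF that] by (simp only: tr_def)
        show "j \<in> U" using j by simp
      qed
      have "p j \<noteq> 0 \<or> q j \<noteq> 0" using fr j unfolding frame_def by blast
      with m r show ?thesis by (cases "p j = 0") (simp_all only: if_True if_False mult_zero_left mult_zero_right add_0_left add_0_right mult_eq_0_iff not_True_eq_False not_False_eq_True simp_thms)
    qed
    show "f z = 0"
    proof (cases "z \<in> B \<times> UNIV")
      case True
      show ?thesis
      proof (rule indepD[OF B(3) _ True])
        fix i assume "i \<in> I"
        have "(\<Sum>z\<in>?Q. f z * ?A z i) = (\<Sum>z\<in>B \<times> UNIV. f z * ?A z i)"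
          by (rule sum.mono_neutral_right[OF fQ]) (use pk0 in auto)
        then show "(\<Sum>z\<in>B \<times> UNIV. f z * ?A z i) = 0" using h[OF \<open>i \<in> I\<close>] by simp
      qed
    next
      case False
      then obtain j where "j \<in> U - B" "z = ?pk j" using z by blast
      then show ?thesis using pk0 by simp
    qed
  qed
  have span: "\<exists>l. \<forall>i\<in>I. row M i z = (\<Sum>v\<in>?Q. l v * row M i v)" if z: "z \<in> U \<times> UNIV" for z
  proof (cases "z \<in> ?Q")
    case False
    obtain j b where e: "z = (j, b)" by (cases z)
    with False z have j: "j \<in> U - B" by auto
    have "insert j B \<times> UNIV \<subseteq> insert z ?Q"
    proof
      fix v assume v: "v \<in> insert j B \<times> (UNIV :: bool set)"
      obtain l b' where v': "v = (l, b')" by (cases v)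
      show "v \<in> insert z ?Q"
      proof (cases "l = j \<and> l \<notin> B")
        case True
        have pk: "?pk j \<in> ?Q" using j by blast
        with False e have "b \<noteq> (p j \<noteq> 0)" by auto
        then have "b' = b \<or> b' = (p j \<noteq> 0)" by auto
        then show ?thesis using True v' e pk by auto
      next
        case False then show ?thesis using v v' j by auto
      qed
    qed
    then have "\<not> indep ?A (insert z ?Q) I"
      using B(4)[OF j] indep_subset_rows[of ?A "insert z ?Q" I "insert j B \<times> UNIV"] fQ by auto
    then show ?thesis by (rule maximal_cols_span[OF fQ iQ])
  qed (rule indep_self_span[OF fQ])
  have "indep (row M) I (U \<times> UNIV)" using fr by (simp add: frame_def)
  from indep_of_spanning[OF this span] have rQ: "indep (row M) I ?Q" by blast
  have "card I = card ?Q"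
    using indep_card_le[OF rQ fI fQ] indep_card_le[OF iQ fQ fI] by simp
  also have "\<dots> = card (B \<times> (UNIV :: bool set)) + card (?pk ` (U - B))"
    using fB fU by (intro card_Un_disjoint) auto
  also have "card (?pk ` (U - B)) = card (U - B)" by (rule card_image) (simp add: inj_on_def)
  finally have cI: "card I = card (U - B) + 2 * card B" by (simp add: card_cartesian_product)
  show ?thesis
  proof (rule that[OF B(2,3) B(4) _ iQ cI])
    fix j assume j: "j \<in> U - B" and sp: "special (p j) (q j)"
    show "\<not> ?P (insert j (B \<inter> {l. special (p l) (q l)}))"
    proof
      assume a: "?P (insert j (B \<inter> {l. special (p l) (q l)}))"
      have "?P (insert j Bs)"
        by (rule indep_subset_rows[OF a]) (use Bs(1) B(1) fB in \<open>auto simp: Sp_def\<close>)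
      moreover have "j \<in> U \<inter> Sp - Bs" using j sp B(1) by (auto simp: Sp_def)
      ultimately show False using Bs(3) by blast
    qed
  qed
qed

text \<open>A direction vector of the line \<open>p * x + q * y = 0\<close> for special slopes; the
  last case is meant for p = - q.\<close>

definition dir :: "real \<Rightarrow> real \<Rightarrow> real \<times> real" where
  "dir p q = (if p = 0 then (1, 0) else if q = 0 then (0, 1) else if p = q then (1, - 1) else (1, 1))"

definition dirs :: "(real \<times> real) set" where
  "dirs = {(1, 0), (0, 1), (1, - 1), (1, 1)}"

definition zrow :: "('v \<times> 'v \<Rightarrow> real) \<Rightarrow> ('v \<Rightarrow> real \<times> real) \<Rightarrow> 'v \<Rightarrow> 'v \<Rightarrow> real" where
  "zrow M d l i = fst (d l) * row M i (l, True) + snd (d l) * row M i (l, False)"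

lemma dir_dirs: "dir p q \<in> dirs"
  by (simp add: dir_def dirs_def)

lemma special_dir:
  assumes "special p q" "p \<noteq> 0 \<or> q \<noteq> 0" "p * x + q * y = 0"
  shows "\<exists>k. x = k * fst (dir p q) \<and> y = k * snd (dir p q)"
proof -
  consider "p = 0" | "p \<noteq> 0" "q = 0" | "p \<noteq> 0" "q \<noteq> 0" "p = q" | "p \<noteq> 0" "q \<noteq> 0" "p = - q" "p \<noteq> q"
    using assms(1,2) unfolding special_def by fastforce
  then show ?thesis
  proof cases
    case 3
    then have "p * (x + y) = 0" using assms(3) by (simp add: distrib_left)
    then have "y = - x" using 3 by simp
    then show ?thesis using 3 by (simp add: dir_def)
  next
    case 4
    then have "q * (y - x) = 0" using assms(3) by (simp add: right_diff_distrib)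
    then have "y = x" using 4 by simp
    then show ?thesis using 4 by (simp add: dir_def)
  qed (use assms in \<open>auto simp: dir_def\<close>)
qed

lemma sum_times_bool_zrow:
  "(\<Sum>l\<in>L. k l * zrow M d l i)
     = (\<Sum>z\<in>L \<times> UNIV. (k (fst z) * (if snd z then fst (d (fst z)) else snd (d (fst z)))) * row M i z)"
  unfolding sum_times_bool by (simp add: zrow_def algebra_simps)

text \<open>All indices of the relation are special, so its part at each \<open>l\<close> is a
  multiple \<open>k l\<close> of the direction vector, and the relation becomes one between the
  combined columns \<open>zrow\<close>. Independence of \<open>B\<close> gives
  \<open>k j \<noteq> 0\<close>.\<close>

lemma frame_special:
  assumes fr: "frame V M I U p q" and V: "finite V" and B: "B \<subseteq> U"
    and ind: "indep (tr (row M)) (B \<times> UNIV) I"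
    and sp: "\<And>l. l \<in> B \<Longrightarrow> special (p l) (q l)"
    and j: "j \<in> U - B" "special (p j) (q j)" "\<not> indep (tr (row M)) (insert j B \<times> UNIV) I"
  shows "\<exists>\<mu>. \<forall>i\<in>I. zrow M (\<lambda>l. dir (p l) (q l)) j i = (\<Sum>l\<in>B. \<mu> l * zrow M (\<lambda>l. dir (p l) (q l)) l i)"
proof -
  let ?d = "\<lambda>l. dir (p l) (q l)"
  let ?Q = "insert j B \<times> (UNIV :: bool set)"
  have fB: "finite B" using B frame_finite(1)[OF fr V] finite_subset by blast
  obtain c where c: "\<And>i. i \<in> I \<Longrightarrow> (\<Sum>z\<in>?Q. c z * row M i z) = 0" and nz: "\<exists>z\<in>?Q. c z \<noteq> 0"
    using j(3) unfolding indep_def tr_def by blast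
  have QU: "?Q \<subseteq> U \<times> UNIV" using B j by auto
  have "\<exists>k. c (l, True) = k * fst (?d l) \<and> c (l, False) = k * snd (?d l)" if l: "l \<in> insert j B" for l
  proof (rule special_dir)
    show "special (p l) (q l)" using sp j l by auto
    show "p l \<noteq> 0 \<or> q l \<noteq> 0" using fr l B j unfolding frame_def by blast
    have "p l * (if (l, True) \<in> ?Q then c (l, True) else 0) + q l * (if (l, False) \<in> ?Q then c (l, False) else 0) = 0"
      by (rule frame_rel[OF fr V QU c]) (use l B j in auto)
    then show "p l * c (l, True) + q l * c (l, False) = 0" using l by simp
  qed
  then have "\<forall>l\<in>insert j B. \<exists>k. c (l, True) = k * fst (?d l) \<and> c (l, False) = k * snd (?d l)" by blast
  from bchoice[OF this] obtain k where
    k: "\<And>l. l \<in> insert j B \<Longrightarrow> c (l, True) = k l * fst (?d l) \<and> c (l, False) = k l * snd (?d l)"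
    by blast
  have kz: "(\<Sum>l\<in>insert j B. k l * zrow M ?d l i) = 0" if "i \<in> I" for i
  proof -
    have "(\<Sum>l\<in>insert j B. k l * zrow M ?d l i) = (\<Sum>z\<in>?Q. c z * row M i z)"
      unfolding sum_times_bool_zrow by (intro sum.cong) (auto simp: k)
    then show ?thesis using c that by simp
  qed
  have "k j \<noteq> 0"
  proof
    assume 0: "k j = 0"
    then have cj: "c (j, b) = 0" for b using k[of j] by (cases b) auto
    have "c z = 0" if "z \<in> B \<times> UNIV" for z
    proof (rule indepD[OF ind _ that])
      fix i assume i: "i \<in> I"
      have "(\<Sum>z\<in>?Q. c z * row M i z) = (\<Sum>z\<in>B \<times> UNIV. c z * row M i z)"
        using fB cj by (intro sum.mono_neutral_right) auto
      then show "(\<Sum>z\<in>B \<times> UNIV. c z * tr (row M) z i) = 0" using c[OF i] by (simp add: tr_def)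
    qed
    then show False using nz cj by auto
  qed
  have "zrow M ?d j i = (\<Sum>l\<in>B. (- k l / k j) * zrow M ?d l i)" if "i \<in> I" for i
  proof -
    have "k j * zrow M ?d j i + (\<Sum>l\<in>B. k l * zrow M ?d l i) = 0"
      using kz[OF that] j fB by simp
    then have "zrow M ?d j i = - (\<Sum>l\<in>B. k l * zrow M ?d l i) / k j"
      using \<open>k j \<noteq> 0\<close> by (simp add: field_simps)
    moreover have "(\<Sum>l\<in>B. (- k l / k j) * zrow M ?d l i) = - (\<Sum>l\<in>B. k l * zrow M ?d l i) / k j"
      by (simp add: sum_divide_distrib sum_negf)
    ultimately show ?thesis by (simp only:)
  qed
  then show ?thesis by (intro exI[of _ "\<lambda>l. - k l / k j"] ballI)
qed

lemma zrow_indep: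
  assumes ind: "indep (tr (row M)) (B \<times> UNIV) I" and d: "\<And>l. l \<in> B \<Longrightarrow> d l \<in> dirs"
  shows "indep (zrow M d) B I"
proof (rule indepI)
  fix f l assume h: "\<And>i. i \<in> I \<Longrightarrow> (\<Sum>l\<in>B. f l * zrow M d l i) = 0" and l: "l \<in> B"
  let ?c = "\<lambda>z. f (fst z) * (if snd z then fst (d (fst z)) else snd (d (fst z)))"
  have "?c z = 0" if z: "z \<in> B \<times> UNIV" for z
  proof (rule indepD[OF ind _ z])
    show "(\<Sum>z\<in>B \<times> UNIV. ?c z * tr (row M) z i) = 0" if "i \<in> I" for i
      using h[OF that] unfolding sum_times_bool_zrow tr_def .
  qed
  from this[of "(l, True)"] this[of "(l, False)"] show "f l = 0" using d[OF l] l by (auto simp: dirs_def)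
qed

text \<open>The \<open>j\<close>-part of a relation has slope \<beta> = - p j / q j, which avoids 0,
  1 and -1 because \<open>j\<close> is not special. A relation that uses only
  \<open>(j, False)\<close> beside \<open>B\<close> has \<open>q j * y = 0\<close>, hence the second
  claim.\<close>

lemma frame_generic:
  assumes fr: "frame V M I U p q" and V: "finite V" and B: "B \<subseteq> U"
    and ind: "indep (tr (row M)) (B \<times> UNIV) I"
    and j: "j \<in> U - B" "\<not> special (p j) (q j)" "\<not> indep (tr (row M)) (insert j B \<times> UNIV) I"
  shows "\<exists>\<beta> g. \<beta> \<notin> {0, 1, -1} \<and>
      (\<forall>i\<in>I. row M i (j, True) + \<beta> * row M i (j, False) = (\<Sum>z\<in>B \<times> UNIV. g z * row M i z))"
    and "indep (tr (row M)) (insert (j, False) (B \<times> UNIV)) I"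
proof -
  have fB: "finite B" using B frame_finite(1)[OF fr V] finite_subset by blast
  let ?Q = "insert j B \<times> (UNIV :: bool set)"
  obtain c where c: "\<And>i. i \<in> I \<Longrightarrow> (\<Sum>z\<in>?Q. c z * row M i z) = 0" and nz: "\<exists>z\<in>?Q. c z \<noteq> 0"
    using j(3) unfolding indep_def tr_def by blast
  have QU: "?Q \<subseteq> U \<times> UNIV" using B j by auto
  have pq: "p j \<noteq> 0" "q j \<noteq> 0" "p j \<noteq> q j" "p j \<noteq> - q j" using j(2) by (auto simp: special_def)
  have "p j * (if (j, True) \<in> ?Q then c (j, True) else 0) + q j * (if (j, False) \<in> ?Q then c (j, False) else 0) = 0"
    by (rule frame_rel[OF fr V QU c]) (use B j in auto)
  then have rel: "p j * c (j, True) + q j * c (j, False) = 0" by simp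
  have sp: "(\<Sum>z\<in>?Q. c z * row M i z) = c (j, True) * row M i (j, True) + c (j, False) * row M i (j, False)
        + (\<Sum>z\<in>B \<times> UNIV. c z * row M i z)" for i
    unfolding sum_times_bool using fB j by simp
  have "c (j, True) \<noteq> 0"
  proof
    assume "c (j, True) = 0"
    with rel pq have cj: "c (j, b) = 0" for b by (cases b) auto
    have "c z = 0" if z: "z \<in> B \<times> UNIV" for z
    proof (rule indepD[OF ind _ z])
      show "(\<Sum>z\<in>B \<times> UNIV. c z * tr (row M) z i) = 0" if "i \<in> I" for i
        using c[OF that] sp[of i] cj by (simp add: tr_def)
    qed
    then show False using nz cj by auto
  qed
  then have b: "c (j, False) / c (j, True) = - p j / q j" using rel pq by (simp add: field_simps)
  show "\<exists>\<beta> g. \<beta> \<notin> {0, 1, -1} \<and>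
      (\<forall>i\<in>I. row M i (j, True) + \<beta> * row M i (j, False) = (\<Sum>z\<in>B \<times> UNIV. g z * row M i z))"
  proof (intro exI[of _ "c (j, False) / c (j, True)"] exI[of _ "\<lambda>z. - c z / c (j, True)"] conjI ballI)
    show "c (j, False) / c (j, True) \<notin> {0, 1, -1}" unfolding b using pq by (auto simp: field_simps)
    fix i assume i: "i \<in> I"
    have "(\<Sum>z\<in>B \<times> UNIV. (- c z / c (j, True)) * row M i z) = - (\<Sum>z\<in>B \<times> UNIV. c z * row M i z) / c (j, True)"
      by (simp add: sum_divide_distrib sum_negf)
    also have "(\<Sum>z\<in>B \<times> UNIV. c z * row M i z) = - (c (j, True) * row M i (j, True) + c (j, False) * row M i (j, False))"
      using c[OF i] sp[of i] by linarith
    finally show "row M i (j, True) + c (j, False) / c (j, True) * row M i (j, False)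
        = (\<Sum>z\<in>B \<times> UNIV. (- c z / c (j, True)) * row M i z)"
      using \<open>c (j, True) \<noteq> 0\<close> by (simp add: field_simps)
  qed
  show "indep (tr (row M)) (insert (j, False) (B \<times> UNIV)) I"
  proof (rule indepI)
    let ?R = "insert (j, False) (B \<times> UNIV)"
    fix f z assume h: "\<And>i. i \<in> I \<Longrightarrow> (\<Sum>z\<in>?R. f z * tr (row M) z i) = 0" and z: "z \<in> ?R"
    have "p j * (if (j, True) \<in> ?R then f (j, True) else 0) + q j * (if (j, False) \<in> ?R then f (j, False) else 0) = 0"
    proof (rule frame_rel[OF fr V])
      show "(\<Sum>z\<in>?R. f z * row M i z) = 0" if "i \<in> I" for i using h[OF that] by (simp only: tr_def)
    qed (use B j in auto)
    then have 0: "f (j, False) = 0" using j(1) pq by simp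
    have "f z = 0" if z: "z \<in> B \<times> UNIV"
    proof (rule indepD[OF ind _ z])
      show "(\<Sum>z\<in>B \<times> UNIV. f z * tr (row M) z i) = 0" if "i \<in> I" for i
        using h[OF that] 0 fB j(1) by simp
    qed
    then show "f z = 0" using z 0 by auto
  qed
qed

text \<open>On the rows \<open>E\<close> the column \<open>v\<close> is one definite combination of
  the columns \<open>C\<close>. Independence on \<open>T\<close> makes this combination fail in some
  row of \<open>T\<close>, and that row forces the coefficient of \<open>v\<close> to
  vanish.\<close>

lemma ex_witness_row:
  assumes fin: "finite C" "finite E" and sq: "indep (tr A) C E" "card E = card C"
    and ind: "indep (tr A) (insert v C) T" and v: "v \<notin> C"
  shows "\<exists>i\<in>T. indep (tr A) (insert v C) (insert i E)"
proof -
  have "indep A E C" by (rule indep_square'[OF sq(1) fin(2,1) sq(2)])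
  from square_cols_span[OF this fin(2,1), of v] sq(2) obtain w where
    w: "\<And>e. e \<in> E \<Longrightarrow> A e v = (\<Sum>z\<in>C. w z * A e z)" by auto
  have "\<exists>i\<in>T. A i v \<noteq> (\<Sum>z\<in>C. w z * A i z)"
  proof (rule ccontr)
    assume "\<not> ?thesis"
    then have e: "A i v = (\<Sum>z\<in>C. w z * A i z)" if "i \<in> T" for i using that by blast
    define f where "f z = (if z = v then 1 else - w z)" for z
    have "f v = 0"
    proof (rule indepD[OF ind])
      fix i assume i: "i \<in> T"
      have "(\<Sum>z\<in>C. f z * A i z) = - (\<Sum>z\<in>C. w z * A i z)"
        using v unfolding sum_negf[symmetric] by (intro sum.cong) (auto simp: f_def)
      then show "(\<Sum>r\<in>insert v C. f r * tr A r i) = 0"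
        using fin v e[OF i] by (simp add: tr_def f_def)
    qed simp
    then show False by (simp add: f_def)
  qed
  then obtain i where i: "i \<in> T" "A i v \<noteq> (\<Sum>z\<in>C. w z * A i z)" by blast
  have "indep (tr A) (insert v C) (insert i E)"
  proof (rule indepI)
    fix f z assume h: "\<And>e. e \<in> insert i E \<Longrightarrow> (\<Sum>z\<in>insert v C. f z * tr A z e) = 0" and z: "z \<in> insert v C"
    have h': "f v * A e v + (\<Sum>z\<in>C. f z * A e z) = 0" if "e \<in> insert i E" for e
      using h[OF that] fin v by (simp add: tr_def)
    have fz: "f z + f v * w z = 0" if "z \<in> C" for z
    proof (rule indepD[OF sq(1) _ that])
      fix e assume e: "e \<in> E"
      have "(\<Sum>z\<in>C. (f z + f v * w z) * tr A z e) = (\<Sum>z\<in>C. f z * A e z) + f v * (\<Sum>z\<in>C. w z * A e z)"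
        by (simp add: tr_def distrib_right sum.distrib sum_distrib_left mult.assoc)
      then show "(\<Sum>z\<in>C. (f z + f v * w z) * tr A z e) = 0" using h'[of e] w[OF e] e by simp
    qed
    have "(\<Sum>z\<in>C. f z * A i z) = (\<Sum>z\<in>C. - (f v * (w z * A i z)))"
    proof (rule sum.cong[OF refl])
      fix z assume "z \<in> C"
      then have "f z = - (f v * w z)" using fz[of z] by linarith
      then show "f z * A i z = - (f v * (w z * A i z))" by simp
    qed
    also have "\<dots> = - f v * (\<Sum>z\<in>C. w z * A i z)" by (simp add: sum_negf sum_distrib_left)
    finally have "f v * (A i v - (\<Sum>z\<in>C. w z * A i z)) = 0"
      using h'[of i] by (simp add: right_diff_distrib)
    then have "f v = 0" using i by simp
    then show "f z = 0" using z fz by auto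
  qed
  then show ?thesis using i by blast
qed

lemma cnt_le_cells:
  assumes "\<M> \<subseteq> QN V N" "finite C" "C \<subseteq> V \<times> V" "card C \<le> d"
  shows "real (cnt C \<M>) \<le> 2 ^ d"
  by (rule cnt_le_determined[of C]) (use assms QN_sign[of _ V N] in blast)+

lemma cells_le_times: "finite X \<Longrightarrow> finite Y \<Longrightarrow> card (X \<times> Y \<union> Y \<times> X) \<le> 2 * (card X * card Y)"
  using card_Un_le[of "X \<times> Y" "Y \<times> X"] by (simp add: card_cartesian_product mult.commute)

lemma cell_in: "i \<in> V \<Longrightarrow> fst z \<in> V \<Longrightarrow> cell i z \<in> V \<times> V"
  by (simp add: cell_def)

text \<open>Both rows are combinations of the same known rows \<open>K\<close>, and the entries on
  \<open>Q\<close>, where these are independent, pin down the coefficients.\<close>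

lemma span_determined:
  assumes ind: "indep (row M0) K Q" and Q: "Q \<subseteq> Z"
    and M: "\<And>i z. i \<in> K \<Longrightarrow> z \<in> Z \<Longrightarrow> row M i z = row M0 i z"
    and M': "\<And>i z. i \<in> K \<Longrightarrow> z \<in> Z \<Longrightarrow> row M' i z = row M0 i z"
    and l: "\<forall>z\<in>Z. row M k z = (\<Sum>i\<in>K. l i * row M i z)"
    and l': "\<forall>z\<in>Z. row M' k z = (\<Sum>i\<in>K. l' i * row M' i z)"
    and ag: "\<And>z. z \<in> Q \<Longrightarrow> row M k z = row M' k z" and z: "z \<in> Z"
  shows "row M k z = row M' k z"
proof -
  have e: "row M k z = (\<Sum>i\<in>K. l i * row M0 i z)" "row M' k z = (\<Sum>i\<in>K. l' i * row M0 i z)" if "z \<in> Z" for z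
    using l l' M M' that by simp_all
  have "l i - l' i = 0" if "i \<in> K" for i
  proof (rule indepD[OF ind _ that])
    fix z assume z: "z \<in> Q"
    then have "(\<Sum>i\<in>K. l i * row M0 i z) = (\<Sum>i\<in>K. l' i * row M0 i z)"
      using ag[OF z] e[of z] Q by auto
    then show "(\<Sum>i\<in>K. (l i - l' i) * row M0 i z) = 0"
      by (simp add: left_diff_distrib sum_subtractf)
  qed
  then show ?thesis using e[OF z] by simp
qed

section \<open>Counting along a frame\<close>

text \<open>\<open>Il\<close> enumerates \<open>I\<close>, \<open>Rl\<close> the indices outside \<open>I\<close> and \<open>U\<close>, and \<open>Al @ Bl\<close> enumerates \<open>U\<close> in the
  order of exposure, where all columns with index in \<open>Bl\<close> are independent. The
  arguments of \<open>dv_f\<close> and \<open>dv_g\<close> are \<open>length Il\<close> and \<open>length Il + length Rl\<close>, divided by \<open>n\<close>.\<close>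

definition good :: "'v set \<Rightarrow> 'v list \<Rightarrow> 'v list \<Rightarrow> 'v list \<Rightarrow> 'v list \<Rightarrow> ('v \<times> 'v \<Rightarrow> real) \<Rightarrow> bool" where
  "good V Il Rl Al Bl M \<longleftrightarrow> distinct (Il @ Rl @ Al @ Bl) \<and> set (Il @ Rl @ Al @ Bl) = V \<and>
     length Il = length Al + 2 * length Bl \<and>
     (\<forall>j\<in>set Rl. \<exists>l. \<forall>z\<in>(V - set Il - {j}) \<times> UNIV. row M j z = (\<Sum>i\<in>set Il. l i * row M i z)) \<and>
     (\<exists>pk. indep (tr (row M)) (set Bl \<times> UNIV \<union> (\<lambda>j. (j, pk j)) ` set Al) (set Il))"

text \<open>By \<open>length Il = length Al + 2 * length Bl\<close> the chosen columns are as many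
  as the rows of \<open>Il\<close>, so column independence turns into row independence.\<close>

lemma goodE:
  assumes g: "good V Il Rl Al Bl M"
  obtains pk where
    "indep (tr (row M)) (set Bl \<times> UNIV \<union> (\<lambda>j. (j, pk j)) ` set Al) (set Il)"
    "indep (row M) (set Il) (set Bl \<times> UNIV \<union> (\<lambda>j. (j, pk j)) ` set Al)"
    "card (set Bl \<times> UNIV \<union> (\<lambda>j. (j, pk j)) ` set Al) = length Il"
proof -
  obtain pk where pk: "indep (tr (row M)) (set Bl \<times> UNIV \<union> (\<lambda>j. (j, pk j)) ` set Al) (set Il)"
    using g unfolding good_def by blast
  let ?Q = "set Bl \<times> UNIV \<union> (\<lambda>j. (j, pk j)) ` set Al"
  have d: "distinct Il" "distinct Al" "distinct Bl" "set Al \<inter> set Bl = {}"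
    and len: "length Il = length Al + 2 * length Bl"
    using g unfolding good_def by auto
  have "card ?Q = card (set Bl \<times> (UNIV :: bool set)) + card ((\<lambda>j. (j, pk j)) ` set Al)"
    using d by (intro card_Un_disjoint) auto
  also have "card ((\<lambda>j. (j, pk j)) ` set Al) = length Al"
    using d by (subst card_image) (auto simp: inj_on_def distinct_card)
  finally have c: "card ?Q = length Il"
    using d len by (simp add: card_cartesian_product distinct_card)
  have "indep (row M) (set Il) ?Q"
    by (rule indep_square'[OF pk]) (use c d in \<open>auto simp: distinct_card\<close>)
  then show ?thesis using that pk c by blast
qed

text \<open>The rank survives the removal of few indices, which yields three disjoint bases of rank \<open>m\<close>.\<close>

definition rankcond :: "'v set \<Rightarrow> 'v list \<Rightarrow> nat \<Rightarrow> nat \<Rightarrow> ('v \<times> 'v \<Rightarrow> real) \<Rightarrow> bool" where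
  "rankcond V Il x0 m M \<longleftrightarrow> (\<forall>x. x0 \<le> x \<and> x < 2 * x0 \<and> x < length Il \<longrightarrow>
     (\<forall>J\<subseteq>V - set (take x Il) - {Il ! x}. card J \<le> 2 * x \<longrightarrow>
       (\<exists>S\<subseteq>set (take x Il). card S = m \<and> indep (row M) S ((V - set (take x Il) - {Il ! x} - J) \<times> UNIV))))"

text \<open>The lists are common to the whole class, so the order of exposure is fixed in advance;
  the spanning coefficients and the choice \<open>pk\<close> may vary with the matrix.\<close>

locale good_class =
  fixes V :: "'v set" and N \<M> Il Rl Al Bl
  assumes V: "finite V" and MQ: "\<M> \<subseteq> QN V N" and gd: "\<And>M. M \<in> \<M> \<Longrightarrow> good V Il Rl Al Bl M"
    and dist: "distinct (Il @ Rl @ Al @ Bl)" and setV: "V = set Il \<union> set Rl \<union> set Al \<union> set Bl"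
    and len: "length Il = length Al + 2 * length Bl"
begin

abbreviation "n \<equiv> card V"
abbreviation "s \<equiv> length Il"
abbreviation "r \<equiv> length Rl"
abbreviation "a \<equiv> length Al"
abbreviation "b \<equiv> length Bl"

lemma cardV: "n = s + r + a + b"
proof -
  have "V = set (Il @ Rl @ Al @ Bl)" using setV by auto
  then have "n = length (Il @ Rl @ Al @ Bl)" using distinct_card[OF dist] by simp
  then show ?thesis by simp
qed

lemma finM: "finite \<M>"
  using MQ finite_QN[OF V] finite_subset by blast

lemma known_empty: "real (cnt (known V {}) \<M>) \<le> 2 ^ n"
proof (rule cnt_le_cells[OF MQ])
  have "known V {} \<subseteq> (\<lambda>i. (i, i)) ` V" by (auto simp: known_def)
  then have "card (known V {}) \<le> card ((\<lambda>i. (i, i)) ` V)" using V by (intro card_mono) auto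
  also have "\<dots> \<le> n" using V by (rule card_image_le)
  finally show "card (known V {}) \<le> n" .
  show "finite (known V {})" by (rule finite_subset[OF known_sub]) (use V in simp)
qed (rule known_sub)

text \<open>The rows \<open>Il\<close> are independent on columns of \<open>Al\<close> and
  \<open>Bl\<close>, so an initial segment of length \<open>x\<close> stays independent on the
  unknown columns and yields \<open>x\<close> equations for the \<open>2 * (n - x - 1)\<close> new
  entries.\<close>

lemma stage_I:
  assumes rk: "\<And>M. M \<in> \<M> \<Longrightarrow> rankcond V Il x0 m M"
  shows "real (cnt (known V (set Il)) \<M>) \<le> real (cnt (known V {}) \<M>) *
     (\<Prod>x<s. 2 ^ (2 * (n - x - 1) - x) * (if x0 \<le> x \<and> x < 2 * x0 then sqrt ((3/4) ^ m) else 1))"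
proof -
  have "real (cnt (known V ({} \<union> set Il)) \<M>) \<le> real (cnt (known V {}) \<M>) *
     (\<Prod>x<s. 2 ^ (2 * (n - x - 1) - x) * (if x0 \<le> x \<and> x < 2 * x0 then sqrt ((3/4) ^ m) else 1))"
  proof (rule cnt_chain[OF finM])
    fix x M0 assume x: "x < s" and M0: "M0 \<in> \<M>"
    let ?P = "{} \<union> set (take x Il)" and ?k = "Il ! x"
    have dI: "distinct Il" using dist by simp
    have P: "?P \<subseteq> V" "?P \<subseteq> set Il" using setV set_take_subset by fastforce+
    have k: "?k \<in> V - ?P"
    proof -
      have "?k \<in> set (drop x Il)" using x by (metis Cons_nth_drop_Suc list.set_intros(1))
      moreover have "set (take x Il) \<inter> set (drop x Il) = {}"
        using dI by (metis append_take_drop_id distinct_append)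
      ultimately show ?thesis using setV x by auto
    qed
    have cP: "card ?P = x" using dI x by (simp add: distinct_card)
    have cJ: "card (V - ?P - {?k}) = n - x - 1"
      using V P k cP by (simp add: card_Diff_subset finite_subset)
    obtain pk where Q: "indep (row M0) (set Il) (set Bl \<times> UNIV \<union> (\<lambda>j. (j, pk j)) ` set Al)" (is "indep _ _ ?Q")
      using goodE[OF gd[OF M0]] by metis
    have kI: "?k \<in> set Il" using x by simp
    have "?Q \<subseteq> (V - ?P - {?k}) \<times> UNIV" using setV dist P kI by auto
    then have ind: "indep (row M0) ?P ((V - ?P - {?k}) \<times> UNIV)"
      using indep_mono_cols[OF indep_subset_rows[OF Q P(2)]] by simp
    show "real (cnt (known V (insert ?k ?P)) {M \<in> \<M>. agree (known V ?P) M M0})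
      \<le> 2 ^ (2 * (n - x - 1) - x) * (if x0 \<le> x \<and> x < 2 * x0 then sqrt ((3/4) ^ m) else 1)"
    proof (cases "x0 \<le> x \<and> x < 2 * x0")
      case True
      have "real (cnt (known V (insert ?k ?P)) {M \<in> \<M>. agree (known V ?P) M M0})
          \<le> 2 ^ (2 * card (V - ?P - {?k}) - card ?P) * sqrt ((3/4) ^ m)"
      proof (rule step_halasz[OF V P(1) k MQ M0 ind])
        fix J assume "J \<subseteq> V - ?P - {?k}" "card J \<le> 2 * card ?P"
        then show "\<exists>S\<subseteq>?P. card S = m \<and> indep (row M0) S ((V - ?P - {?k} - J) \<times> UNIV)"
          using rk[OF M0] True x cP unfolding rankcond_def by auto
      qed
      then show ?thesis using True cJ cP by simp
    next
      case False
      have "finite ?P" by simp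
      moreover have "finite ((V - ?P - {?k}) \<times> (UNIV :: bool set))" using V by simp
      ultimately obtain Q' where Q': "Q' \<subseteq> (V - ?P - {?k}) \<times> UNIV" "card Q' = card ?P" "indep (tr (row M0)) Q' ?P"
        using ex_square_subset[OF ind] by metis
      have "real (cnt (known V (insert ?k ?P)) {M \<in> \<M>. agree (known V ?P) M M0})
          \<le> 2 ^ (2 * card (V - ?P - {?k}) - card Q')"
        by (rule step_odlyzko[OF V P(1) k MQ M0 _ Q'(1,3)]) simp
      then show ?thesis using False cJ cP Q'(2) by auto
    qed
  qed simp
  then show ?thesis by simp
qed

text \<open>A row in the span of the rows \<open>Il\<close> is fixed by its entries on
  \<open>s\<close> columns. These are read off from \<open>M0\<close>, but serve its whole fibre
  because the rows \<open>Il\<close> are already known.\<close>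

lemma stage_R_span:
  assumes R1: "R1 \<subseteq> set Rl" "card R1 = r1"
  shows "real (cnt (known V (set Il \<union> R1)) \<M>) \<le> real (cnt (known V (set Il)) \<M>) * 2 ^ (r1 * s)"
proof (rule cnt_step[OF finM])
  show "known V (set Il) \<subseteq> known V (set Il \<union> R1)" by (rule known_mono) simp
  fix M0 assume M0: "M0 \<in> \<M>"
  let ?F = "{M \<in> \<M>. agree (known V (set Il)) M M0}"
  obtain pk where Q: "indep (row M0) (set Il) (set Bl \<times> UNIV \<union> (\<lambda>j. (j, pk j)) ` set Al)" (is "indep _ _ ?Q")
    and cQ: "card (set Bl \<times> UNIV \<union> (\<lambda>j. (j, pk j)) ` set Al) = s"
    using goodE[OF gd[OF M0]] by metis
  have fR: "finite R1" using R1 finite_subset by blast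
  have QV: "?Q \<subseteq> (V - set Il - {k}) \<times> UNIV" if "k \<in> R1" for k
    using that R1 setV dist by auto
  let ?D = "\<Union>k\<in>R1. cell k ` ?Q"
  show "real (cnt (known V (set Il \<union> R1)) ?F) \<le> 2 ^ (r1 * s)"
  proof (rule cnt_le_determined[of ?D])
    show "finite ?D" using fR by simp
    have "card ?D \<le> (\<Sum>k\<in>R1. card (cell k ` ?Q))" by (rule card_UN_le[OF fR])
    also have "\<dots> \<le> (\<Sum>k\<in>R1. s)"
    proof (intro sum_mono)
      show "card (cell k ` ?Q) \<le> s" for k using card_image_le[of ?Q "cell k"] cQ by simp
    qed
    finally show "card ?D \<le> r1 * s" using R1 by simp
    show "M c \<in> {-1, 1}" if "M \<in> ?F" "c \<in> ?D" for M c
    proof -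
      obtain k z where "k \<in> R1" "z \<in> ?Q" "c = cell k z" using \<open>c \<in> ?D\<close> by blast
      then have "c \<in> V \<times> V" using setV R1 QV[of k] by (auto intro!: cell_in)
      then show ?thesis using that(1) MQ QN_sign by blast
    qed
    fix M M' assume M: "M \<in> ?F" and M': "M' \<in> ?F" and ag: "agree ?D M M'"
    have eq: "row M k z = row M' k z" if k: "k \<in> R1" and z: "z \<in> (V - set Il - {k}) \<times> UNIV" for k z
    proof -
      let ?Z = "(V - set Il - {k}) \<times> (UNIV :: bool set)"
      have kR: "k \<in> set Rl" using k R1 by blast
      obtain l where l: "\<forall>z\<in>?Z. row M k z = (\<Sum>i\<in>set Il. l i * row M i z)"
        using gd[of M] M kR unfolding good_def by blast
      obtain l' where l': "\<forall>z\<in>?Z. row M' k z = (\<Sum>i\<in>set Il. l' i * row M' i z)"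
        using gd[of M'] M' kR unfolding good_def by blast
      have kn: "cell i z \<in> known V (set Il)" if "i \<in> set Il" "z \<in> ?Z" for i z
        using that setV by (intro cell_known) auto
      show ?thesis
      proof (rule span_determined[OF Q QV[OF k] _ _ l l' _ z])
        show "row M i z = row M0 i z" "row M' i z = row M0 i z" if "i \<in> set Il" "z \<in> ?Z" for i z
          using kn[OF that] M M' by (simp_all add: agree_def row_def)
        show "row M k z = row M' k z" if "z \<in> ?Q" for z
        proof -
          have "cell k z \<in> ?D" using k that by blast
          then show ?thesis using ag unfolding agree_def row_def by blast
        qed
      qed
    qed
    show "agree (known V (set Il \<union> R1)) M M'"
      unfolding agree_def
    proof
      fix c assume c: "c \<in> known V (set Il \<union> R1)"
      obtain i j where e: "c = (i, j)" by (cases c)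
      show "M c = M' c"
      proof (cases "c \<in> known V (set Il)")
        case True then show ?thesis using M M' by (simp add: agree_def)
      next
        case False
        then have ij: "i \<in> V" "j \<in> V" "i \<noteq> j" "i \<notin> set Il" "j \<notin> set Il" "i \<in> R1 \<or> j \<in> R1"
          using c e by (auto simp: known_def)
        then show ?thesis using eq[of i "(j, True)"] eq[of j "(i, False)"] e by (auto simp: row_def)
      qed
    qed
  qed
qed

text \<open>The alternative to the span: the \<open>s\<close> independent columns belong to
  \<open>Al\<close> and \<open>Bl\<close>, hence stay unknown throughout this stage and provide
  \<open>s\<close> equations at every step.\<close>

lemma stage_R_lin:
  assumes r1: "r1 \<le> r"
  shows "real (cnt (known V (set Il \<union> set Rl)) \<M>)
    \<le> real (cnt (known V (set Il \<union> set (take r1 Rl))) \<M>) * (\<Prod>i<r - r1. 2 ^ (2 * (n - s - r1 - i - 1) - s))"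
proof -
  let ?P = "set Il \<union> set (take r1 Rl)" and ?L = "drop r1 Rl"
  have "real (cnt (known V (?P \<union> set ?L)) \<M>) \<le> real (cnt (known V ?P) \<M>) * (\<Prod>i<length ?L. 2 ^ (2 * (n - s - r1 - i - 1) - s))"
  proof (rule cnt_chain[OF finM])
    fix i M0 assume i: "i < length ?L" and M0: "M0 \<in> \<M>"
    let ?S = "?P \<union> set (take i ?L)" and ?k = "?L ! i"
    have Se: "?S = set Il \<union> set (take (r1 + i) Rl)" by (simp add: take_add Un_assoc)
    have ke: "?k = Rl ! (r1 + i)" using r1 by simp
    have ri: "r1 + i < r" using i by simp
    have dR: "distinct Rl" "set Il \<inter> set Rl = {}" "distinct Il" using dist by auto
    have kR: "?k \<in> set Rl" using ri ke by simp
    have S: "?S \<subseteq> V" unfolding Se using setV set_take_subset[of "r1 + i" Rl] by auto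
    have knS: "?k \<notin> ?S"
    proof -
      have "?k \<in> set (drop (r1 + i) Rl)" unfolding ke using ri by (metis Cons_nth_drop_Suc list.set_intros(1))
      moreover have "set (take (r1 + i) Rl) \<inter> set (drop (r1 + i) Rl) = {}"
        using dR(1) by (metis append_take_drop_id distinct_append)
      ultimately show ?thesis unfolding Se using kR dR(2) by auto
    qed
    have k: "?k \<in> V - ?S" using knS kR setV by blast
    have cS: "card ?S = s + (r1 + i)"
    proof -
      have "card ?S = card (set Il) + card (set (take (r1 + i) Rl))"
        unfolding Se using dR(2) set_take_subset[of "r1 + i" Rl] by (intro card_Un_disjoint) auto
      then show ?thesis using dR ri by (simp add: distinct_card)
    qed
    have cJ: "card (V - ?S - {?k}) = n - s - r1 - i - 1"
      using V S k cS by (simp add: card_Diff_subset finite_subset)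
    obtain pk where Q: "indep (tr (row M0)) (set Bl \<times> UNIV \<union> (\<lambda>j. (j, pk j)) ` set Al) (set Il)" (is "indep _ ?Q _")
      and cQ: "card (set Bl \<times> UNIV \<union> (\<lambda>j. (j, pk j)) ` set Al) = s"
      using goodE[OF gd[OF M0]] by metis
    have QJ: "?Q \<subseteq> (V - ?S - {?k}) \<times> UNIV"
      using setV dist kR set_take_subset[of "r1 + i" Rl] unfolding Se by auto
    have "real (cnt (known V (insert ?k ?S)) {M \<in> \<M>. agree (known V ?S) M M0})
        \<le> 2 ^ (2 * card (V - ?S - {?k}) - card ?Q)"
      by (rule step_odlyzko[OF V S k MQ M0 _ QJ Q]) auto
    then show "real (cnt (known V (insert ?k ?S)) {M \<in> \<M>. agree (known V ?S) M M0})
        \<le> 2 ^ (2 * (n - s - r1 - i - 1) - s)"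
      unfolding cJ cQ .
  qed simp
  moreover have "?P \<union> set ?L = set Il \<union> set Rl"
    by (metis append_take_drop_id set_append sup_assoc)
  ultimately show ?thesis by simp
qed

text \<open>Among the columns left, both for each index of \<open>Bl\<close> and one for each
  remaining index of \<open>Al\<close> are independent, so 2 (a + b - 1 - i) - (2 b + a - 1 - i) = a
  - 1 - i bits remain. Once \<open>Al\<close> is exhausted everything is determined, in accordance
  with truncated subtraction.\<close>

lemma stage_U:
  "real (card \<M>) \<le> real (cnt (known V (set Il \<union> set Rl)) \<M>) * (\<Prod>i<a + b. 2 ^ (a - 1 - i))"
proof -
  let ?P = "set Il \<union> set Rl" and ?L = "Al @ Bl"
  have "real (cnt (known V (?P \<union> set ?L)) \<M>) \<le> real (cnt (known V ?P) \<M>) * (\<Prod>i<length ?L. 2 ^ (a - 1 - i))"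
  proof (rule cnt_chain[OF finM])
    fix i M0 assume i: "i < length ?L" and M0: "M0 \<in> \<M>"
    let ?S = "?P \<union> set (take i ?L)" and ?k = "?L ! i"
    let ?J = "set (drop (Suc i) ?L)"
    have dL: "distinct ?L" "?P \<inter> set ?L = {}" using dist by auto
    have eL: "?L = take i ?L @ ?k # drop (Suc i) ?L" using i by (rule id_take_nth_drop)
    have dec: "set ?L = set (take i ?L) \<union> {?k} \<union> ?J"
      using arg_cong[OF eL, of set] by auto
    have dd: "set (take i ?L) \<inter> ?J = {}" "?k \<notin> set (take i ?L)" "?k \<notin> ?J"
      using dL(1) eL by (metis distinct_append distinct.simps(2) disjoint_insert(1) list.simps(15) Int_commute)+
    have VL: "V = ?P \<union> set ?L" using setV by auto
    have S: "?S \<subseteq> V" unfolding VL using dec by auto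
    have k: "?k \<in> V - ?S" using dL(2) dd(2) dec VL by auto
    have J: "V - ?S - {?k} = ?J" using dL(2) dd dec VL by auto
    have cJ: "card ?J = a + b - 1 - i" using dL(1) by (simp add: distinct_card del: drop_append)
    obtain pk where Q: "indep (tr (row M0)) (set Bl \<times> UNIV \<union> (\<lambda>j. (j, pk j)) ` set Al) (set Il)" (is "indep _ ?Q _")
      using goodE[OF gd[OF M0]] by metis
    have dAB: "distinct Al" "distinct Bl" "set Al \<inter> set Bl = {}" using dist by auto
    have "\<exists>Q'. Q' \<subseteq> ?Q \<and> Q' \<subseteq> ?J \<times> UNIV \<and> 2 * card ?J - card Q' \<le> a - 1 - i"
    proof (cases "i < a")
      case True
      let ?Q' = "set Bl \<times> UNIV \<union> (\<lambda>j. (j, pk j)) ` set (drop (Suc i) Al)"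
      have dA: "set (drop (Suc i) Al) \<subseteq> set Al" by (rule set_drop_subset)
      have J': "?J = set (drop (Suc i) Al) \<union> set Bl" using True by simp
      have "card ?Q' = card (set Bl \<times> (UNIV :: bool set)) + card ((\<lambda>j. (j, pk j)) ` set (drop (Suc i) Al))"
        using dA dAB by (intro card_Un_disjoint) auto
      also have "card ((\<lambda>j. (j, pk j)) ` set (drop (Suc i) Al)) = a - Suc i"
        using dAB by (subst card_image) (auto simp: inj_on_def distinct_card)
      finally have "card ?Q' = 2 * b + (a - Suc i)" using dAB by (simp add: card_cartesian_product distinct_card)
      then have "2 * card ?J - card ?Q' \<le> a - 1 - i" unfolding cJ using True by simp
      moreover have "?Q' \<subseteq> ?Q" using dA by auto
      moreover have "?Q' \<subseteq> ?J \<times> UNIV" unfolding J' by auto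
      ultimately show ?thesis by blast
    next
      case False
      then have "?J \<subseteq> set Bl" using set_drop_subset[of "Suc i - a" Bl] by simp
      then have "?J \<times> UNIV \<subseteq> ?Q" by auto
      moreover have "2 * card ?J - card (?J \<times> (UNIV :: bool set)) \<le> a - 1 - i"
        by (simp add: card_cartesian_product)
      ultimately show ?thesis by blast
    qed
    then obtain Q' where Q': "Q' \<subseteq> ?Q" "Q' \<subseteq> ?J \<times> UNIV" "2 * card ?J - card Q' \<le> a - 1 - i" by blast
    have "indep (tr (row M0)) Q' (set Il)"
      by (rule indep_subset_rows[OF Q Q'(1)]) simp
    then have "real (cnt (known V (insert ?k ?S)) {M \<in> \<M>. agree (known V ?S) M M0})
        \<le> 2 ^ (2 * card (V - ?S - {?k}) - card Q')"
      using Q'(2) unfolding J[symmetric] by (intro step_odlyzko[OF V S k MQ M0, of "set Il"]) auto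
    also have "\<dots> \<le> 2 ^ (a - 1 - i)" unfolding J using Q'(3) by (intro power_increasing) auto
    finally show "real (cnt (known V (insert ?k ?S)) {M \<in> \<M>. agree (known V ?S) M M0}) \<le> 2 ^ (a - 1 - i)" .
  qed simp
  moreover have "?P \<union> set ?L = V" using setV by auto
  moreover have "known V V = V \<times> V" by (auto simp: known_def)
  moreover have "cnt (V \<times> V) \<M> = card \<M>" using MQ by (intro cnt_full) (auto simp: QN_def)
  ultimately show ?thesis by simp
qed

text \<open>With D indices left, an index of \<open>Rl\<close> costs \<open>s\<close> bits by the
  span and 2 (D - 1) - s by equations. The costs cross near D = s, that is after
  \<open>n - 2 * s\<close> indices of \<open>Rl\<close>. Truncation to 0 for 2 s > n produces the
  second branch of \<open>dv_g\<close>; the first summand pays for the diagonal.\<close>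

definition bits_g :: nat where
  "bits_g = n + (\<Sum>x<s. 2 * (n - x - 1) - x) + (n - 2 * s) * s
     + (\<Sum>i<r - (n - 2 * s). 2 * (n - s - (n - 2 * s) - i - 1) - s) + (\<Sum>i<a + b. a - 1 - i)"

lemma count_g:
  assumes rk: "\<And>M. M \<in> \<M> \<Longrightarrow> rankcond V Il x0 m M" and x0: "2 * x0 \<le> s"
  shows "real (card \<M>) \<le> 2 ^ bits_g * sqrt ((3/4) ^ m) ^ x0"
proof -
  let ?r1 = "n - 2 * s"
  have r1: "?r1 \<le> r" using cardV len by simp
  have dR: "distinct Rl" using dist by simp
  have "(\<Prod>x<s. 2 ^ (2 * (n - x - 1) - x) * (if x0 \<le> x \<and> x < 2 * x0 then sqrt ((3/4) ^ m) else 1))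
     = 2 ^ (\<Sum>x<s. 2 * (n - x - 1) - x) * (\<Prod>x<s. if x0 \<le> x \<and> x < 2 * x0 then sqrt ((3/4) ^ m) else 1)"
    by (simp add: prod.distrib power_sum)
  also have "(\<Prod>x<s. if x0 \<le> x \<and> x < 2 * x0 then sqrt ((3/4) ^ m) else 1)
      = (\<Prod>x\<in>{x0..<2 * x0}. sqrt ((3/4) ^ m))"
    using x0 by (intro prod.mono_neutral_cong_right) auto
  also have "\<dots> = sqrt ((3/4) ^ m) ^ x0" by simp
  finally have pI: "(\<Prod>x<s. 2 ^ (2 * (n - x - 1) - x) * (if x0 \<le> x \<and> x < 2 * x0 then sqrt ((3/4) ^ m) else 1))
     = 2 ^ (\<Sum>x<s. 2 * (n - x - 1) - x) * sqrt ((3/4) ^ m) ^ x0" .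
  have 1: "real (cnt (known V (set Il)) \<M>) \<le> 2 ^ n * (2 ^ (\<Sum>x<s. 2 * (n - x - 1) - x) * sqrt ((3/4) ^ m) ^ x0)"
  proof -
    have "real (cnt (known V (set Il)) \<M>) \<le> real (cnt (known V {}) \<M>) *
        (2 ^ (\<Sum>x<s. 2 * (n - x - 1) - x) * sqrt ((3/4) ^ m) ^ x0)"
      unfolding pI[symmetric] by (rule stage_I) (rule rk)
    also have "\<dots> \<le> 2 ^ n * (2 ^ (\<Sum>x<s. 2 * (n - x - 1) - x) * sqrt ((3/4) ^ m) ^ x0)"
      by (rule mult_right_mono[OF known_empty]) simp
    finally show ?thesis .
  qed
  have 2: "real (cnt (known V (set Il \<union> set (take ?r1 Rl))) \<M>)
      \<le> 2 ^ n * (2 ^ (\<Sum>x<s. 2 * (n - x - 1) - x) * sqrt ((3/4) ^ m) ^ x0) * 2 ^ (?r1 * s)"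
  proof (rule order_trans[OF stage_R_span mult_right_mono[OF 1]])
    show "set (take ?r1 Rl) \<subseteq> set Rl" by (rule set_take_subset)
    show "card (set (take ?r1 Rl)) = ?r1" using dR r1 by (simp add: distinct_card)
  qed simp
  have 3: "real (cnt (known V (set Il \<union> set Rl)) \<M>)
      \<le> 2 ^ n * (2 ^ (\<Sum>x<s. 2 * (n - x - 1) - x) * sqrt ((3/4) ^ m) ^ x0) * 2 ^ (?r1 * s)
        * (\<Prod>i<r - ?r1. 2 ^ (2 * (n - s - ?r1 - i - 1) - s))"
    by (rule order_trans[OF stage_R_lin[OF r1] mult_right_mono[OF 2]]) (simp add: prod_nonneg)
  have "real (card \<M>)
      \<le> 2 ^ n * (2 ^ (\<Sum>x<s. 2 * (n - x - 1) - x) * sqrt ((3/4) ^ m) ^ x0) * 2 ^ (?r1 * s)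
        * (\<Prod>i<r - ?r1. 2 ^ (2 * (n - s - ?r1 - i - 1) - s)) * (\<Prod>i<a + b. 2 ^ (a - 1 - i))"
    by (rule order_trans[OF stage_U mult_right_mono[OF 3]]) (simp add: prod_nonneg)
  also have "\<dots> = 2 ^ bits_g * sqrt ((3/4) ^ m) ^ x0"
    by (simp add: bits_g_def power_add power_sum mult_ac)
  finally show ?thesis .
qed

end

text \<open>The data needed to read the cells between \<open>Il\<close>, \<open>Rl\<close> and
  \<open>Al\<close>, \<open>Bl\<close> economically; \<open>Sp\<close> marks the special indices.
  \<open>E\<close> and \<open>ix\<close> are prescribed rather than chosen from the matrix, because
  their independence involves the column \<open>(j, False)\<close>, which is not yet known when the
  cells to be read are selected.\<close>

definition goodf where
  "goodf Il Rl Al Bl Sp d E ix M \<longleftrightarrow>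
     (\<forall>l\<in>set Al \<union> set Bl. d l \<in> dirs) \<and>
     indep (zrow M d) (set Bl \<inter> Sp) (set Il \<union> set Rl) \<and>
     (\<forall>j\<in>set Al \<inter> Sp. \<exists>\<mu>. \<forall>i\<in>set Il \<union> set Rl. zrow M d j i = (\<Sum>l\<in>set Bl \<inter> Sp. \<mu> l * zrow M d l i)) \<and>
     E \<subseteq> set Il \<union> set Rl \<and> card E = 2 * length Bl \<and>
     (\<forall>j\<in>set Al - Sp. ix j \<in> set Il \<union> set Rl \<and>
        indep (tr (row M)) (insert (j, False) (set Bl \<times> UNIV)) (insert (ix j) E) \<and>
        (\<exists>\<beta> g. \<beta> \<notin> {0, 1, -1} \<and> (\<forall>i\<in>set Il \<union> set Rl.
           row M i (j, True) + \<beta> * row M i (j, False) = (\<Sum>z\<in>set Bl \<times> UNIV. g z * row M i z))))"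

text \<open>The four values of x + \<beta> y on signs are distinct exactly when \<beta> avoids 0, 1
  and -1.\<close>

lemma sign_pair:
  fixes x y x' y' \<beta> :: real
  assumes "x \<in> {-1, 1}" "y \<in> {-1, 1}" "x' \<in> {-1, 1}" "y' \<in> {-1, 1}" "\<beta> \<notin> {0, 1, -1}"
    "x + \<beta> * y = x' + \<beta> * y'"
  shows "x = x' \<and> y = y'"
  using assms by auto

text \<open>Both entries on \<open>Es\<close> determine the coefficients and thus the combination in
  every row; in the other rows one entry is enough. The entry with flag \<open>True\<close> is read
  if the direction involves the other one, which is then solved for, and the entry with flag
  \<open>False\<close> otherwise.\<close>

lemma special_determined:
  assumes ind: "indep Z0 L Es" and d: "d j \<in> dirs" and Es: "Es \<subseteq> T"
    and l: "\<forall>i\<in>T. zrow M d j i = (\<Sum>l\<in>L. \<mu> l * Z0 l i)"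
    and l': "\<forall>i\<in>T. zrow M' d j i = (\<Sum>l\<in>L. \<mu>' l * Z0 l i)"
    and ag: "\<And>i b. i \<in> Es \<Longrightarrow> row M i (j, b) = row M' i (j, b)"
    and ag': "\<And>i. i \<in> T - Es \<Longrightarrow> row M i (j, snd (d j) \<noteq> 0) = row M' i (j, snd (d j) \<noteq> 0)"
    and i: "i \<in> T"
  shows "row M i (j, b) = row M' i (j, b)"
proof (cases "i \<in> Es")
  case False
  have "\<mu> l - \<mu>' l = 0" if "l \<in> L" for l
  proof (rule indepD[OF ind _ that])
    fix e assume e: "e \<in> Es"
    then have "zrow M d j e = zrow M' d j e" using ag[OF e] by (simp add: zrow_def)
    then show "(\<Sum>l\<in>L. (\<mu> l - \<mu>' l) * Z0 l e) = 0"
      using l l' e Es by (auto simp: left_diff_distrib sum_subtractf)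
  qed
  then have "(\<Sum>l\<in>L. \<mu> l * Z0 l i) = (\<Sum>l\<in>L. \<mu>' l * Z0 l i)" by (intro sum.cong) auto
  then have z: "zrow M d j i = zrow M' d j i" using l l' i by simp
  have a: "row M i (j, snd (d j) \<noteq> 0) = row M' i (j, snd (d j) \<noteq> 0)" using ag' i False by simp
  show ?thesis
  proof (cases "snd (d j) = 0")
    case True
    then have "fst (d j) \<noteq> 0" using d by (auto simp: dirs_def)
    then show ?thesis using z a True by (cases b) (auto simp: zrow_def)
  next
    case F: False
    then show ?thesis using z a by (cases b) (auto simp: zrow_def)
  qed
qed (use ag in simp)

text \<open>On \<open>Ei\<close> the two relations differ by a relation between independent columns,
  so their coefficients coincide. The combinations then agree in every row, and
  \<open>sign_pair\<close> separates the two entries.\<close>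

lemma generic_determined:
  assumes ind: "indep (tr (row M)) (insert (j, False) C) Ei" and j: "(j, False) \<notin> C" "finite C" and Ei: "Ei \<subseteq> T"
    and l: "\<forall>i\<in>T. row M i (j, True) + \<beta> * row M i (j, False) = (\<Sum>z\<in>C. g z * row M i z)"
    and l': "\<forall>i\<in>T. row M' i (j, True) + \<beta>' * row M' i (j, False) = (\<Sum>z\<in>C. g' z * row M' i z)"
    and \<beta>: "\<beta> \<notin> {0, 1, -1}"
    and C: "\<And>i z. i \<in> T \<Longrightarrow> z \<in> C \<Longrightarrow> row M i z = row M' i z"
    and ag: "\<And>i b. i \<in> Ei \<Longrightarrow> row M i (j, b) = row M' i (j, b)"
    and sgn: "\<And>i b. i \<in> T \<Longrightarrow> row M i (j, b) \<in> {-1, 1} \<and> row M' i (j, b) \<in> {-1, 1}"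
    and i: "i \<in> T"
  shows "row M i (j, b) = row M' i (j, b)"
proof -
  define f where "f z = (if z = (j, False) then \<beta> - \<beta>' else g' z - g z)" for z
  have f0: "f z = 0" if "z \<in> insert (j, False) C" for z
  proof (rule indepD[OF ind _ that])
    fix e assume e: "e \<in> Ei"
    then have eT: "e \<in> T" using Ei by blast
    have "(\<Sum>z\<in>C. f z * tr (row M) z e) = (\<Sum>z\<in>C. g' z * row M e z) - (\<Sum>z\<in>C. g z * row M e z)"
      unfolding sum_subtractf[symmetric] using j by (intro sum.cong) (auto simp: f_def tr_def left_diff_distrib)
    also have "(\<Sum>z\<in>C. g' z * row M e z) = row M' e (j, True) + \<beta>' * row M' e (j, False)"
      using l' eT C[OF eT] by simp
    also have "(\<Sum>z\<in>C. g z * row M e z) = row M e (j, True) + \<beta> * row M e (j, False)"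
      using l eT by simp
    finally have "(\<Sum>z\<in>C. f z * tr (row M) z e) = - (\<beta> - \<beta>') * row M e (j, False)"
      using ag[OF e] by (simp add: algebra_simps)
    then show "(\<Sum>z\<in>insert (j, False) C. f z * tr (row M) z e) = 0"
      using j by (simp add: f_def tr_def algebra_simps)
  qed
  have b: "\<beta>' = \<beta>" using f0[of "(j, False)"] by (simp add: f_def)
  have "g' z = g z" if "z \<in> C" for z
  proof -
    have "z \<noteq> (j, False)" using that j(1) by blast
    then show ?thesis using f0[of z] that by (simp add: f_def)
  qed
  then have "(\<Sum>z\<in>C. g' z * row M' i z) = (\<Sum>z\<in>C. g z * row M i z)"
    using C[OF i] by (intro sum.cong) auto
  then have "row M i (j, True) + \<beta> * row M i (j, False) = row M' i (j, True) + \<beta> * row M' i (j, False)"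
    using l l' i b by simp
  from sign_pair[OF _ _ _ _ \<beta> this] sgn[OF i] show ?thesis by (cases b) auto
qed

context good_class
begin

abbreviation "T \<equiv> set Il \<union> set Rl"
abbreviation "U \<equiv> set Al \<union> set Bl"

text \<open>All cells towards \<open>Bl\<close> are read outright. A special index of
  \<open>Al\<close> costs one bit per row and a second one on a set of card (set Bl \<inter> Sp)
  rows; any other index costs both entries on the 2 b + 1 rows given by \<open>E\<close> and
  \<open>ix\<close>.\<close>

definition bits_tu :: "'v set \<Rightarrow> nat" where
  "bits_tu Sp = 2 * ((s + r) * b) + card (set Al \<inter> Sp) * ((s + r) + card (set Bl \<inter> Sp))
     + card (set Al - Sp) * (2 * (2 * b + 1))"

lemma cardT: "card T = s + r"
  using dist by (subst card_Un_disjoint) (auto simp: distinct_card)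

lemma count_TU:
  assumes gf: "\<And>M. M \<in> \<M> \<Longrightarrow> goodf Il Rl Al Bl Sp d E ix M"
  shows "real (cnt (T \<times> U \<union> U \<times> T) \<M>) \<le> 2 ^ bits_tu Sp"
proof -
  let ?B = "set Bl"
  let ?C1 = "T \<times> ?B \<union> ?B \<times> T" and ?C0 = "T \<times> U \<union> U \<times> T"
  have cB: "card ?B = b" using dist by (simp add: distinct_card)
  have TV: "T \<subseteq> V" "U \<subseteq> V" "?B \<subseteq> V" using setV by auto
  have 1: "real (cnt ?C1 \<M>) \<le> 2 ^ (2 * ((s + r) * b))"
  proof (rule cnt_le_cells[OF MQ])
    show "card ?C1 \<le> 2 * ((s + r) * b)" using cells_le_times[of T ?B] unfolding cardT cB by simp
    show "?C1 \<subseteq> V \<times> V" using TV by blast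
  qed simp
  let ?m = "card (set Al \<inter> Sp) * ((s + r) + card (?B \<inter> Sp)) + card (set Al - Sp) * (2 * (2 * b + 1))"
  have "real (cnt ?C0 \<M>) \<le> real (cnt ?C1 \<M>) * 2 ^ ?m"
  proof (rule cnt_step[OF finM])
    show "?C1 \<subseteq> ?C0" by auto
    fix M0 assume M0: "M0 \<in> \<M>"
    let ?F = "{M \<in> \<M>. agree ?C1 M M0}"
    note g0 = gf[OF M0, unfolded goodf_def]
    have "indep (zrow M0 d) (?B \<inter> Sp) T" using g0 by blast
    \<comment> \<open>In contrast to \<open>E\<close>, the set \<open>Es\<close> may be taken from
      \<open>M0\<close>: it depends only on the columns of \<open>Bl\<close>, which are constant on
      the fibre.\<close>
    then obtain Es where Es: "Es \<subseteq> T" "card Es = card (?B \<inter> Sp)" "indep (zrow M0 d) (?B \<inter> Sp) Es"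
      by (rule ex_square_subset) auto
    have fEs: "finite Es" using Es(1) by (rule finite_subset) simp
    have E: "E \<subseteq> T" "card E = 2 * b" using g0 by blast+
    have fE: "finite E" using E(1) by (rule finite_subset) simp
    have dd: "d l \<in> dirs" if "l \<in> U" for l using g0 that by blast
    have ixT: "ix j \<in> T" if "j \<in> set Al - Sp" for j using g0 that by blast
    define Ds where "Ds j = (\<lambda>p. cell (fst p) (j, snd p)) ` (Es \<times> UNIV \<union> (T - Es) \<times> {snd (d j) \<noteq> 0})" for j
    define Dg where "Dg j = (\<lambda>p. cell (fst p) (j, snd p)) ` (insert (ix j) E \<times> UNIV)" for j
    have fD: "finite (Ds j)" "finite (Dg j)" for j using fEs fE by (simp_all add: Ds_def Dg_def)
    have cDs: "card (Ds j) \<le> (s + r) + card (?B \<inter> Sp)" for j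
    proof -
      have "card (Ds j) \<le> card (Es \<times> (UNIV :: bool set) \<union> (T - Es) \<times> {snd (d j) \<noteq> 0})"
        unfolding Ds_def using fEs by (intro card_image_le) simp
      also have "\<dots> \<le> card (Es \<times> (UNIV :: bool set)) + card ((T - Es) \<times> {snd (d j) \<noteq> 0})"
        by (rule card_Un_le)
      also have "\<dots> = 2 * card Es + (card T - card Es)"
        using Es fEs by (simp add: card_cartesian_product card_Diff_subset)
      also have "\<dots> = (s + r) + card (?B \<inter> Sp)"
        using card_mono[OF _ Es(1)] unfolding cardT Es(2) by simp
      finally show ?thesis .
    qed
    have cDg: "card (Dg j) \<le> 2 * (2 * b + 1)" for j
    proof -
      have "card (Dg j) \<le> card (insert (ix j) E \<times> (UNIV :: bool set))"
        unfolding Dg_def using fE by (intro card_image_le) simp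
      also have "\<dots> \<le> 2 * (2 * b + 1)"
        using card_insert_le_m1[of "2 * b + 1" E "ix j"] E(2) by (simp add: card_cartesian_product)
      finally show ?thesis .
    qed
    let ?D = "(\<Union>j\<in>set Al \<inter> Sp. Ds j) \<union> (\<Union>j\<in>set Al - Sp. Dg j)"
    show "real (cnt ?C0 ?F) \<le> 2 ^ ?m"
    proof (rule cnt_le_determined[of ?D])
      show "finite ?D" using fD by simp
      have "card ?D \<le> card (\<Union>j\<in>set Al \<inter> Sp. Ds j) + card (\<Union>j\<in>set Al - Sp. Dg j)" by (rule card_Un_le)
      also have "\<dots> \<le> (\<Sum>j\<in>set Al \<inter> Sp. card (Ds j)) + (\<Sum>j\<in>set Al - Sp. card (Dg j))"
        by (intro add_mono card_UN_le) auto
      also have "\<dots> \<le> (\<Sum>j\<in>set Al \<inter> Sp. (s + r) + card (?B \<inter> Sp)) + (\<Sum>j\<in>set Al - Sp. 2 * (2 * b + 1))"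
        using cDs cDg by (intro add_mono sum_mono) auto
      finally show "card ?D \<le> ?m" by simp
      show "M c \<in> {-1, 1}" if M: "M \<in> ?F" and c: "c \<in> ?D" for M c
      proof -
        have EV: "Es \<subseteq> V" "E \<subseteq> V" using TV(1) Es(1) E(1) by (meson subset_trans)+
        have "Ds j \<subseteq> V \<times> V" if "j \<in> set Al \<inter> Sp" for j
          unfolding Ds_def using that TV EV by (intro image_subsetI cell_in) auto
        moreover have "Dg j \<subseteq> V \<times> V" if "j \<in> set Al - Sp" for j
        proof -
          have "ix j \<in> V" using ixT[OF that] TV(1) by (rule rev_subsetD)
          then show ?thesis unfolding Dg_def using that TV EV by (intro image_subsetI cell_in) auto
        qed
        ultimately have "c \<in> V \<times> V" using c by blast
        then show ?thesis using M MQ QN_sign by blast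
      qed
      fix M M' assume M: "M \<in> ?F" and M': "M' \<in> ?F" and ag: "agree ?D M M'"
      have MM: "M \<in> \<M>" "M' \<in> \<M>" using M M' by auto
      note gM = gf[OF MM(1), unfolded goodf_def] and gM' = gf[OF MM(2), unfolded goodf_def]
      have rB: "row M i (l, c) = row M0 i (l, c)" "row M' i (l, c) = row M0 i (l, c)"
        if "i \<in> T" "l \<in> ?B" for i l c
      proof -
        have "cell i (l, c) \<in> ?C1" using that by (auto simp: cell_def)
        then show "row M i (l, c) = row M0 i (l, c)" "row M' i (l, c) = row M0 i (l, c)"
          using M M' by (auto simp: agree_def row_def simp del: Un_iff)
      qed
      have rU: "row M i (j, c) = row M' i (j, c)" if i: "i \<in> T" and j: "j \<in> U" for i j c
      proof -
        consider "j \<in> ?B" | "j \<in> set Al \<inter> Sp" | "j \<in> set Al - Sp" using j by blast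
        then show ?thesis
        proof cases
          case 1 then show ?thesis using rB[OF i, of j c] by simp
        next
          case 2
          obtain \<mu> where \<mu>: "\<forall>i\<in>T. zrow M d j i = (\<Sum>l\<in>?B \<inter> Sp. \<mu> l * zrow M d l i)" using gM 2 by blast
          obtain \<mu>' where \<mu>': "\<forall>i\<in>T. zrow M' d j i = (\<Sum>l\<in>?B \<inter> Sp. \<mu>' l * zrow M' d l i)" using gM' 2 by blast
          have z: "zrow M d l i = zrow M0 d l i" "zrow M' d l i = zrow M0 d l i" if "i \<in> T" "l \<in> ?B \<inter> Sp" for i l
            using rB that by (simp_all add: zrow_def)
          have agD: "M c = M' c" if "c \<in> Ds j" for c using ag 2 that unfolding agree_def by blast
          show ?thesis
          proof (rule special_determined[OF Es(3) _ Es(1), where d = d and \<mu> = \<mu> and \<mu>' = \<mu>'])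
            show "d j \<in> dirs" using dd j by blast
            show "\<forall>i\<in>T. zrow M d j i = (\<Sum>l\<in>?B \<inter> Sp. \<mu> l * zrow M0 d l i)" using \<mu> z by simp
            show "\<forall>i\<in>T. zrow M' d j i = (\<Sum>l\<in>?B \<inter> Sp. \<mu>' l * zrow M0 d l i)" using \<mu>' z by simp
            show "row M i (j, b) = row M' i (j, b)" if "i \<in> Es" for i b
            proof -
              have "cell i (j, b) \<in> Ds j" unfolding Ds_def by (rule image_eqI[of _ _ "(i, b)"]) (use that in simp_all)
              then show ?thesis using agD unfolding row_def by blast
            qed
            show "row M i (j, snd (d j) \<noteq> 0) = row M' i (j, snd (d j) \<noteq> 0)" if "i \<in> T - Es" for i
            proof -
              have "cell i (j, snd (d j) \<noteq> 0) \<in> Ds j"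
                unfolding Ds_def by (rule image_eqI[of _ _ "(i, snd (d j) \<noteq> 0)"]) (use that in simp_all)
              then show ?thesis using agD unfolding row_def by blast
            qed
            show "i \<in> T" by fact
          qed
        next
          case 3
          have indj: "indep (tr (row M)) (insert (j, False) (?B \<times> UNIV)) (insert (ix j) E)" using gM 3 by blast
          obtain \<beta> g where g: "\<beta> \<notin> {0, 1, -1}"
            "\<forall>i\<in>T. row M i (j, True) + \<beta> * row M i (j, False) = (\<Sum>z\<in>?B \<times> UNIV. g z * row M i z)"
            using gM 3 by blast
          obtain \<beta>' g' where g':
            "\<forall>i\<in>T. row M' i (j, True) + \<beta>' * row M' i (j, False) = (\<Sum>z\<in>?B \<times> UNIV. g' z * row M' i z)"
            using gM' 3 by blast
          have agD: "M c = M' c" if "c \<in> Dg j" for c using ag 3 that unfolding agree_def by blast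
          show ?thesis
          proof (rule generic_determined[OF indj _ _ _ g(2) g' g(1)])
            show "(j, False) \<notin> ?B \<times> UNIV" using 3 dist by auto
            show "insert (ix j) E \<subseteq> T" using ixT[OF 3] E(1) by blast
            show "row M i z = row M' i z" if "i \<in> T" "z \<in> ?B \<times> UNIV" for i z
              using rB[OF that(1), of "fst z" "snd z"] that(2) by (simp add: mem_Times_iff)
            show "row M i (j, b) = row M' i (j, b)" if "i \<in> insert (ix j) E" for i b
            proof -
              have "cell i (j, b) \<in> Dg j" unfolding Dg_def by (rule image_eqI[of _ _ "(i, b)"]) (use that in simp_all)
              then show ?thesis using agD unfolding row_def by blast
            qed
            show "row M i (j, b) \<in> {-1, 1} \<and> row M' i (j, b) \<in> {-1, 1}" if "i \<in> T" for i b
            proof -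
              have c: "cell i (j, b) \<in> V \<times> V" using that j TV by (intro cell_in) auto
              have q: "M \<in> QN V N" "M' \<in> QN V N" using MM MQ by (meson subsetD)+
              from QN_sign[OF q(1) c] QN_sign[OF q(2) c] show ?thesis unfolding row_def by (rule conjI)
            qed
            show "i \<in> T" by fact
          qed simp
        qed
      qed
      show "agree ?C0 M M'"
        unfolding agree_def
      proof
        fix c assume c: "c \<in> ?C0"
        obtain i j where e: "c = (i, j)" by (cases c)
        show "M c = M' c"
        proof (cases "i \<in> T \<and> j \<in> U")
          case True then show ?thesis using rU[of i j True] e by (simp add: row_def)
        next
          case False
          then have "i \<in> U" "j \<in> T" using c e by auto
          then show ?thesis using rU[of j i False] e by (simp add: row_def)
        qed
      qed
    qed
  qed
  also have "\<dots> \<le> 2 ^ (2 * ((s + r) * b)) * 2 ^ ?m" by (rule mult_right_mono[OF 1]) simp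
  also have "\<dots> = 2 ^ bits_tu Sp" by (simp add: bits_tu_def power_add)
  finally show ?thesis .
qed

text \<open>The cells between \<open>T\<close> and \<open>U\<close> come first, since they make the
  block on \<open>T\<close> quasi-normal with a fixed right-hand side and hence countable by
  \<open>F\<close>; the rest is the diagonal and \<open>stage_U\<close>.\<close>

lemma count_f:
  assumes gf: "\<And>M. M \<in> \<M> \<Longrightarrow> goodf Il Rl Al Bl Sp d E ix M"
    and F: "\<And>N. real (card (QN T N)) \<le> F"
  shows "real (card \<M>) \<le> 2 ^ (bits_tu Sp + n + (\<Sum>i<a + b. a - 1 - i)) * F"
proof -
  let ?C0 = "T \<times> U \<union> U \<times> T"
  have TV: "T \<subseteq> V" using setV by auto
  have VT: "V - T = U" using setV dist by auto
  have F0: "0 \<le> F" using F[of undefined] of_nat_0_le_iff order_trans by blast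
  have "real (cnt (?C0 \<union> T \<times> T) \<M>) \<le> real (cnt ?C0 \<M>) * F"
  proof (rule cnt_step[OF finM])
    show "real (cnt (?C0 \<union> T \<times> T) {M \<in> \<M>. agree ?C0 M M0}) \<le> F" if "M0 \<in> \<M>" for M0
      by (rule cnt_block[OF V TV MQ that _ F]) (simp add: VT)
  qed simp
  also have "\<dots> \<le> 2 ^ bits_tu Sp * F"
    by (rule mult_right_mono[OF count_TU F0]) (rule gf)
  finally have 1: "real (cnt (?C0 \<union> T \<times> T) \<M>) \<le> 2 ^ bits_tu Sp * F" .
  have "real (cnt (known V T) \<M>) \<le> real (cnt (?C0 \<union> T \<times> T) \<M>) * 2 ^ n"
  proof (rule cnt_step[OF finM])
    show "?C0 \<union> T \<times> T \<subseteq> known V T" using setV by (auto simp: known_def)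
    fix M0 assume M0: "M0 \<in> \<M>"
    let ?F = "{M \<in> \<M>. agree (?C0 \<union> T \<times> T) M M0}"
    show "real (cnt (known V T) ?F) \<le> 2 ^ n"
    proof (rule cnt_le_determined[of "(\<lambda>i. (i, i)) ` V"])
      show "card ((\<lambda>i. (i, i)) ` V) \<le> n" using V by (rule card_image_le)
      show "M c \<in> {-1, 1}" if "M \<in> ?F" "c \<in> (\<lambda>i. (i, i)) ` V" for M c
        using that MQ by (intro QN_sign[of M V N]) auto
      fix M M' assume M: "M \<in> ?F" and M': "M' \<in> ?F" and ag: "agree ((\<lambda>i. (i, i)) ` V) M M'"
      have ag2: "agree (?C0 \<union> T \<times> T) M M'" using M M' by (auto simp: agree_def)
      have "known V T \<subseteq> (?C0 \<union> T \<times> T) \<union> (\<lambda>i. (i, i)) ` V"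
        using VT by (auto simp: known_def)
      then show "agree (known V T) M M'" using ag ag2 unfolding agree_def by blast
    qed (use V in simp)
  qed
  also have "\<dots> \<le> 2 ^ bits_tu Sp * F * 2 ^ n" by (rule mult_right_mono[OF 1]) simp
  finally have 2: "real (cnt (known V T) \<M>) \<le> 2 ^ bits_tu Sp * F * 2 ^ n" .
  have "real (card \<M>) \<le> 2 ^ bits_tu Sp * F * 2 ^ n * (\<Prod>i<a + b. 2 ^ (a - 1 - i))"
    by (rule order_trans[OF stage_U mult_right_mono[OF 2]]) (simp add: prod_nonneg)
  also have "\<dots> = 2 ^ (bits_tu Sp + n + (\<Sum>i<a + b. a - 1 - i)) * F"
    by (simp add: power_add power_sum mult_ac)
  finally show ?thesis .
qed

end

section \<open>Matrices whose first rows lose their rank\<close>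

text \<open>Failure of \<open>rankcond\<close>: the rows and columns of \<open>P\<close> are then described by so few bits that the
  bound for the block on \<open>V - P\<close> suffices.\<close>

definition cheap :: "'v set \<Rightarrow> 'v set \<Rightarrow> 'v set \<Rightarrow> 'v set \<Rightarrow> ('v \<times> 'v \<Rightarrow> real) \<Rightarrow> bool" where
  "cheap V P J K M \<longleftrightarrow> P \<subseteq> V \<and> J \<subseteq> V - P \<and> K \<subseteq> P \<and> indep (row M) K ((V - P - J) \<times> UNIV) \<and>
     (\<forall>k\<in>P - K. \<exists>l. \<forall>z\<in>(V - P - J) \<times> UNIV. row M k z = (\<Sum>i\<in>K. l i * row M i z))"

text \<open>After the cells in \<open>P\<close>, towards \<open>J\<close>, and in rows and columns
  of \<open>K\<close> are known, each further row-column pair of \<open>P\<close> is a combination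
  of known ones and costs at most card K bits.\<close>

lemma count_cheap:
  assumes V: "finite V" and MQ: "\<M> \<subseteq> QN V N" and ch: "\<And>M. M \<in> \<M> \<Longrightarrow> cheap V P J K M"
    and sub: "P \<subseteq> V" "J \<subseteq> V - P" "K \<subseteq> P"
    and F: "\<And>N. real (card (QN (V - P) N)) \<le> F"
  shows "real (card \<M>) \<le> 2 ^ (card P * card P + 2 * (card P * card J) + 2 * (card K * card V)
            + card P * card K) * F"
proof -
  have finM: "finite \<M>" using MQ finite_QN[OF V] finite_subset by blast
  have fin: "finite P" "finite J" "finite K" using sub V by (auto intro: finite_subset)
  have F0: "0 \<le> F" using F[of undefined] of_nat_0_le_iff order_trans by blast
  let ?C1 = "P \<times> P \<union> (P \<times> J \<union> J \<times> P) \<union> (K \<times> (V - P) \<union> (V - P) \<times> K)"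
  let ?C2 = "P \<times> V \<union> V \<times> P"
  let ?Z = "(V - P - J) \<times> (UNIV :: bool set)"
  have 1: "real (cnt ?C1 \<M>) \<le> 2 ^ (card P * card P + 2 * (card P * card J) + 2 * (card K * card V))"
  proof (rule cnt_le_cells[OF MQ])
    have "card ?C1 \<le> card (P \<times> P) + card (P \<times> J \<union> J \<times> P) + card (K \<times> (V - P) \<union> (V - P) \<times> K)"
      using card_Un_le[of "P \<times> P \<union> (P \<times> J \<union> J \<times> P)" "K \<times> (V - P) \<union> (V - P) \<times> K"]
        card_Un_le[of "P \<times> P" "P \<times> J \<union> J \<times> P"] by linarith
    also have "\<dots> \<le> card P * card P + 2 * (card P * card J) + 2 * (card K * card (V - P))"
      using fin V by (intro add_mono cells_le_times) (auto simp: card_cartesian_product)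
    also have "card (V - P) \<le> card V" using V by (intro card_mono) auto
    finally show "card ?C1 \<le> card P * card P + 2 * (card P * card J) + 2 * (card K * card V)" by simp
    show "finite ?C1" using fin V by simp
    show "?C1 \<subseteq> V \<times> V" using sub by blast
  qed
  have "real (cnt ?C2 \<M>) \<le> real (cnt ?C1 \<M>) * 2 ^ (card P * card K)"
  proof (rule cnt_step[OF finM])
    show "?C1 \<subseteq> ?C2" using sub by blast
    fix M0 assume M0: "M0 \<in> \<M>"
    let ?F = "{M \<in> \<M>. agree ?C1 M M0}"
    have "indep (row M0) K ?Z" using ch[OF M0] by (simp add: cheap_def)
    then obtain Q where Q: "Q \<subseteq> ?Z" "card Q = card K" "indep (row M0) K Q"
      by (rule ex_square_subset) (use fin V in auto)
    have fQ: "finite Q" using Q(1) V by (rule_tac finite_subset) auto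
    let ?D = "\<Union>k\<in>P - K. cell k ` Q"
    show "real (cnt ?C2 ?F) \<le> 2 ^ (card P * card K)"
    proof (rule cnt_le_determined[of ?D])
      show "finite ?D" using fin fQ by simp
      have "card ?D \<le> (\<Sum>k\<in>P - K. card (cell k ` Q))" using fin by (intro card_UN_le) simp
      also have "\<dots> \<le> (\<Sum>k\<in>P - K. card K)"
      proof (intro sum_mono)
        show "card (cell k ` Q) \<le> card K" for k using card_image_le[OF fQ, of "cell k"] Q(2) by simp
      qed
      also have "\<dots> \<le> card P * card K" using fin by (simp add: card_mono)
      finally show "card ?D \<le> card P * card K" .
      show "M c \<in> {-1, 1}" if M: "M \<in> ?F" and c: "c \<in> ?D" for M c
      proof -
        have "c \<in> V \<times> V" using c Q(1) sub by (auto intro!: cell_in)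
        then show ?thesis using M MQ QN_sign by blast
      qed
      fix M M' assume M: "M \<in> ?F" and M': "M' \<in> ?F" and ag: "agree ?D M M'"
      have eq: "row M k z = row M' k z" if k: "k \<in> P - K" and z: "z \<in> ?Z" for k z
      proof -
        obtain l where l: "\<forall>z\<in>?Z. row M k z = (\<Sum>i\<in>K. l i * row M i z)"
          using ch[of M] M k unfolding cheap_def by blast
        obtain l' where l': "\<forall>z\<in>?Z. row M' k z = (\<Sum>i\<in>K. l' i * row M' i z)"
          using ch[of M'] M' k unfolding cheap_def by blast
        have kn: "cell i z \<in> ?C1" if "i \<in> K" "z \<in> ?Z" for i z
          using that by (auto simp: cell_def)
        show ?thesis
        proof (rule span_determined[OF Q(3,1) _ _ l l' _ z])
          show "row M i z = row M0 i z" "row M' i z = row M0 i z" if "i \<in> K" "z \<in> ?Z" for i z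
            using kn[OF that] M M' by (auto simp: agree_def row_def simp del: Un_iff)
          show "row M k z = row M' k z" if "z \<in> Q" for z
          proof -
            have "cell k z \<in> ?D" using k that by blast
            then show ?thesis using ag unfolding agree_def row_def by blast
          qed
        qed
      qed
      show "agree ?C2 M M'"
        unfolding agree_def
      proof
        fix c assume c: "c \<in> ?C2"
        obtain i j where e: "c = (i, j)" by (cases c)
        show "M c = M' c"
        proof (cases "c \<in> ?C1")
          case True
          then have "M c = M0 c" "M' c = M0 c" using M M' unfolding agree_def by blast+
          then show ?thesis by simp
        next
          case False
          then have "i \<in> P - K \<and> j \<in> V - P - J \<or> j \<in> P - K \<and> i \<in> V - P - J" using c e by auto
          then show ?thesis using eq[of i "(j, True)"] eq[of j "(i, False)"] e by (auto simp: row_def)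
        qed
      qed
    qed
  qed
  also have "\<dots> \<le> 2 ^ (card P * card P + 2 * (card P * card J) + 2 * (card K * card V)) * 2 ^ (card P * card K)"
    by (rule mult_right_mono[OF 1]) simp
  also have "\<dots> = 2 ^ (card P * card P + 2 * (card P * card J) + 2 * (card K * card V) + card P * card K)"
    by (simp only: power_add)
  finally have 2: "real (cnt ?C2 \<M>) \<le> 2 ^ (card P * card P + 2 * (card P * card J) + 2 * (card K * card V) + card P * card K)" .
  have "real (cnt (?C2 \<union> (V - P) \<times> (V - P)) \<M>) \<le> real (cnt ?C2 \<M>) * F"
  proof (rule cnt_step[OF finM])
    show "real (cnt (?C2 \<union> (V - P) \<times> (V - P)) {M \<in> \<M>. agree ?C2 M M0}) \<le> F" if "M0 \<in> \<M>" for M0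
      by (rule cnt_block[OF V _ MQ that _ F]) auto
  qed simp
  also have "\<dots> \<le> 2 ^ (card P * card P + 2 * (card P * card J) + 2 * (card K * card V) + card P * card K) * F"
    by (rule mult_right_mono[OF 2 F0])
  also have "?C2 \<union> (V - P) \<times> (V - P) = V \<times> V" using sub by blast
  also have "cnt (V \<times> V) \<M> = card \<M>" using MQ by (intro cnt_full) (auto simp: QN_def)
  finally show ?thesis .
qed

text \<open>\<open>K\<close> is a maximal independent set among the first rows once the exceptional
  columns are gone; the failing condition bounds its size. The index \<open>Il ! x\<close> joins
  \<open>J\<close>, hence the + 1.\<close>

lemma ex_cheap:
  assumes V: "finite V" and Il: "distinct Il" "set Il \<subseteq> V" and nr: "\<not> rankcond V Il x0 m M"
  shows "\<exists>P J K. cheap V P J K M \<and> x0 \<le> card P \<and> card P < 2 * x0 \<and> card J \<le> 2 * card P + 1 \<and> card K < m"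
proof -
  obtain x J where x: "x0 \<le> x" "x < 2 * x0" "x < length Il"
    and J: "J \<subseteq> V - set (take x Il) - {Il ! x}" "card J \<le> 2 * x"
    and no: "\<And>S. S \<subseteq> set (take x Il) \<Longrightarrow> card S = m \<Longrightarrow>
       \<not> indep (row M) S ((V - set (take x Il) - {Il ! x} - J) \<times> UNIV)"
    using nr unfolding rankcond_def by blast
  let ?P = "set (take x Il)" and ?J = "insert (Il ! x) J"
  have P: "?P \<subseteq> V" using Il(2) set_take_subset[of x Il] by blast
  have cP: "card ?P = x" using Il x by (simp add: distinct_card)
  have kP: "Il ! x \<in> V - ?P"
  proof -
    have "Il ! x \<in> set (drop x Il)" using x by (metis Cons_nth_drop_Suc list.set_intros(1))
    moreover have "?P \<inter> set (drop x Il) = {}" using Il(1) by (metis append_take_drop_id distinct_append)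
    ultimately show ?thesis using Il(2) x by auto
  qed
  have VJ: "V - ?P - ?J = V - ?P - {Il ! x} - J" by auto
  let ?ind = "\<lambda>K. indep (row M) K ((V - ?P - ?J) \<times> UNIV)"
  obtain K where K: "K \<subseteq> ?P" "?ind K" "\<And>k. k \<in> ?P - K \<Longrightarrow> \<not> ?ind (insert k K)"
    using ex_maximal_subset[of ?P "{}" ?ind] by auto
  have fK: "finite K" using K(1) by (rule finite_subset) simp
  have "card K < m"
  proof (rule ccontr)
    assume "\<not> card K < m"
    then obtain S where S: "S \<subseteq> K" "card S = m" by (meson not_le obtain_subset_with_card_n)
    then have "?ind S" using indep_subset_rows[OF K(2) _ fK] by blast
    then show False using no[of S] S K(1) unfolding VJ by auto
  qed
  moreover have "cheap V ?P ?J K M"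
    unfolding cheap_def
  proof (intro conjI ballI)
    show "\<exists>l. \<forall>z\<in>(V - ?P - ?J) \<times> UNIV. row M k z = (\<Sum>i\<in>K. l i * row M i z)" if "k \<in> ?P - K" for k
      by (rule indep_insert_comb[OF K(2) K(3)[OF that] fK])
  qed (use P J kP K in auto)
  moreover have "card ?J \<le> 2 * card ?P + 1" using card_insert_le_m1[of "2 * x + 1" J "Il ! x"] J(2) cP by simp
  ultimately show ?thesis
    by (intro exI[of _ ?P] exI[of _ ?J] exI[of _ K]) (use x cP in simp)
qed

lemma ex_good:
  assumes V: "finite V"
  shows "\<exists>Il Rl Al Bl Sp d E ix. good V Il Rl Al Bl M \<and> goodf Il Rl Al Bl Sp d E ix M \<and>
     Sp \<subseteq> V \<and> d \<in> PiE V (\<lambda>_. dirs) \<and> E \<subseteq> V \<and> ix \<in> PiE V (\<lambda>_. V)"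
proof -
  from ex_frame[OF V, of M] obtain I U p q where fr: "frame V M I U p q" by (elim exE)
  obtain B where B: "B \<subseteq> U" "indep (tr (row M)) (B \<times> UNIV) I"
    "\<And>j. j \<in> U - B \<Longrightarrow> \<not> indep (tr (row M)) (insert j B \<times> UNIV) I"
    "\<And>j. j \<in> U - B \<Longrightarrow> special (p j) (q j) \<Longrightarrow>
       \<not> indep (tr (row M)) (insert j (B \<inter> {l. special (p l) (q l)}) \<times> UNIV) I"
    "indep (tr (row M)) (B \<times> UNIV \<union> (\<lambda>j. (j, p j \<noteq> 0)) ` (U - B)) I"
    "card I = card (U - B) + 2 * card B"
    by (rule ex_frame_basis[OF fr V], rule that) blast+
  have sub: "I \<subseteq> V" "U \<subseteq> V - I" and indI: "indep (row M) I (U \<times> UNIV)" using fr by (simp_all add: frame_def)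
  have fin: "finite I" "finite U" "finite B" using frame_finite[OF fr V] B(1) finite_subset by auto
  let ?R = "V - I - U"
  obtain Il where Il: "set Il = I" "distinct Il" using finite_distinct_list[OF fin(1)] by blast
  obtain Rl where Rl: "set Rl = ?R" "distinct Rl" using finite_distinct_list[of ?R] V by blast
  obtain Al where Al: "set Al = U - B" "distinct Al" using finite_distinct_list[of "U - B"] fin by blast
  obtain Bl where Bl: "set Bl = B" "distinct Bl" using finite_distinct_list[OF fin(3)] by blast
  have good: "good V Il Rl Al Bl M"
    unfolding good_def
  proof (intro conjI)
    show "distinct (Il @ Rl @ Al @ Bl)" using Il Rl Al Bl sub B(1) by auto
    show "set (Il @ Rl @ Al @ Bl) = V" using Il Rl Al Bl sub B(1) by auto
    show "length Il = length Al + 2 * length Bl" using B(6) Il Al Bl by (metis distinct_card)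
    show "\<forall>j\<in>set Rl. \<exists>l. \<forall>z\<in>(V - set Il - {j}) \<times> UNIV. row M j z = (\<Sum>i\<in>set Il. l i * row M i z)"
      using fr unfolding frame_def Il Rl by blast
    show "\<exists>pk. indep (tr (row M)) (set Bl \<times> UNIV \<union> (\<lambda>j. (j, pk j)) ` set Al) (set Il)"
      unfolding Il Al Bl by (rule exI[of _ "\<lambda>j. p j \<noteq> 0"]) (rule B(5))
  qed
  define Sp where "Sp = {l \<in> V. special (p l) (q l)}"
  define d where "d = restrict (\<lambda>l. dir (p l) (q l)) V"
  have TI: "set Il \<union> set Rl = I \<union> ?R" using Il Rl by simp
  \<comment> \<open>Frame relations hold on the rows \<open>I\<close> only. On the columns of
    \<open>U\<close> the remaining rows are combinations of these, which carries the relations over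
    to all rows of \<open>I \<union> ?R\<close>.\<close>
  have ext: "\<exists>l. \<forall>z\<in>U \<times> UNIV. row M i z = (\<Sum>k\<in>I. l k * row M k z)" if i: "i \<in> I \<union> ?R" for i
  proof (cases "i \<in> I")
    case True
    have "\<exists>l. \<forall>z\<in>U \<times> UNIV. tr (row M) z i = (\<Sum>k\<in>I. l k * tr (row M) z k)"
      by (rule indep_self_span[OF fin(1) True])
    then show ?thesis by (simp add: tr_def)
  next
    case False
    then have iR: "i \<in> ?R" using i by blast
    then obtain l where "\<forall>z\<in>(V - I - {i}) \<times> UNIV. row M i z = (\<Sum>k\<in>I. l k * row M k z)"
      using fr unfolding frame_def by blast
    then show ?thesis using iR sub by (intro exI[of _ l]) auto
  qed
  have zd: "zrow M d l i = zrow M (\<lambda>l. dir (p l) (q l)) l i" if "l \<in> V" for l i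
    using that by (simp add: zrow_def d_def)
  have BSp: "B \<inter> Sp = B \<inter> {l. special (p l) (q l)}" using B(1) sub by (auto simp: Sp_def)
  have indBs: "indep (tr (row M)) ((B \<inter> Sp) \<times> UNIV) I"
    by (rule indep_subset_rows[OF B(2)]) (use fin in auto)
  have indT: "indep (tr (row M)) (B \<times> UNIV) (I \<union> ?R)"
    by (rule indep_mono_cols[OF B(2)]) simp
  have fT: "finite (I \<union> ?R)" using fin V by simp
  have fBU: "finite (B \<times> (UNIV :: bool set))" using fin by simp
  obtain E where E: "E \<subseteq> I \<union> ?R" "card E = card (B \<times> (UNIV :: bool set))" "indep (tr (row M)) (B \<times> UNIV) E"
    using ex_square_subset[OF indT fBU fT] by metis
  have fE: "finite E" using E(1) fT finite_subset by blast
  have wit: "\<exists>i\<in>I \<union> ?R. indep (tr (row M)) (insert (j, False) (B \<times> UNIV)) (insert i E)" if j: "j \<in> U - B - Sp" for j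
  proof (rule ex_witness_row[OF fBU fE E(3,2)])
    have "j \<in> U - B" "\<not> special (p j) (q j)" using j sub by (auto simp: Sp_def)
    then have "indep (tr (row M)) (insert (j, False) (B \<times> UNIV)) I"
      using frame_generic(2)[OF fr V B(1,2)] B(3) by blast
    then show "indep (tr (row M)) (insert (j, False) (B \<times> UNIV)) (I \<union> ?R)" by (rule indep_mono_cols) simp
    show "(j, False) \<notin> B \<times> UNIV" using j by simp
  qed
  then have "\<forall>j\<in>U - B - Sp. \<exists>i. i \<in> I \<union> ?R \<and> indep (tr (row M)) (insert (j, False) (B \<times> UNIV)) (insert i E)" by blast
  from bchoice[OF this] obtain ix0 where ix0: "\<And>j. j \<in> U - B - Sp \<Longrightarrow>
      ix0 j \<in> I \<union> ?R \<and> indep (tr (row M)) (insert (j, False) (B \<times> UNIV)) (insert (ix0 j) E)" by blast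
  \<comment> \<open>The default value \<open>j\<close> and the restriction put \<open>ix\<close>
    into the finite set of maps from \<open>V\<close> to \<open>V\<close>, over which the union
    bound runs.\<close>
  define ix where "ix = restrict (\<lambda>j. if j \<in> U - B - Sp then ix0 j else j) V"
  have ixe: "ix j = ix0 j" if "j \<in> U - B - Sp" for j using that sub by (auto simp: ix_def)
  have goodf: "goodf Il Rl Al Bl Sp d E ix M"
    unfolding goodf_def TI unfolding Il Al Bl
  proof (intro conjI ballI)
    show "d l \<in> dirs" if "l \<in> U - B \<union> B" for l using that sub B(1) by (auto simp: d_def dir_dirs)
    show "indep (zrow M d) (B \<inter> Sp) (I \<union> ?R)"
    proof (rule indep_mono_cols[OF zrow_indep[OF indBs]])
      show "d l \<in> dirs" if "l \<in> B \<inter> Sp" for l using that sub B(1) by (auto simp: d_def dir_dirs)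
    qed simp
    show "E \<subseteq> I \<union> ?R" by (rule E(1))
    show "card E = 2 * length Bl" using E(2) Bl by (simp add: card_cartesian_product distinct_card[symmetric])
    fix j
    { assume j: "j \<in> (U - B) \<inter> Sp"
      have jU: "j \<in> U - (B \<inter> Sp)" "special (p j) (q j)" "j \<in> U - B" using j by (auto simp: Sp_def)
      have "\<exists>\<mu>. \<forall>i\<in>I. zrow M (\<lambda>l. dir (p l) (q l)) j i = (\<Sum>l\<in>B \<inter> Sp. \<mu> l * zrow M (\<lambda>l. dir (p l) (q l)) l i)"
      proof (rule frame_special[OF fr V _ indBs _ jU(1,2)])
        show "B \<inter> Sp \<subseteq> U" using B(1) by blast
        show "special (p l) (q l)" if "l \<in> B \<inter> Sp" for l using that by (simp add: Sp_def)
        show "\<not> indep (tr (row M)) (insert j (B \<inter> Sp) \<times> UNIV) I" unfolding BSp by (rule B(4)[OF jU(3,2)])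
      qed
      then obtain \<mu> where "\<forall>i\<in>I. zrow M (\<lambda>l. dir (p l) (q l)) j i = (\<Sum>l\<in>B \<inter> Sp. \<mu> l * zrow M (\<lambda>l. dir (p l) (q l)) l i)"
        by blast
      moreover have "j \<in> V" "B \<inter> Sp \<subseteq> V" using j sub B(1) by auto
      ultimately have \<mu>: "zrow M d j i = (\<Sum>l\<in>B \<inter> Sp. \<mu> l * zrow M d l i)" if "i \<in> I" for i
        using that by (auto simp: zd subset_iff intro!: sum.cong)
      have "zrow M d j i = (\<Sum>l\<in>B \<inter> Sp. \<mu> l * zrow M d l i)" if i: "i \<in> I \<union> ?R" for i
      proof -
        obtain l where l: "\<forall>z\<in>U \<times> UNIV. row M i z = (\<Sum>k\<in>I. l k * row M k z)" using ext[OF i] by blast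
        have zl: "zrow M d v i = (\<Sum>k\<in>I. l k * zrow M d v k)" if "v \<in> U" for v
          using l that by (simp add: zrow_def sum_distrib_left sum.distrib[symmetric] algebra_simps)
        have "zrow M d j i = (\<Sum>k\<in>I. l k * (\<Sum>v\<in>B \<inter> Sp. \<mu> v * zrow M d v k))"
          using zl[of j] \<mu> j by simp
        also have "\<dots> = (\<Sum>k\<in>I. \<Sum>v\<in>B \<inter> Sp. \<mu> v * (l k * zrow M d v k))"
          by (simp add: sum_distrib_left mult.left_commute)
        also have "\<dots> = (\<Sum>v\<in>B \<inter> Sp. \<Sum>k\<in>I. \<mu> v * (l k * zrow M d v k))" by (rule sum.swap)
        also have "\<dots> = (\<Sum>v\<in>B \<inter> Sp. \<mu> v * zrow M d v i)"
          using zl B(1) by (intro sum.cong) (auto simp: sum_distrib_left)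
        finally show ?thesis .
      qed
      then show "\<exists>\<mu>. \<forall>i\<in>I \<union> ?R. zrow M d j i = (\<Sum>l\<in>B \<inter> Sp. \<mu> l * zrow M d l i)" by blast
    }
    { assume j: "j \<in> U - B - Sp"
      show "ix j \<in> I \<union> ?R" using ix0[OF j] ixe[OF j] by simp
      show "indep (tr (row M)) (insert (j, False) (B \<times> UNIV)) (insert (ix j) E)" using ix0[OF j] ixe[OF j] by simp
      have jU: "j \<in> U - B" "\<not> special (p j) (q j)" using j sub by (auto simp: Sp_def)
      obtain \<beta> g where g: "\<beta> \<notin> {0, 1, -1}"
        "\<forall>i\<in>I. row M i (j, True) + \<beta> * row M i (j, False) = (\<Sum>z\<in>B \<times> UNIV. g z * row M i z)"
        using frame_generic(1)[OF fr V B(1,2) jU B(3)[OF jU(1)]] by blast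
      have "row M i (j, True) + \<beta> * row M i (j, False) = (\<Sum>z\<in>B \<times> UNIV. g z * row M i z)" if i: "i \<in> I \<union> ?R" for i
      proof -
        obtain l where l: "\<forall>z\<in>U \<times> UNIV. row M i z = (\<Sum>k\<in>I. l k * row M k z)" using ext[OF i] by blast
        have "row M i (j, True) + \<beta> * row M i (j, False)
            = (\<Sum>k\<in>I. l k * (row M k (j, True) + \<beta> * row M k (j, False)))"
          using l jU(1) by (simp add: sum_distrib_left sum.distrib[symmetric] algebra_simps)
        also have "\<dots> = (\<Sum>k\<in>I. \<Sum>z\<in>B \<times> UNIV. g z * (l k * row M k z))"
          using g(2) by (simp add: sum_distrib_left mult.left_commute)
        also have "\<dots> = (\<Sum>z\<in>B \<times> UNIV. \<Sum>k\<in>I. g z * (l k * row M k z))" by (rule sum.swap)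
        also have "\<dots> = (\<Sum>z\<in>B \<times> UNIV. g z * row M i z)"
          using l B(1) by (intro sum.cong) (auto simp: sum_distrib_left)
        finally show ?thesis .
      qed
      then show "\<exists>\<beta> g. \<beta> \<notin> {0, 1, -1} \<and> (\<forall>i\<in>I \<union> ?R.
           row M i (j, True) + \<beta> * row M i (j, False) = (\<Sum>z\<in>B \<times> UNIV. g z * row M i z))"
        using g(1) by blast
    }
  qed
  have "Sp \<subseteq> V" "E \<subseteq> V" using E(1) sub by (auto simp: Sp_def)
  moreover have "d \<in> PiE V (\<lambda>_. dirs)" by (simp add: d_def dir_dirs)
  moreover have "ix \<in> PiE V (\<lambda>_. V)"
  proof (rule PiE_I)
    show "ix j \<in> V" if "j \<in> V" for j
      using that ix0[of j] sub unfolding ix_def by auto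
  qed (simp add: ix_def)
  ultimately show ?thesis using good goodf by blast
qed

section \<open>The optimization problem\<close>

definition dv_region :: "real \<Rightarrow> real \<Rightarrow> bool" where
  "dv_region s t \<longleftrightarrow> 0 \<le> s \<and> s \<le> 2/3 \<and> s \<le> t \<and> s/2 \<le> 1 - t \<and> 1 - t \<le> s"

definition dv_adm :: "real set" where
  "dv_adm = {\<alpha>. \<alpha> > 0 \<and> (\<forall>s t. dv_region s t \<longrightarrow> min (dv_f \<alpha> s t) (dv_g s t) \<le> - \<alpha>)}"

lemma dv_alpha_eq: "dv_alpha = Sup dv_adm"
  unfolding dv_alpha_def dv_adm_def dv_region_def by (intro arg_cong[of _ _ Sup] Collect_cong) blast

text \<open>In both branches the dependence on \<open>t\<close> is t^2 + s t - 2 t, which decreases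
  up to t = 1 - s/2.\<close>

lemma dv_g_antimono:
  assumes "l \<le> t" "t \<le> 1 - s/2"
  shows "dv_g s t \<le> dv_g s l"
proof -
  have "dv_g s t - dv_g s l = (t - l) * (t + l + s - 2)"
    by (simp add: dv_g_def power2_eq_square algebra_simps)
  moreover have "(t - l) * (t + l + s - 2) \<le> 0"
    using assms by (intro mult_nonneg_nonpos) auto
  ultimately show ?thesis by simp
qed

text \<open>The line \<open>t = 0.7015 - 0.552 (s - 0.46)\<close> is just below the tangent, at \<open>s = 0.46\<close>, of the
  curve \<open>dv_f \<alpha> s t = - \<alpha>\<close> for \<open>\<alpha> = 0.3025\<close>.\<close>

lemma dv_adm_lower: "(3025/10000) \<in> dv_adm"
proof -
  have "min (dv_f (3025/10000) s t) (dv_g s t) \<le> - (3025/10000)" if reg: "dv_region s t" for s t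
  proof (rule ccontr)
    assume "\<not> ?thesis"
    then have f: "dv_f (3025/10000) s t > - (3025/10000)" and g: "dv_g s t > - (3025/10000)" by (auto simp: min_le_iff_disj)
    have r: "0 \<le> s" "s \<le> 2/3" "s \<le> t" "t \<le> 1 - s/2" "1 - s \<le> t" using reg by (auto simp: dv_region_def)
    define l where "l = (95542/100000) - (552/1000) * s"
    have l0: "0 \<le> l" using r by (simp add: l_def)
    \<comment> \<open>The difference of the two sides is a convex quadratic in \<open>s\<close> with
      its minimum near 0.4597; completing the square there shows that it is not negative.\<close>
    have "(6975/10000) * l\<^sup>2 \<le> (6975/10000) - s + s\<^sup>2 / 2"
    proof -
      have "l\<^sup>2 = (304704/1000000) * s\<^sup>2 - (105478368/100000000) * s + (9128273764/10000000000)"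
        by (simp add: l_def power2_eq_square algebra_simps)
      moreover have "(s - (4597/10000))\<^sup>2 = s\<^sup>2 - (9194/10000) * s + (21132409/100000000)"
        by (simp add: power2_eq_square algebra_simps)
      moreover have "0 \<le> (s - (4597/10000))\<^sup>2" by simp
      ultimately show ?thesis using r(1) by linarith
    qed
    moreover have "(6975/10000) - s + s\<^sup>2 / 2 < (6975/10000) * t\<^sup>2" using f by (simp add: dv_f_def)
    ultimately have "l\<^sup>2 < t\<^sup>2" by simp
    then have "l \<le> t" using r l0 by (intro less_imp_le power_less_imp_less_base[of l 2 t]) auto
    then have gl: "dv_g s t \<le> dv_g s l" using r by (intro dv_g_antimono)
    show False
    proof (cases "s \<le> 1/2")
      case True
      \<comment> \<open>A concave quadratic with its maximum near 0.4626; the maximal value is below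
        -0.3025 by a small margin.\<close>
      have "dv_g s l = - (3247296/1000000) * s\<^sup>2 + (300463632/100000000) * s - (9980126236/10000000000)"
        using True by (simp add: dv_g_def l_def power2_eq_square algebra_simps)
      moreover have "(s - (4626/10000))\<^sup>2 = s\<^sup>2 - (9252/10000) * s + (21399876/100000000)"
        by (simp add: power2_eq_square algebra_simps)
      moreover have "0 \<le> (s - (4626/10000))\<^sup>2" by simp
      ultimately have "dv_g s l \<le> - (3025/10000)" using True by linarith
      then show False using gl g by simp
    next
      case False
      \<comment> \<open>Here the quadratic is convex, so it is bounded by its chord over the
        interval from 1/2 to 2/3.\<close>
      have "dv_g s l = (752704/1000000) * s\<^sup>2 - (99536368/100000000) * s + (19873764/10000000000)"
        using False by (simp add: dv_g_def l_def power2_eq_square algebra_simps)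
      moreover have "(s - 1/2) * (2/3 - s) = 7/6 * s - s\<^sup>2 - 1/3"
        by (simp add: power2_eq_square field_simps)
      moreover have "0 \<le> (s - 1/2) * (2/3 - s)" using False r by (intro mult_nonneg_nonneg) auto
      ultimately have "dv_g s l \<le> - (3025/10000)" using False r(2) by linarith
      then show False using gl g by simp
    qed
  qed
  then show ?thesis by (simp add: dv_adm_def)
qed

text \<open>The test point (0.46, 0.7) lies near the optimum, and either term of the minimum bounds
  \<alpha> there.\<close>

lemma dv_adm_upper: "\<alpha> \<in> dv_adm \<Longrightarrow> \<alpha> \<le> (306/1000)"
proof -
  assume "\<alpha> \<in> dv_adm"
  moreover have "dv_region (46/100) (7/10)" by (simp add: dv_region_def)
  ultimately have "min (dv_f \<alpha> (46/100) (7/10)) (dv_g (46/100) (7/10)) \<le> - \<alpha>" by (simp add: dv_adm_def)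
  then show ?thesis by (auto simp: dv_f_def dv_g_def power2_eq_square min_le_iff_disj field_simps)
qed

lemma dv_alpha_bounds: "(3025/10000) \<le> dv_alpha" "dv_alpha \<le> (306/1000)"
proof -
  have b: "bdd_above dv_adm" using dv_adm_upper by (rule bdd_aboveI)
  show "(3025/10000) \<le> dv_alpha" unfolding dv_alpha_eq by (rule cSup_upper[OF dv_adm_lower b])
  show "dv_alpha \<le> (306/1000)" unfolding dv_alpha_eq
    by (rule cSup_least) (use dv_adm_lower dv_adm_upper in auto)
qed

text \<open>The supremum is attained: two strict violations would persist at an admissible \<alpha>
  slightly below it, since \<open>dv_f \<alpha> s t + \<alpha>\<close> moves by no more than
  \<alpha> does.\<close>

lemma dv_alpha_admissible:
  assumes reg: "dv_region s t"
  shows "dv_f dv_alpha s t \<le> - dv_alpha \<or> dv_g s t \<le> - dv_alpha"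
proof (rule ccontr)
  assume "\<not> ?thesis"
  then have pos: "dv_f dv_alpha s t + dv_alpha > 0" "dv_g s t + dv_alpha > 0" by auto
  define e where "e = min (dv_f dv_alpha s t + dv_alpha) (dv_g s t + dv_alpha) / 2"
  have e: "0 < e" "e < dv_f dv_alpha s t + dv_alpha" "e < dv_g s t + dv_alpha"
    using pos by (auto simp: e_def min_def)
  have b: "bdd_above dv_adm" using dv_adm_upper by (rule bdd_aboveI)
  have "dv_alpha - e < Sup dv_adm" using e by (simp add: dv_alpha_eq)
  then obtain \<alpha> where a: "\<alpha> \<in> dv_adm" "dv_alpha - e < \<alpha>"
    using less_cSupD[of dv_adm] dv_adm_lower by blast
  have le: "\<alpha> \<le> dv_alpha" unfolding dv_alpha_eq by (rule cSup_upper[OF a(1) b])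
  have t: "0 \<le> t" "t \<le> 1" using reg by (auto simp: dv_region_def)
  have "dv_f \<alpha> s t + \<alpha> = dv_f dv_alpha s t + dv_alpha - (dv_alpha - \<alpha>) * (1 - t\<^sup>2)"
    by (simp add: dv_f_def algebra_simps)
  moreover have "(dv_alpha - \<alpha>) * (1 - t\<^sup>2) \<le> e * 1"
    using a le e t by (intro mult_mono) (auto simp: power_le_one)
  ultimately have "dv_f \<alpha> s t + \<alpha> > 0" using e by simp
  moreover have "dv_g s t + \<alpha> > 0" using a e by simp
  moreover have "min (dv_f \<alpha> s t) (dv_g s t) \<le> - \<alpha>" using a(1) reg by (simp add: dv_adm_def)
  ultimately show False by (auto simp: min_le_iff_disj)
qed

text \<open>At the critical value \<open>dv_alpha\<close> both terms of the minimum are needed, and increasing \<open>t\<close>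
  increases \<open>dv_f\<close> while \<open>dv_g\<close> is Lipschitz; so lowering \<open>dv_g\<close> by a constant lowers the whole
  min-max value.\<close>

lemma dv_gap:
  assumes reg: "dv_region s t" and s: "1/10 \<le> s" and \<kappa>: "0 < \<kappa>" "\<kappa> \<le> 1/1000"
  shows "dv_f dv_alpha s t \<le> - dv_alpha - \<kappa>/10 \<or> dv_g s t \<le> - dv_alpha + \<kappa> - \<kappa>/10"
proof (rule ccontr)
  assume "\<not> ?thesis"
  then have f: "dv_f dv_alpha s t > - dv_alpha - \<kappa>/10" and g: "dv_g s t > - dv_alpha + \<kappa> - \<kappa>/10" by auto
  have r: "0 \<le> s" "s \<le> 2/3" "s \<le> t" "t \<le> 1 - s/2" "1 - s \<le> t" using reg by (auto simp: dv_region_def)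
  define c where "c = 1 - dv_alpha"
  have c: "(694/1000) \<le> c" "c \<le> (6975/10000)" using dv_alpha_bounds by (auto simp: c_def)
  \<comment> \<open>Moving \<open>t\<close> up by \<kappa>/4 raises \<open>dv_f\<close> by at least
    0.694 * (2/3) * \<kappa>/4 > \<kappa>/10, as t is at least 1/3, and lowers \<open>dv_g\<close>
    by at most \<kappa>/2, so both terms would violate admissibility.\<close>
  define e where "e = \<kappa>/4"
  show False
  proof (cases "t + e \<le> 1 - s/2")
    case True
    have "dv_region s (t + e)" using r True \<kappa> by (auto simp: dv_region_def e_def)
    from dv_alpha_admissible[OF this] show False
    proof
      assume a: "dv_f dv_alpha s (t + e) \<le> - dv_alpha"
      have "dv_f dv_alpha s (t + e) - dv_f dv_alpha s t = c * (2 * t * e + e\<^sup>2)"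
        by (simp add: dv_f_def c_def power2_eq_square algebra_simps)
      moreover have "(694/1000) * (2 * (1/3) * e) \<le> c * (2 * t * e + e\<^sup>2)"
      proof (rule mult_mono)
        have "2 * (1/3) * e \<le> 2 * t * e" using r \<kappa> by (intro mult_right_mono) (auto simp: e_def)
        then show "2 * (1/3) * e \<le> 2 * t * e + e\<^sup>2" using zero_le_power2[of e] by linarith
      qed (use c \<kappa> in \<open>auto simp: e_def\<close>)
      ultimately show False using a f \<kappa> by (simp add: e_def)
    next
      assume a: "dv_g s (t + e) \<le> - dv_alpha"
      have "dv_g s (t + e) - dv_g s t = e * (2 * t + e + s - 2)"
        by (simp add: dv_g_def power2_eq_square algebra_simps)
      moreover have "e * (- 2) \<le> e * (2 * t + e + s - 2)"
        using r \<kappa> by (intro mult_left_mono) (auto simp: e_def)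
      ultimately show False using a g \<kappa> by (simp add: e_def)
    qed
  next
    case False
    \<comment> \<open>The shifted point leaves the region, so \<open>t\<close> is within
      \<open>e\<close> of the edge t = 1 - s/2. There \<open>dv_f\<close> exceeds -
      \<open>dv_alpha\<close> by at least 0.08 s, and s \<ge> 1/10 makes this larger than the error
      2 e.\<close>
    have "(1 - s/2 - e)\<^sup>2 \<le> t\<^sup>2" using False r \<kappa> by (intro power_mono) (auto simp: e_def)
    moreover have "(1 - s/2 - e)\<^sup>2 = (1 - s/2)\<^sup>2 - 2 * e * (1 - s/2) + e\<^sup>2"
      by (simp add: power2_eq_square algebra_simps)
    moreover have "2 * e * (1 - s/2) \<le> 2 * e * 1" using r \<kappa> by (intro mult_left_mono) (auto simp: e_def)
    ultimately have t2: "(1 - s/2)\<^sup>2 - 2 * e \<le> t\<^sup>2" using zero_le_power2[of e] by linarith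
    have "c * ((1 - s/2)\<^sup>2 - 2 * e) \<le> c * t\<^sup>2" using t2 c by (intro mult_left_mono) auto
    moreover have "c * (2 * e) \<le> 1 * (2 * e)" using c \<kappa> by (intro mult_right_mono) (auto simp: e_def)
    moreover have "c * ((1 - s/2)\<^sup>2 - 2 * e) = c * (1 - s/2)\<^sup>2 - c * (2 * e)" by (rule right_diff_distrib)
    ultimately have "c * (1 - s/2)\<^sup>2 - 2 * e \<le> c * t\<^sup>2" by linarith
    then have "dv_f dv_alpha s t + dv_alpha \<ge> c * (1 - s/2)\<^sup>2 - 2 * e - s\<^sup>2/2 + s - c"
      by (simp add: dv_f_def c_def)
    also have "c * (1 - s/2)\<^sup>2 - 2 * e - s\<^sup>2/2 + s - c = s * ((1 - c) - s * (1/2 - c/4)) - 2 * e"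
      by (simp add: power2_eq_square algebra_simps)
    finally have ge: "s * ((1 - c) - s * (1/2 - c/4)) - 2 * e \<le> dv_f dv_alpha s t + dv_alpha" .
    have "s * (1/2 - c/4) \<le> 2/3 * (3265/10000)" using r c by (intro mult_mono) auto
    then have "1/10 * (8/100) \<le> s * ((1 - c) - s * (1/2 - c/4))" using s c by (intro mult_mono) auto
    with ge \<kappa> have "dv_f dv_alpha s t > - dv_alpha" by (simp add: e_def)
    with dv_alpha_admissible[OF reg] have "dv_g s t \<le> - dv_alpha" by simp
    with g \<kappa> show False by simp
  qed
qed

text \<open>The alternatives correspond to induction on the block, to the plain count, and to the
  count with gain \<kappa>. The first is stated with \<beta> itself, the exponent of the induction
  hypothesis. Its side condition is needed by \<open>bits_f_bound\<close>, and where it fails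
  \<open>dv_g\<close> is small anyway.\<close>

lemma dv_trichotomy:
  assumes \<kappa>: "0 < \<kappa>" "\<kappa> \<le> 1/1000"
  shows "\<exists>\<beta> \<eta>. 0 < \<eta> \<and> (69/100) \<le> \<beta> \<and> \<beta> < c_DV \<and> (\<forall>s t. dv_region s t \<longrightarrow>
     (1/10 \<le> s \<and> 3 * s + 2 * t \<le> 3 \<and> \<beta> * t\<^sup>2 + s - s\<^sup>2/2 \<le> \<beta> - \<eta>) \<or>
     (s < 1/10 \<and> 1 + dv_g s t \<le> \<beta> - \<eta>) \<or>
     (1/10 \<le> s \<and> 1 + dv_g s t - \<kappa> \<le> \<beta> - \<eta>))"
proof -
  \<comment> \<open>The margin \<kappa>/10 of \<open>dv_gap\<close> covers the drop \<kappa>/40 of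
    the exponent together with the gain \<eta> = \<kappa>/20.\<close>
  define \<beta> where "\<beta> = c_DV - \<kappa>/40"
  define \<eta> where "\<eta> = \<kappa>/20"
  have c: "(694/1000) \<le> c_DV" "c_DV \<le> (6975/10000)" using dv_alpha_bounds by (auto simp: c_DV_def)
  have "(1/10 \<le> s \<and> 3 * s + 2 * t \<le> 3 \<and> \<beta> * t\<^sup>2 + s - s\<^sup>2/2 \<le> \<beta> - \<eta>) \<or>
     (s < 1/10 \<and> 1 + dv_g s t \<le> \<beta> - \<eta>) \<or>
     (1/10 \<le> s \<and> 1 + dv_g s t - \<kappa> \<le> \<beta> - \<eta>)" if reg: "dv_region s t" for s t
  proof -
    have r: "0 \<le> s" "s \<le> 2/3" "s \<le> t" "t \<le> 1 - s/2" "1 - s \<le> t" "t \<le> 1" using reg by (auto simp: dv_region_def)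
    consider "s < 1/10" | "1/10 \<le> s" "3 < 3 * s + 2 * t" | "1/10 \<le> s" "3 * s + 2 * t \<le> 3" by linarith
    then show ?thesis
    proof cases
      case 1
      have "1 + dv_g s t = (1 - t)\<^sup>2 + 2 * s - 3 * s\<^sup>2 + s * t"
        using 1 by (simp add: dv_g_def power2_eq_square algebra_simps)
      moreover have "(1 - t)\<^sup>2 \<le> (1/10)\<^sup>2" using r 1 by (intro power_mono) auto
      moreover have "s * t \<le> 1/10 * 1" using r 1 by (intro mult_mono) auto
      moreover have "0 \<le> s\<^sup>2" "(1/10 :: real)\<^sup>2 = 1/100" by (simp_all add: power2_eq_square)
      ultimately have "1 + dv_g s t \<le> (31/100)" using 1 by linarith
      then show ?thesis using 1 c \<kappa> by (simp add: \<beta>_def \<eta>_def)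
    next
      case 2
      \<comment> \<open>\<open>dv_g\<close> decreases in \<open>t\<close>, so a lower bound for
        \<open>t\<close> is inserted: 3/2 - 3/2 s or s, which coincide at s = 3/5. The resulting
        convex quadratics are bounded by chords.\<close>
      have "1 + dv_g s t \<le> (6875/10000)"
      proof (cases "s \<le> 3/5")
        case True
        have s2: "1/2 < s" using 2 r by linarith
        have "dv_g s t \<le> dv_g s (3/2 - 3/2 * s)" using 2 r by (intro dv_g_antimono) auto
        moreover have "1 + dv_g s (3/2 - 3/2 * s) = 7/4 * s\<^sup>2 - 2 * s + 5/4"
          using s2 by (simp add: dv_g_def power2_eq_square field_simps)
        moreover have "(s - 1/2) * (3/5 - s) = 11/10 * s - s\<^sup>2 - 3/10"
          by (simp add: power2_eq_square field_simps)
        moreover have "0 \<le> (s - 1/2) * (3/5 - s)" using True s2 by (intro mult_nonneg_nonneg) auto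
        ultimately show ?thesis using s2 by linarith
      next
        case False
        have "dv_g s t \<le> dv_g s s" using r by (intro dv_g_antimono) auto
        moreover have "1 + dv_g s s = 3 * s\<^sup>2 - 4 * s + 2"
          using False by (simp add: dv_g_def power2_eq_square field_simps)
        moreover have "(s - 3/5) * (2/3 - s) = 19/15 * s - s\<^sup>2 - 2/5"
          by (simp add: power2_eq_square field_simps)
        moreover have "0 \<le> (s - 3/5) * (2/3 - s)" using False r by (intro mult_nonneg_nonneg) auto
        ultimately show ?thesis using False by linarith
      qed
      then show ?thesis using 2 c \<kappa> by (simp add: \<beta>_def \<eta>_def)
    next
      case 3
      from dv_gap[OF reg 3(1) \<kappa>] show ?thesis
      proof
        assume f: "dv_f dv_alpha s t \<le> - dv_alpha - \<kappa>/10"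
        have "\<beta> * t\<^sup>2 \<le> c_DV * t\<^sup>2" using \<kappa> by (intro mult_right_mono) (auto simp: \<beta>_def)
        moreover have "c_DV * t\<^sup>2 + s - s\<^sup>2/2 = dv_f dv_alpha s t + 1" by (simp add: dv_f_def c_DV_def)
        moreover have "1 - dv_alpha = c_DV" by (simp add: c_DV_def)
        ultimately show ?thesis using f 3 \<kappa> by (simp add: \<beta>_def \<eta>_def)
      next
        assume g: "dv_g s t \<le> - dv_alpha + \<kappa> - \<kappa>/10"
        then show ?thesis using 3 \<kappa> by (simp add: \<beta>_def \<eta>_def c_DV_def)
      qed
    qed
  qed
  then show ?thesis
    by (intro exI[of _ \<beta>] exI[of _ \<eta>]) (use \<kappa> c in \<open>auto simp: \<beta>_def \<eta>_def\<close>)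
qed

section \<open>Sums of the bits spent per exposed index\<close>

lemma sum_lin_bound:
  assumes "3 * k \<le> 2 * n"
  shows "real (\<Sum>x<k. 2 * (n - x - 1) - x) \<le> 2 * real n * real k - 3 * (real k)\<^sup>2 / 2"
  using assms
proof (induction k)
  case (Suc k)
  have "real (2 * (n - k - 1) - k) = 2 * real n - 2 - 3 * real k" using Suc.prems by (simp add: of_nat_diff)
  then have "real (\<Sum>x<Suc k. 2 * (n - x - 1) - x)
      = real (\<Sum>x<k. 2 * (n - x - 1) - x) + (2 * real n - 2 - 3 * real k)"
    by (simp only: sum.lessThan_Suc of_nat_add)
  also have "\<dots> \<le> 2 * real n * real k - 3 * (real k)\<^sup>2 / 2 + (2 * real n - 2 - 3 * real k)"
    using Suc by (intro add_right_mono) simp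
  also have "\<dots> \<le> 2 * real n * real (Suc k) - 3 * (real (Suc k))\<^sup>2 / 2"
    by (simp add: power2_eq_square field_simps)
  finally show ?case .
qed simp

text \<open>The hypotheses keep truncated subtraction from cutting off any term, and the squares of
  the number of remaining indices telescope.\<close>

lemma sum_lin_bound2:
  assumes "s \<le> 2 * u" "D = u + k"
  shows "real (\<Sum>i<k. 2 * (D - i - 1) - s) \<le> (real D)\<^sup>2 - (real u)\<^sup>2 - real s * real k"
proof -
  have "j \<le> k \<Longrightarrow> real (\<Sum>i<j. 2 * (D - i - 1) - s) \<le> (real D)\<^sup>2 - (real D - real j)\<^sup>2 - real s * real j" for j
  proof (induction j)
    case (Suc j)
    have "real (2 * (D - j - 1) - s) = 2 * real D - 2 * real j - 2 - real s" using Suc.prems assms by (simp add: of_nat_diff)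
    then show ?case using Suc by (simp add: power2_eq_square algebra_simps)
  qed simp
  from this[of k] show ?thesis using assms(2) by simp
qed

lemma sum_tri_bound: "real (\<Sum>i<a + b. a - 1 - i) \<le> (real a)\<^sup>2 / 2"
proof -
  have "(\<Sum>i<a + b. a - 1 - i) = (\<Sum>i<a. a - 1 - i)"
    by (rule sum.mono_neutral_right) auto
  moreover have "real (\<Sum>i<a. a - 1 - i) \<le> (real a)\<^sup>2 / 2"
  proof (induction a)
    case (Suc a)
    have "(\<Sum>i<Suc a. Suc a - 1 - i) = (\<Sum>i<a. a - i)" by simp
    also have "\<dots> = (\<Sum>i<a. (a - 1 - i) + 1)" by (intro sum.cong) auto
    also have "\<dots> = (\<Sum>i<a. a - 1 - i) + a" by (simp only: sum.distrib) simp
    finally show ?case using Suc by (simp add: power2_eq_square algebra_simps)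
  qed simp
  ultimately show ?thesis by simp
qed

section \<open>The induction\<close>

lemma two_powr_nat: "(2::real) ^ k = 2 powr real k"
  by (simp add: powr_realpow)

lemma two_pow_le_powr: "real k \<le> x \<Longrightarrow> (2::real) ^ k \<le> 2 powr x"
  by (simp add: two_powr_nat)

text \<open>Here x0 \<ge> n/50 and m \<ge> n/100, and 3/4 \<le> 2^(-2/5) because (3/4)^5 < 1/4; with
  the square root the exponent is (1/5) * n^2/5000.\<close>

lemma halasz_gain:
  assumes n: "1000 \<le> n"
  defines "x0 \<equiv> n div 40"
  shows "sqrt ((3/4) ^ (x0 div 2)) ^ x0 \<le> 2 powr (- (1/25000) * (real n)\<^sup>2)"
proof -
  define m where "m = x0 div 2"
  have "real (50 * x0) \<ge> real n" using n unfolding x0_def by (intro of_nat_mono) linarith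
  then have x0: "real n / 50 \<le> real x0" by simp
  have "real (100 * m) \<ge> real n" using n unfolding x0_def m_def by (intro of_nat_mono) linarith
  then have m: "real n / 100 \<le> real m" by simp
  have "real n / 100 * (real n / 50) \<le> real m * real x0" using m x0 by (intro mult_mono) auto
  then have mx: "(real n)\<^sup>2 / 5000 \<le> real m * real x0" by (simp add: power2_eq_square)
  have q: "3/4 \<le> (2::real) powr (- (2/5))"
  proof (rule power_le_imp_le_base)
    have "((2::real) powr (- (2/5))) ^ Suc 4 = 2 powr (- 2)"
      by (simp add: powr_power)
    also have "\<dots> = 1/4" by (simp add: powr_minus)
    finally have e: "((2::real) powr (- (2/5))) ^ Suc 4 = 1/4" .
    show "(3/4) ^ Suc 4 \<le> ((2::real) powr (- (2/5))) ^ Suc 4"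
      unfolding e by (simp add: eval_nat_numeral)
  qed simp
  have "(sqrt ((3/4) ^ m) ^ x0)\<^sup>2 = ((sqrt ((3/4) ^ m))\<^sup>2) ^ x0"
    by (simp only: power_mult[symmetric] mult.commute)
  also have "\<dots> = (3/4) ^ (m * x0)"
    by (simp add: power_mult)
  also have "\<dots> \<le> (2 powr (- (2/5))) ^ (m * x0)" by (rule power_mono[OF q]) simp
  also have "\<dots> = 2 powr (- (2/5) * (real m * real x0))" by (simp add: powr_power mult_ac)
  also have "\<dots> \<le> 2 powr (2 * (- (1/25000) * (real n)\<^sup>2))" using mx by simp
  also have "\<dots> = (2 powr (- (1/25000) * (real n)\<^sup>2))\<^sup>2"
    by (simp add: powr_power)
  finally show ?thesis unfolding m_def by (rule power2_le_imp_le) simp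
qed

lemma dv_g_scaled:
  assumes "0 < n"
  shows "n\<^sup>2 * dv_g (s / n) (t / n) = (if 2 * s \<le> n then t\<^sup>2 - 3 * s\<^sup>2 + 2 * s * n + s * t - 2 * t * n
     else n\<^sup>2 + s\<^sup>2 + t\<^sup>2 + s * t - 2 * s * n - 2 * t * n)"
proof -
  have "s / n \<le> 1/2 \<longleftrightarrow> 2 * s \<le> n" using assms by (simp add: field_simps)
  then show ?thesis using assms by (simp add: dv_g_def field_simps power2_eq_square)
qed

lemma steps_after_span:
  fixes n s r u b :: nat
  assumes "n = s + r + u" "s = u + b"
  shows "n - s - (n - 2 * s) = u + (r - (n - 2 * s))" "2 * s \<le> n \<Longrightarrow> r - (n - 2 * s) = b"
  using assms by auto

context good_class
begin

text \<open>After substituting s = a + 2 b and n = s + r + a + b, each branch is a polynomial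
  identity, up to the linear term for the diagonal.\<close>

lemma bits_g_bound:
  assumes n: "0 < n"
  shows "real bits_g \<le> (real n)\<^sup>2 * (1 + dv_g (real s / real n) (real (s + r) / real n)) + real n"
proof -
  let ?u = "a + b" and ?r1 = "n - 2 * s"
  let ?D = "n - s - ?r1"
  have su: "s = ?u + b" "s \<le> 2 * ?u" "a = 2 * ?u - s" using len by auto
  have nn: "n = s + r + ?u" using cardV by simp
  note k = steps_after_span(1)[OF nn su(1)]
  have 1: "real (\<Sum>x<s. 2 * (n - x - 1) - x) \<le> 2 * real n * real s - 3 * (real s)\<^sup>2 / 2"
    by (rule sum_lin_bound) (use nn su in linarith)
  have 2: "real (\<Sum>i<r - ?r1. 2 * (?D - i - 1) - s) \<le> (real ?D)\<^sup>2 - (real ?u)\<^sup>2 - real s * real (r - ?r1)"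
    by (rule sum_lin_bound2[OF su(2) k])
  have 3: "real (\<Sum>i<a + b. a - 1 - i) \<le> (real a)\<^sup>2 / 2" by (rule sum_tri_bound)
  define S R A B' where "S = real s" and "R = real r" and "A = real a" and "B' = real b"
  have S: "S = A + 2 * B'" using len by (simp add: S_def A_def B'_def)
  have N: "real n = S + R + A + B'" using cardV by (simp add: S_def R_def A_def B'_def)
  have tot: "real bits_g \<le> real n + (2 * real n * S - 3 * S\<^sup>2 / 2) + real ?r1 * S
      + ((real ?D)\<^sup>2 - (A + B')\<^sup>2 - S * real (r - ?r1)) + A\<^sup>2 / 2"
    using 1 2 3 unfolding bits_g_def S_def A_def B'_def by simp
  have sc: "(real n)\<^sup>2 * (1 + dv_g (real s / real n) (real (s + r) / real n))
     = (real n)\<^sup>2 + (if 2 * S \<le> real n then (S + R)\<^sup>2 - 3 * S\<^sup>2 + 2 * S * real n + S * (S + R) - 2 * (S + R) * real n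
     else (real n)\<^sup>2 + S\<^sup>2 + (S + R)\<^sup>2 + S * (S + R) - 2 * S * real n - 2 * (S + R) * real n)"
    using dv_g_scaled[of "real n" S "S + R"] n by (simp add: distrib_left S_def R_def)
  show ?thesis
  proof (cases "2 * s \<le> n")
    case True
    then have c: "2 * S \<le> real n" by (simp add: S_def)
    have "?D = s" using True by simp
    moreover have "real ?r1 = real n - 2 * S" using True by (simp add: S_def of_nat_diff)
    moreover have "real (r - ?r1) = B'"
      unfolding steps_after_span(2)[OF nn su(1) True] B'_def ..
    ultimately have "real bits_g \<le> real n + (2 * real n * S - 3 * S\<^sup>2 / 2) + (real n - 2 * S) * S
      + (S\<^sup>2 - (A + B')\<^sup>2 - S * B') + A\<^sup>2 / 2" using tot by (simp add: S_def)
    also have "\<dots> = (real n)\<^sup>2 + ((S + R)\<^sup>2 - 3 * S\<^sup>2 + 2 * S * real n + S * (S + R) - 2 * (S + R) * real n) + real n"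
      unfolding N S by (simp add: power2_eq_square field_simps)
    finally show ?thesis unfolding sc using c by simp
  next
    case False
    then have c: "\<not> 2 * S \<le> real n" by (simp add: S_def)
    have "?r1 = 0" using False by simp
    moreover have "real (n - s) = real n - S" using nn by (simp add: S_def)
    ultimately have "real bits_g \<le> real n + (2 * real n * S - 3 * S\<^sup>2 / 2)
      + ((real n - S)\<^sup>2 - (A + B')\<^sup>2 - S * R) + A\<^sup>2 / 2" using tot by (simp add: R_def)
    also have "\<dots> = (real n)\<^sup>2 + ((real n)\<^sup>2 + S\<^sup>2 + (S + R)\<^sup>2 + S * (S + R) - 2 * S * real n - 2 * (S + R) * real n) + real n"
      unfolding N S by (simp add: power2_eq_square field_simps)
    finally show ?thesis unfolding sc using c by simp
  qed
qed

text \<open>The hypothesis makes a non-special index no dearer than a special one. What remains is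
  the identity 2 (s + r) b + a (s + r + b) + a^2/2 = s n - s^2/2.\<close>

lemma bits_f_bound:
  assumes "3 * b \<le> s + r"
  shows "real (bits_tu Sp + n + (\<Sum>i<a + b. a - 1 - i)) \<le> real s * real n - (real s)\<^sup>2 / 2 + 3 * real n"
proof -
  have cA: "card (set Al \<inter> Sp) + card (set Al - Sp) = a"
  proof -
    have "card (set Al \<inter> Sp) + card (set Al - Sp) = card (set Al)"
      by (subst card_Un_disjoint[symmetric]) (auto intro: arg_cong[of _ _ card])
    then show ?thesis using dist by (simp add: distinct_card)
  qed
  have cB: "card (set Bl \<inter> Sp) \<le> b"
    using card_mono[of "set Bl" "set Bl \<inter> Sp"] card_length[of Bl] by simp
  have "card (set Al \<inter> Sp) * ((s + r) + card (set Bl \<inter> Sp)) + card (set Al - Sp) * (2 * (2 * b + 1))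
      \<le> card (set Al \<inter> Sp) * (s + r + b + 2) + card (set Al - Sp) * (s + r + b + 2)"
  proof (rule add_mono[OF mult_le_mono2 mult_le_mono2])
    show "(s + r) + card (set Bl \<inter> Sp) \<le> s + r + b + 2" using cB by simp
    show "2 * (2 * b + 1) \<le> s + r + b + 2" using assms by simp
  qed
  also have "\<dots> = a * (s + r + b + 2)" unfolding cA[symmetric] by (simp only: add_mult_distrib)
  finally have "bits_tu Sp \<le> 2 * ((s + r) * b) + a * (s + r + b + 2)" by (simp add: bits_tu_def)
  then have "real (bits_tu Sp) \<le> real (2 * ((s + r) * b) + a * (s + r + b + 2))" by (rule of_nat_mono)
  moreover have "real (\<Sum>i<a + b. a - 1 - i) \<le> (real a)\<^sup>2 / 2" by (rule sum_tri_bound)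
  ultimately have "real (bits_tu Sp + n + (\<Sum>i<a + b. a - 1 - i))
      \<le> real (2 * ((s + r) * b) + a * (s + r + b + 2)) + real n + (real a)\<^sup>2 / 2" by simp
  also have "\<dots> \<le> real s * real n - (real s)\<^sup>2 / 2 + 3 * real n"
    unfolding cardV using len by (simp add: power2_eq_square field_simps)
  finally show ?thesis .
qed

lemma good_class_bound:
  assumes gf: "\<And>M. M \<in> \<M> \<Longrightarrow> goodf Il Rl Al Bl Sp d E ix M"
    and rk: "\<And>M. M \<in> \<M> \<Longrightarrow> rankcond V Il (n div 40) (n div 40 div 2) M"
    and n: "1000 \<le> n" and K: "1 \<le> K" and \<beta>: "0 \<le> \<beta>"
    and IH: "\<And>W N. W \<subseteq> V \<Longrightarrow> card W < n \<Longrightarrow> real (card (QN W N)) \<le> K * 2 powr (\<beta> * (real (card W))\<^sup>2)"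
    and tri: "\<And>s t. dv_region s t \<Longrightarrow>
     (1/10 \<le> s \<and> 3 * s + 2 * t \<le> 3 \<and> \<beta> * t\<^sup>2 + s - s\<^sup>2/2 \<le> \<beta> - \<eta>) \<or>
     (s < 1/10 \<and> 1 + dv_g s t \<le> \<beta> - \<eta>) \<or>
     (1/10 \<le> s \<and> 1 + dv_g s t - 1/25000 \<le> \<beta> - \<eta>)"
  shows "real (card \<M>) \<le> K * 2 powr ((\<beta> - \<eta>) * (real n)\<^sup>2 + 3 * real n)"
proof -
  define N' S T' where "N' = real n" and "S = real s" and "T' = real (s + r)"
  have N': "0 < N'" using n by (simp add: N'_def)
  have SN: "S / N' * N' = S" "T' / N' * N' = T'" using N' by auto
  have su: "s = a + 2 * b" "n = s + r + a + b" using len cardV by auto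
  \<comment> \<open>For u = a + b = n - (s + r), the relation s = a + 2 b gives u \<le> s \<le> 2 u,
    which is the region after scaling.\<close>
  have reg: "dv_region (S / N') (T' / N')"
    unfolding dv_region_def
  proof (intro conjI)
    show "0 \<le> S / N'" using N' by (simp add: S_def)
    have "3 * s \<le> 2 * n" using su by arith
    then have "3 * S \<le> 2 * N'" unfolding S_def N'_def by linarith
    then show "S / N' \<le> 2/3" using N' by (simp add: field_simps)
    show "S / N' \<le> T' / N'" using N' by (simp add: S_def T'_def divide_right_mono)
    have "s + 2 * (s + r) \<le> 2 * n" using su by arith
    then have "S + 2 * T' \<le> 2 * N'" unfolding S_def N'_def T'_def by linarith
    then show "S / N' / 2 \<le> 1 - T' / N'" using N' by (simp add: field_simps)
    have "n \<le> s + (s + r)" using su by arith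
    then have "N' \<le> S + T'" unfolding S_def N'_def T'_def by linarith
    then have "N' / N' \<le> (S + T') / N'" using N' by (intro divide_right_mono) auto
    then show "1 - T' / N' \<le> S / N'" using N' by (simp add: add_divide_distrib)
  qed
  have g: "real bits_g \<le> N'\<^sup>2 * (1 + dv_g (S / N') (T' / N')) + N'"
    using bits_g_bound n unfolding N'_def S_def T'_def by simp
  have K1: "x \<le> K * x" if "0 \<le> x" for x using K that mult_right_mono[of 1 K x] by simp
  have fin: "2 powr (N'\<^sup>2 * (\<beta> - \<eta>) + N') \<le> K * 2 powr ((\<beta> - \<eta>) * N'\<^sup>2 + 3 * N')"
  proof -
    have "2 powr (N'\<^sup>2 * (\<beta> - \<eta>) + N') \<le> 2 powr ((\<beta> - \<eta>) * N'\<^sup>2 + 3 * N')"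
      using N' by (simp add: mult.commute)
    also have "\<dots> \<le> K * 2 powr ((\<beta> - \<eta>) * N'\<^sup>2 + 3 * N')" by (rule K1) simp
    finally show ?thesis .
  qed
  from tri[OF reg] consider
    (f) "1/10 \<le> S / N'" "3 * (S / N') + 2 * (T' / N') \<le> 3"
        "\<beta> * (T' / N')\<^sup>2 + S / N' - (S / N')\<^sup>2/2 \<le> \<beta> - \<eta>"
    | (g0) "S / N' < 1/10" "1 + dv_g (S / N') (T' / N') \<le> \<beta> - \<eta>"
    | (g1) "1/10 \<le> S / N'" "1 + dv_g (S / N') (T' / N') - 1/25000 \<le> \<beta> - \<eta>" by blast
  then show ?thesis
  proof cases
    case f
    have "0 < S" using f(1) N' by (simp add: field_simps)
    then have "0 < s" by (simp add: S_def)
    then have cT: "card (set Il \<union> set Rl) < n" unfolding cardT using su by arith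
    \<comment> \<open>Since s + (s + r) = n + b, the condition 3 s + 2 t \<le> 3 is, after scaling,
      3 b \<le> s + r.\<close>
    have "3 * S + 2 * T' \<le> 3 * N'" using f(2) N' by (simp add: field_simps)
    then have "real (3 * s + 2 * (s + r)) \<le> real (3 * n)" by (simp add: S_def T'_def N'_def)
    then have "3 * s + 2 * (s + r) \<le> 3 * n" by (simp only: of_nat_le_iff)
    then have "3 * b \<le> s + r" using su by simp
    from bits_f_bound[OF this] have bf: "real (bits_tu Sp + n + (\<Sum>i<a + b. a - 1 - i)) \<le> S * N' - S\<^sup>2 / 2 + 3 * N'"
      by (simp add: S_def N'_def)
    have "real (card \<M>) \<le> 2 ^ (bits_tu Sp + n + (\<Sum>i<a + b. a - 1 - i)) * (K * 2 powr (\<beta> * T'\<^sup>2))"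
    proof (rule count_f)
      show "goodf Il Rl Al Bl Sp d E ix M" if "M \<in> \<M>" for M by (rule gf[OF that])
      show "real (card (QN (set Il \<union> set Rl) N)) \<le> K * 2 powr (\<beta> * T'\<^sup>2)" for N
        using IH[of "set Il \<union> set Rl" N] cT setV unfolding cardT T'_def by auto
    qed
    also have "\<dots> \<le> 2 powr (S * N' - S\<^sup>2 / 2 + 3 * N') * (K * 2 powr (\<beta> * T'\<^sup>2))"
      using K by (intro mult_right_mono two_pow_le_powr bf) auto
    also have "\<dots> = K * 2 powr ((\<beta> * T'\<^sup>2 + S * N' - S\<^sup>2 / 2) + 3 * N')"
      by (simp add: powr_add[symmetric] algebra_simps)
    also have "\<dots> \<le> K * 2 powr ((\<beta> - \<eta>) * N'\<^sup>2 + 3 * N')"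
    proof -
      have "N'\<^sup>2 * (\<beta> * (T' / N')\<^sup>2 + S / N' - (S / N')\<^sup>2/2) \<le> N'\<^sup>2 * (\<beta> - \<eta>)"
        using f(3) by (intro mult_left_mono) auto
      also have "N'\<^sup>2 * (\<beta> * (T' / N')\<^sup>2 + S / N' - (S / N')\<^sup>2/2) = \<beta> * T'\<^sup>2 + S * N' - S\<^sup>2 / 2"
        using N' by (simp add: field_simps power2_eq_square)
      finally show ?thesis using K by (intro mult_left_mono) (auto simp: mult.commute)
    qed
    finally show ?thesis by (simp add: N'_def)
  next
    case g0
    have "real (card \<M>) \<le> 2 ^ bits_g * sqrt ((3/4) ^ 0) ^ 0"
      by (rule count_g) (simp_all add: rankcond_def)
    also have "\<dots> = 2 ^ bits_g" by simp
    also have "\<dots> \<le> 2 powr (N'\<^sup>2 * (\<beta> - \<eta>) + N')"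
      using g g0(2) mult_left_mono[OF g0(2), of "N'\<^sup>2"] by (intro two_pow_le_powr) simp
    also note fin
    finally show ?thesis by (simp add: N'_def)
  next
    case g1
    have "N' \<le> 10 * S" using g1(1) N' by (simp add: field_simps)
    then have x0: "2 * (n div 40) \<le> s" unfolding S_def N'_def by linarith
    have "real (card \<M>) \<le> 2 ^ bits_g * sqrt ((3/4) ^ (n div 40 div 2)) ^ (n div 40)"
      by (rule count_g[OF rk x0])
    also have "\<dots> \<le> 2 powr (N'\<^sup>2 * (1 + dv_g (S / N') (T' / N')) + N') * 2 powr (- (1/25000) * N'\<^sup>2)"
      using g halasz_gain[OF n] unfolding N'_def by (intro mult_mono two_pow_le_powr) auto
    also have "\<dots> = 2 powr (N'\<^sup>2 * (1 + dv_g (S / N') (T' / N') - 1/25000) + N')"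
      by (simp add: powr_add[symmetric] algebra_simps)
    also have "\<dots> \<le> 2 powr (N'\<^sup>2 * (\<beta> - \<eta>) + N')"
      using mult_left_mono[OF g1(2), of "N'\<^sup>2"] by simp
    also note fin
    finally show ?thesis by (simp add: N'_def)
  qed
qed

end

text \<open>This fixes the thresholds n/40 and n/80. With x = card P, describing the rows costs at
  most 5.5 x^2 + 2 x + x n bits, where card K \<le> x/2 accounts for x n, while shrinking the block
  saves at least 1.38 x n - x^2. For x \<le> n/20 more than x n / 20 is left, and x \<ge> n/50 turns
  this into n^2/1000.\<close>

lemma cheap_class_bound:
  fixes V :: "'v set"
  assumes V: "finite V" and MQ: "\<M> \<subseteq> QN V N" and ch: "\<And>M. M \<in> \<M> \<Longrightarrow> cheap V P J K M"
    and x: "card V div 40 \<le> card P" "card P < 2 * (card V div 40)" and J: "card J \<le> 2 * card P + 1"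
    and Kc: "card K < card V div 40 div 2"
    and n: "1000 \<le> card V" and C: "0 \<le> C" and \<beta>: "69/100 \<le> \<beta>" "\<beta> \<le> 1"
    and IH: "\<And>W N. W \<subseteq> V \<Longrightarrow> card W < card V \<Longrightarrow> real (card (QN W N)) \<le> C * 2 powr (\<beta> * (real (card W))\<^sup>2)"
  shows "real (card \<M>) \<le> C * 2 powr (\<beta> * (real (card V))\<^sup>2 - (real (card V))\<^sup>2 / 1000)"
proof (cases "\<M> = {}")
  case False
  then obtain M where "M \<in> \<M>" by blast
  from ch[OF this] have sub: "P \<subseteq> V" "J \<subseteq> V - P" "K \<subseteq> P" by (auto simp: cheap_def)
  define n x j k where "n = card V" and "x = card P" and "j = card J" and "k = card K"
  have cW: "card (V - P) = n - x" using sub V by (simp add: card_Diff_subset finite_subset n_def x_def)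
  have xn: "50 * x \<ge> n" "20 * x \<le> n" "2 * k \<le> x" "j \<le> 2 * x + 1" "x \<le> n" "0 < x"
    using x J Kc n unfolding n_def x_def k_def j_def by linarith+
  define X Nn where "X = real x" and "Nn = real n"
  have XN: "Nn \<le> 50 * X" "20 * X \<le> Nn" "1000 \<le> Nn" "0 \<le> X"
    using xn n unfolding X_def Nn_def n_def by linarith+
  have "real (card \<M>) \<le> 2 ^ (x * x + 2 * (x * j) + 2 * (k * n) + x * k) * (C * 2 powr (\<beta> * (Nn - X)\<^sup>2))"
    unfolding x_def j_def k_def n_def
  proof (rule count_cheap[OF V MQ ch sub])
    show "real (card (QN (V - P) N)) \<le> C * 2 powr (\<beta> * (Nn - X)\<^sup>2)" for N
      using IH[of "V - P" N] cW xn n unfolding Nn_def X_def n_def[symmetric] by (simp add: of_nat_diff)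
  qed
  also have "\<dots> \<le> 2 powr (11/2 * X\<^sup>2 + 2 * X + X * Nn) * (C * 2 powr (\<beta> * (Nn - X)\<^sup>2))"
  proof (intro mult_right_mono two_pow_le_powr)
    have "real (x * x + 2 * (x * j) + 2 * (k * n) + x * k) \<le> X * X + 2 * (X * (2 * X + 1)) + X * Nn + X * (X / 2)"
    proof -
      have "real j \<le> 2 * X + 1" "2 * real k \<le> X" using xn unfolding X_def by linarith+
      then have "X * real j \<le> X * (2 * X + 1)" "2 * real k * Nn \<le> X * Nn" "X * real k \<le> X * (X / 2)"
        using XN by (auto intro!: mult_left_mono mult_right_mono)
      then show ?thesis by (simp add: X_def Nn_def)
    qed
    also have "\<dots> = 11/2 * X\<^sup>2 + 2 * X + X * Nn" by (simp add: power2_eq_square field_simps)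
    finally show "real (x * x + 2 * (x * j) + 2 * (k * n) + x * k) \<le> 11/2 * X\<^sup>2 + 2 * X + X * Nn" .
  qed (use C in simp)
  also have "\<dots> = C * 2 powr (11/2 * X\<^sup>2 + 2 * X + X * Nn + \<beta> * (Nn - X)\<^sup>2)"
    by (simp add: powr_add mult_ac)
  also have "\<dots> \<le> C * 2 powr (\<beta> * Nn\<^sup>2 - Nn\<^sup>2 / 1000)"
  proof (intro mult_left_mono powr_mono C)
    have "(69/100) * (X * Nn) \<le> \<beta> * (X * Nn)" using \<beta> XN by (intro mult_right_mono) auto
    moreover have "\<beta> * X\<^sup>2 \<le> 1 * X\<^sup>2" using \<beta> by (intro mult_right_mono) auto
    moreover have "20 * X\<^sup>2 \<le> X * Nn"
      using mult_left_mono[OF XN(2,4)] by (simp add: power2_eq_square mult.left_commute)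
    moreover have "1000 * X \<le> X * Nn"
      using mult_left_mono[OF XN(3,4)] by (simp add: mult.commute)
    moreover have "Nn\<^sup>2 \<le> 50 * (X * Nn)"
      using mult_right_mono[OF XN(1), of Nn] XN(3) by (simp add: power2_eq_square mult.assoc)
    moreover have "\<beta> * (Nn - X)\<^sup>2 = \<beta> * Nn\<^sup>2 - 2 * (\<beta> * (X * Nn)) + \<beta> * X\<^sup>2"
      by (simp add: power2_eq_square algebra_simps)
    moreover have "0 \<le> X * Nn" using XN by simp
    ultimately show "11/2 * X\<^sup>2 + 2 * X + X * Nn + \<beta> * (Nn - X)\<^sup>2 \<le> \<beta> * Nn\<^sup>2 - Nn\<^sup>2 / 1000"
      by linarith
  qed simp
  finally show ?thesis by (simp add: Nn_def n_def)
qed (use C in simp)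

section \<open>Union bound over the classes and conclusion of the recursion\<close>

lemma card_le_classes:
  assumes "finite S" "finite \<Delta>" "\<And>M. M \<in> S \<Longrightarrow> \<exists>\<delta>\<in>\<Delta>. P \<delta> M"
    and "\<And>\<delta>. \<delta> \<in> \<Delta> \<Longrightarrow> real (card {M \<in> S. P \<delta> M}) \<le> B"
  shows "real (card S) \<le> real (card \<Delta>) * B"
proof -
  have "S = (\<Union>\<delta>\<in>\<Delta>. {M \<in> S. P \<delta> M})" using assms(3) by blast
  then have "card S \<le> (\<Sum>\<delta>\<in>\<Delta>. card {M \<in> S. P \<delta> M})"
    using card_UN_le[OF assms(2), of "\<lambda>\<delta>. {M \<in> S. P \<delta> M}"] by simp
  then have "real (card S) \<le> (\<Sum>\<delta>\<in>\<Delta>. real (card {M \<in> S. P \<delta> M}))" by (metis of_nat_le_iff of_nat_sum)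
  also have "\<dots> \<le> (\<Sum>\<delta>\<in>\<Delta>. B)" by (intro sum_mono assms(4))
  finally show ?thesis by simp
qed

lemma card_short_lists:
  assumes "finite V"
  shows "card {xs. set xs \<subseteq> V \<and> length xs \<le> card V} \<le> (card V + 1) ^ (card V + 1)"
proof -
  have "(\<Sum>i\<le>card V. card V ^ i) \<le> (\<Sum>i\<le>card V. (card V + 1) ^ card V)"
  proof (intro sum_mono)
    fix i assume i: "i \<in> {..card V}"
    have "card V ^ i \<le> (card V + 1) ^ i" by (intro power_mono) auto
    also have "\<dots> \<le> (card V + 1) ^ card V" using i by (intro power_increasing) auto
    finally show "card V ^ i \<le> (card V + 1) ^ card V" .
  qed
  then show ?thesis using assms by (simp add: card_lists_length_le)
qed

text \<open>The factor 8^n counts the triples of subsets in the cheap case. In the other case the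
  four lists and the map \<open>ix\<close> account for (n + 1)^(5 n + 4), and the two subsets and
  the directions for 2^n * 2^n * 4^n = 16^n.\<close>

lemma QN_recursion:
  fixes V :: "'v set"
  assumes V: "finite V" and n: "1000 \<le> card V" and C: "1 \<le> C" and \<beta>: "69/100 \<le> \<beta>" "\<beta> \<le> 1"
    and IH: "\<And>W N. W \<subseteq> V \<Longrightarrow> card W < card V \<Longrightarrow> real (card (QN W N)) \<le> C * 2 powr (\<beta> * (real (card W))\<^sup>2)"
    and tri: "\<And>s t. dv_region s t \<Longrightarrow>
     (1/10 \<le> s \<and> 3 * s + 2 * t \<le> 3 \<and> \<beta> * t\<^sup>2 + s - s\<^sup>2/2 \<le> \<beta> - \<eta>) \<or>
     (s < 1/10 \<and> 1 + dv_g s t \<le> \<beta> - \<eta>) \<or>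
     (1/10 \<le> s \<and> 1 + dv_g s t - 1/25000 \<le> \<beta> - \<eta>)"
  shows "real (card (QN V N))
    \<le> 8 ^ card V * (C * 2 powr (\<beta> * (real (card V))\<^sup>2 - (real (card V))\<^sup>2 / 1000))
      + real (card V + 1) ^ (5 * card V + 4) * 16 ^ card V
        * (C * 2 powr ((\<beta> - \<eta>) * (real (card V))\<^sup>2 + 3 * real (card V)))"
proof -
  let ?n = "card V"
  let ?x0 = "?n div 40" and ?m = "?n div 40 div 2"
  define Pc :: "'v set \<times> 'v set \<times> 'v set \<Rightarrow> ('v \<times> 'v \<Rightarrow> real) \<Rightarrow> bool" where
    "Pc = (\<lambda>(P, J, K) M. cheap V P J K M \<and> ?x0 \<le> card P \<and> card P < 2 * ?x0 \<and> card J \<le> 2 * card P + 1 \<and> card K < ?m)"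
  define \<Delta>c where "\<Delta>c = Pow V \<times> Pow V \<times> Pow V"
  define Pg where
    "Pg = (\<lambda>((Il, Rl, Al, Bl), Sp, d, E, ix) M. good V Il Rl Al Bl M \<and> goodf Il Rl Al Bl Sp d E ix M \<and> rankcond V Il ?x0 ?m M)"
  define L where "L = {xs. set xs \<subseteq> V \<and> length xs \<le> ?n}"
  define \<Delta>g where "\<Delta>g = (L \<times> L \<times> L \<times> L) \<times> Pow V \<times> PiE V (\<lambda>_. dirs) \<times> Pow V \<times> PiE V (\<lambda>_. V)"
  define Sc where "Sc = {M \<in> QN V N. \<exists>\<delta>\<in>\<Delta>c. Pc \<delta> M}"
  define Sg where "Sg = {M \<in> QN V N. \<exists>\<delta>\<in>\<Delta>g. Pg \<delta> M}"
  have fQ: "finite (QN V N)" by (rule finite_QN[OF V])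
  have fd: "finite dirs" "card dirs = 4" by (simp_all add: dirs_def)
  have fL: "finite L" unfolding L_def by (rule finite_lists_length_le[OF V])
  have "finite \<Delta>c" using V by (simp add: \<Delta>c_def)
  moreover have "finite \<Delta>g"
    unfolding \<Delta>g_def using V fd fL by (intro finite_cartesian_product finite_PiE) auto
  ultimately have fin\<Delta>: "finite \<Delta>c" "finite \<Delta>g" by blast+
  have cover: "QN V N \<subseteq> Sc \<union> Sg"
  proof
    fix M assume M: "M \<in> QN V N"
    from ex_good[OF V, of M] obtain Il Rl Al Bl Sp d E ix where
      g: "good V Il Rl Al Bl M" "goodf Il Rl Al Bl Sp d E ix M" and
      data: "Sp \<subseteq> V" "d \<in> PiE V (\<lambda>_. dirs)" "E \<subseteq> V" "ix \<in> PiE V (\<lambda>_. V)" by (elim exE conjE)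
    have dl: "distinct Il" "distinct Rl" "distinct Al" "distinct Bl"
      and sl: "set Il \<subseteq> V" "set Rl \<subseteq> V" "set Al \<subseteq> V" "set Bl \<subseteq> V" using g(1) by (auto simp: good_def)
    have inL: "xs \<in> L" if "distinct xs" "set xs \<subseteq> V" for xs
      unfolding L_def using that card_mono[OF V that(2)] by (simp add: distinct_card)
    show "M \<in> Sc \<union> Sg"
    proof (cases "rankcond V Il ?x0 ?m M")
      case True
      have "((Il, Rl, Al, Bl), Sp, d, E, ix) \<in> \<Delta>g" using inL dl sl data by (simp add: \<Delta>g_def)
      moreover have "Pg ((Il, Rl, Al, Bl), Sp, d, E, ix) M" using g True by (simp add: Pg_def)
      ultimately show ?thesis using M unfolding Sg_def by blast
    next
      case False
      from ex_cheap[OF V dl(1) sl(1) False] obtain P J K where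
        c: "cheap V P J K M \<and> ?x0 \<le> card P \<and> card P < 2 * ?x0 \<and> card J \<le> 2 * card P + 1 \<and> card K < ?m"
        by (elim exE)
      then have "(P, J, K) \<in> \<Delta>c" by (auto simp: \<Delta>c_def cheap_def)
      moreover have "Pc (P, J, K) M" using c by (simp add: Pc_def)
      ultimately show ?thesis using M unfolding Sc_def by blast
    qed
  qed
  have "card (QN V N) \<le> card (Sc \<union> Sg)" by (rule card_mono[OF _ cover]) (use fQ in \<open>simp add: Sc_def Sg_def\<close>)
  then have "real (card (QN V N)) \<le> real (card Sc) + real (card Sg)" using card_Un_le[of Sc Sg] by linarith
  moreover have "real (card Sc) \<le> real (card \<Delta>c) * (C * 2 powr (\<beta> * (real ?n)\<^sup>2 - (real ?n)\<^sup>2 / 1000))"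
  proof (rule card_le_classes[where P = Pc])
    show "finite Sc" using fQ by (simp add: Sc_def)
    show "finite \<Delta>c" by (rule fin\<Delta>)
    show "\<exists>\<delta>\<in>\<Delta>c. Pc \<delta> M" if "M \<in> Sc" for M using that by (simp add: Sc_def)
    fix \<delta> assume "\<delta> \<in> \<Delta>c"
    obtain P J K where e: "\<delta> = (P, J, K)" by (cases \<delta>)
    show "real (card {M \<in> Sc. Pc \<delta> M}) \<le> C * 2 powr (\<beta> * (real ?n)\<^sup>2 - (real ?n)\<^sup>2 / 1000)"
    proof (cases "{M \<in> Sc. Pc \<delta> M} = {}")
      case False
      then have num: "?x0 \<le> card P" "card P < 2 * ?x0" "card J \<le> 2 * card P + 1" "card K < ?m"
        by (auto simp: Pc_def e)
      show ?thesis
      proof (rule cheap_class_bound[OF V _ _ num n _ \<beta> IH])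
        show "{M \<in> Sc. Pc \<delta> M} \<subseteq> QN V N" by (auto simp: Sc_def)
        show "cheap V P J K M" if "M \<in> {M \<in> Sc. Pc \<delta> M}" for M using that by (simp add: Pc_def e)
      qed (use C in auto)
    next
      case True
      show ?thesis unfolding True using C by simp
    qed
  qed
  moreover have "real (card Sg) \<le> real (card \<Delta>g) * (C * 2 powr ((\<beta> - \<eta>) * (real ?n)\<^sup>2 + 3 * real ?n))"
  proof (rule card_le_classes[where P = Pg])
    show "finite Sg" using fQ by (simp add: Sg_def)
    show "finite \<Delta>g" by (rule fin\<Delta>)
    show "\<exists>\<delta>\<in>\<Delta>g. Pg \<delta> M" if "M \<in> Sg" for M using that by (simp add: Sg_def)
    fix \<delta> assume "\<delta> \<in> \<Delta>g"
    obtain Il Rl Al Bl Sp d E ix where e: "\<delta> = ((Il, Rl, Al, Bl), Sp, d, E, ix)" by (metis prod_cases5 prod_cases4)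
    let ?M = "{M \<in> Sg. Pg \<delta> M}"
    show "real (card ?M) \<le> C * 2 powr ((\<beta> - \<eta>) * (real ?n)\<^sup>2 + 3 * real ?n)"
    proof (cases "?M = {}")
      case False
      then obtain M0 where "good V Il Rl Al Bl M0" by (auto simp: Pg_def e)
      then have gd0: "distinct (Il @ Rl @ Al @ Bl)" "V = set Il \<union> set Rl \<union> set Al \<union> set Bl"
        "length Il = length Al + 2 * length Bl" by (auto simp: good_def)
      interpret good_class V N ?M Il Rl Al Bl
      proof
        show "?M \<subseteq> QN V N" by (auto simp: Sg_def)
        show "good V Il Rl Al Bl M" if "M \<in> ?M" for M using that by (simp add: Pg_def e)
      qed (use V gd0 in auto)
      show ?thesis
      proof (rule good_class_bound[OF _ _ n C _ IH tri])
        show "goodf Il Rl Al Bl Sp d E ix M" if "M \<in> ?M" for M using that by (simp add: Pg_def e)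
        show "rankcond V Il ?x0 ?m M" if "M \<in> ?M" for M using that by (simp add: Pg_def e)
      qed (use \<beta> in auto)
    next
      case True
      show ?thesis unfolding True using C by simp
    qed
  qed
  moreover have "real (card \<Delta>c) = 8 ^ ?n"
  proof -
    have "card \<Delta>c = 2 ^ ?n * (2 ^ ?n * 2 ^ ?n)" using V by (simp add: \<Delta>c_def card_cartesian_product card_Pow)
    also have "\<dots> = 8 ^ ?n" by (simp add: power_mult_distrib[symmetric])
    finally show ?thesis by simp
  qed
  moreover have "real (card \<Delta>g) \<le> real (?n + 1) ^ (5 * ?n + 4) * 16 ^ ?n"
  proof -
    let ?l = "(?n + 1) ^ (?n + 1)"
    have "card \<Delta>g = (card L * (card L * (card L * card L))) * (2 ^ ?n * (4 ^ ?n * (2 ^ ?n * ?n ^ ?n)))"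
      using V fd by (simp add: \<Delta>g_def card_cartesian_product card_Pow card_PiE)
    also have "\<dots> \<le> (?l * (?l * (?l * ?l))) * (2 ^ ?n * (4 ^ ?n * (2 ^ ?n * (?n + 1) ^ ?n)))"
      using card_short_lists[OF V] unfolding L_def[symmetric]
      by (intro mult_le_mono order_refl power_mono) auto
    also have "\<dots> = (?n + 1) ^ (5 * ?n + 4) * 16 ^ ?n"
    proof -
      have e1: "?l * (?l * (?l * ?l)) * (?n + 1) ^ ?n = (?n + 1) ^ (5 * ?n + 4)"
      proof -
        have "5 * ?n + 4 = (?n + 1) + ((?n + 1) + ((?n + 1) + (?n + 1))) + ?n" by simp
        then show ?thesis by (simp only: power_add)
      qed
      have e2: "(2::nat) ^ ?n * (4 ^ ?n * 2 ^ ?n) = 16 ^ ?n" by (simp add: power_mult_distrib[symmetric])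
      have e3: "(l * (l * (l * l))) * (x * (y * (x * z))) = (l * (l * (l * l)) * z) * (x * (y * x))"
        for l x y z :: nat by (simp only: ac_simps)
      show ?thesis unfolding e3 e1 e2 ..
    qed
    finally have "real (card \<Delta>g) \<le> real ((?n + 1) ^ (5 * ?n + 4) * 16 ^ ?n)" by (rule of_nat_mono)
    then show ?thesis by simp
  qed
  then have "real (card \<Delta>g) * (C * 2 powr ((\<beta> - \<eta>) * (real ?n)\<^sup>2 + 3 * real ?n))
     \<le> real (?n + 1) ^ (5 * ?n + 4) * 16 ^ ?n * (C * 2 powr ((\<beta> - \<eta>) * (real ?n)\<^sup>2 + 3 * real ?n))"
    using C by (intro mult_right_mono) auto
  ultimately show ?thesis by simp
qed

text \<open>Each summand is eventually at most half of the right-hand side. No constant appears on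
  the right, so the induction reproduces its multiplicative constant exactly.\<close>

lemma eventually_absorbed:
  assumes \<eta>: "0 < (\<eta>::real)"
  shows "\<forall>\<^sub>F n::nat in sequentially.
      8 ^ n * 2 powr (\<beta> * (real n)\<^sup>2 - (real n)\<^sup>2 / 1000)
      + real (n + 1) ^ (5 * n + 4) * 16 ^ n * 2 powr ((\<beta> - \<eta>) * (real n)\<^sup>2 + 3 * real n)
      \<le> 2 powr (\<beta> * (real n)\<^sup>2)"
proof -
  have "\<forall>\<^sub>F n::nat in sequentially. 3 * real n + 1 \<le> (real n)\<^sup>2 / 1000" by real_asymp
  moreover have "\<forall>\<^sub>F n::nat in sequentially.
      (5 * real n + 4) * log 2 (real n + 1) + 7 * real n + 1 \<le> \<eta> * (real n)\<^sup>2"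
    using \<eta> by real_asymp
  ultimately show ?thesis
  proof eventually_elim
    case (elim n)
    have half: "2 powr (x - 1) = 2 powr x / (2::real)" for x by (simp add: powr_diff)
    have "(8::real) ^ n = 2 powr (3 * real n)"
    proof -
      have "(8::real) ^ n = 2 ^ (3 * n)" by (simp add: power_mult)
      then show ?thesis by (simp add: two_powr_nat)
    qed
    then have "8 ^ n * 2 powr (\<beta> * (real n)\<^sup>2 - (real n)\<^sup>2 / 1000)
        = 2 powr (3 * real n + (\<beta> * (real n)\<^sup>2 - (real n)\<^sup>2 / 1000))" by (simp add: powr_add)
    also have "\<dots> \<le> 2 powr (\<beta> * (real n)\<^sup>2 - 1)" using elim(1) by simp
    finally have 1: "8 ^ n * 2 powr (\<beta> * (real n)\<^sup>2 - (real n)\<^sup>2 / 1000) \<le> 2 powr (\<beta> * (real n)\<^sup>2) / 2"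
      by (simp add: half)
    define l where "l = log 2 (real n + 1)"
    have p: "real (n + 1) = 2 powr l" by (simp add: l_def)
    have "(2 powr l) ^ (5 * n + 4) = 2 powr ((5 * real n + 4) * l)"
      by (simp add: powr_power)
    then have "real (n + 1) ^ (5 * n + 4) = 2 powr ((5 * real n + 4) * log 2 (real n + 1))"
      unfolding p by (simp add: l_def)
    moreover have "(16::real) ^ n = 2 powr (4 * real n)"
    proof -
      have "(16::real) ^ n = 2 ^ (4 * n)" by (simp add: power_mult)
      then show ?thesis by (simp add: two_powr_nat)
    qed
    ultimately have "real (n + 1) ^ (5 * n + 4) * 16 ^ n * 2 powr ((\<beta> - \<eta>) * (real n)\<^sup>2 + 3 * real n)
       = 2 powr ((5 * real n + 4) * log 2 (real n + 1) + 4 * real n + ((\<beta> - \<eta>) * (real n)\<^sup>2 + 3 * real n))"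
      by (simp only: powr_add)
    also have "\<dots> \<le> 2 powr (\<beta> * (real n)\<^sup>2 - 1)" using elim(2) by (simp add: left_diff_distrib)
    finally have "real (n + 1) ^ (5 * n + 4) * 16 ^ n * 2 powr ((\<beta> - \<eta>) * (real n)\<^sup>2 + 3 * real n)
        \<le> 2 powr (\<beta> * (real n)\<^sup>2) / 2" by (simp add: half)
    with 1 show ?case by simp
  qed
qed

lemma QN_exponent:
  "\<exists>\<beta> C. \<beta> < c_DV \<and> 1 \<le> C \<and>
     (\<forall>(V :: nat set) N. finite V \<longrightarrow> real (card (QN V N)) \<le> C * 2 powr (\<beta> * (real (card V))\<^sup>2))"
proof -
  obtain \<beta> \<eta> where \<eta>: "0 < \<eta>" and \<beta>: "69/100 \<le> \<beta>" "\<beta> < c_DV" and tri: "\<And>s t. dv_region s t \<Longrightarrow>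
     (1/10 \<le> s \<and> 3 * s + 2 * t \<le> 3 \<and> \<beta> * t\<^sup>2 + s - s\<^sup>2/2 \<le> \<beta> - \<eta>) \<or>
     (s < 1/10 \<and> 1 + dv_g s t \<le> \<beta> - \<eta>) \<or>
     (1/10 \<le> s \<and> 1 + dv_g s t - 1/25000 \<le> \<beta> - \<eta>)"
    using dv_trichotomy[of "1/25000"] by auto
  have \<beta>1: "\<beta> \<le> 1" using \<beta>(2) dv_alpha_bounds by (simp add: c_DV_def)
  from eventually_absorbed[OF \<eta>, of \<beta>] obtain n1 where n1: "\<And>n. n1 \<le> n \<Longrightarrow>
      8 ^ n * 2 powr (\<beta> * (real n)\<^sup>2 - (real n)\<^sup>2 / 1000)
      + real (n + 1) ^ (5 * n + 4) * 16 ^ n * 2 powr ((\<beta> - \<eta>) * (real n)\<^sup>2 + 3 * real n)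
      \<le> 2 powr (\<beta> * (real n)\<^sup>2)"
    unfolding eventually_sequentially by blast
  define n0 where "n0 = max n1 1000"
  \<comment> \<open>Large enough for the trivial count 2^(n n) of all sign matrices of size below
    \<open>n0\<close>.\<close>
  define C :: real where "C = 2 ^ (n0 * n0)"
  have C: "1 \<le> C" by (simp add: C_def)
  have "real (card (QN V N)) \<le> C * 2 powr (\<beta> * (real (card V))\<^sup>2)" if "finite V" for V :: "nat set" and N
    using that
  proof (induction "card V" arbitrary: V N rule: less_induct)
    case less
    let ?n = "card V"
    show ?case
    proof (cases "?n < n0")
      case True
      have "card (QN V N) \<le> card (signs (V \<times> V))"
        using less.prems by (intro card_mono finite_signs) (auto simp: QN_def)
      also have "\<dots> = 2 ^ (?n * ?n)" using less.prems by (simp add: card_signs card_cartesian_product)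
      also have "\<dots> \<le> 2 ^ (n0 * n0)" using True by (intro power_increasing mult_le_mono) auto
      finally have "real (card (QN V N)) \<le> real (2 ^ (n0 * n0))" by (rule of_nat_mono)
      also have "\<dots> = C * 1" by (simp add: C_def)
      also have "\<dots> \<le> C * 2 powr (\<beta> * (real ?n)\<^sup>2)"
        using C \<beta> by (intro mult_left_mono) (auto intro!: ge_one_powr_ge_zero)
      finally show ?thesis .
    next
      case False
      then have n: "1000 \<le> ?n" "n1 \<le> ?n" by (auto simp: n0_def)
      have "real (card (QN V N))
        \<le> 8 ^ ?n * (C * 2 powr (\<beta> * (real ?n)\<^sup>2 - (real ?n)\<^sup>2 / 1000))
          + real (?n + 1) ^ (5 * ?n + 4) * 16 ^ ?n * (C * 2 powr ((\<beta> - \<eta>) * (real ?n)\<^sup>2 + 3 * real ?n))"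
      proof (rule QN_recursion[OF less.prems n(1) C \<beta>(1) \<beta>1 _ tri])
        fix W N assume W: "W \<subseteq> V" "card W < card V"
        then have "finite W" using less.prems finite_subset by blast
        then show "real (card (QN W N)) \<le> C * 2 powr (\<beta> * (real (card W))\<^sup>2)" by (rule less.hyps[OF W(2)])
      qed
      also have "\<dots> = C * (8 ^ ?n * 2 powr (\<beta> * (real ?n)\<^sup>2 - (real ?n)\<^sup>2 / 1000)
          + real (?n + 1) ^ (5 * ?n + 4) * 16 ^ ?n * 2 powr ((\<beta> - \<eta>) * (real ?n)\<^sup>2 + 3 * real ?n))"
      proof -
        have "x * (C * y) + z * w * (C * v) = C * (x * y + z * w * v)" for x y z w v
          by (simp add: algebra_simps)
        then show ?thesis .
      qed
      also have "\<dots> \<le> C * 2 powr (\<beta> * (real ?n)\<^sup>2)"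
        using n1[OF n(2)] C by (intro mult_left_mono) auto
      finally show ?thesis .
    qed
  qed
  then show ?thesis using \<beta>(2) C by blast
qed

section \<open>Transfer to normal sign matrices\<close>

lemma normal_mats_le_QN: "card {M \<in> sign_mats n. normal_mat M} \<le> card (QN {..<n} (\<lambda>_ _. 0))"
proof (rule card_inj_on_le)
  let ?h = "\<lambda>M :: real mat. restrict (\<lambda>p. M $$ p) ({..<n} \<times> {..<n})"
  show "inj_on ?h {M \<in> sign_mats n. normal_mat M}"
  proof (rule inj_onI)
    fix A B assume A: "A \<in> {M \<in> sign_mats n. normal_mat M}" and B: "B \<in> {M \<in> sign_mats n. normal_mat M}"
      and e: "?h A = ?h B"
    have c: "A \<in> carrier_mat n n" "B \<in> carrier_mat n n" using A B by (auto simp: sign_mats_def)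
    show "A = B"
    proof (rule eq_matI)
      fix i j assume "i < dim_row B" "j < dim_col B"
      then have "i < n" "j < n" using c by auto
      then show "A $$ (i, j) = B $$ (i, j)" using fun_cong[OF e, of "(i, j)"] by simp
    qed (use c in auto)
  qed
  show "?h ` {M \<in> sign_mats n. normal_mat M} \<subseteq> QN {..<n} (\<lambda>_ _. 0)"
  proof (intro image_subsetI)
    fix A assume "A \<in> {M \<in> sign_mats n. normal_mat M}"
    then have A: "A \<in> carrier_mat n n" "elements_mat A \<subseteq> {-1, 1}"
      and N: "A * transpose_mat A = transpose_mat A * A" by (auto simp: sign_mats_def normal_mat_def)
    have ent: "A $$ (i, j) \<in> {-1, 1}" if "i < n" "j < n" for i j
      using elements_matI[OF A(1) that refl] A(2) by blast
    have "(\<Sum>l<n. A $$ (i, l) * A $$ (k, l) - A $$ (l, i) * A $$ (l, k)) = 0" if "i < n" "k < n" for i k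
    proof -
      have "(A * transpose_mat A) $$ (i, k) = (\<Sum>l<n. A $$ (i, l) * A $$ (k, l))"
        using A(1) that by (simp add: scalar_prod_def lessThan_atLeast0)
      moreover have "(transpose_mat A * A) $$ (i, k) = (\<Sum>l<n. A $$ (l, i) * A $$ (l, k))"
        using A(1) that by (simp add: scalar_prod_def lessThan_atLeast0)
      ultimately show ?thesis using N by (simp add: sum_subtractf)
    qed
    moreover have "?h A \<in> signs ({..<n} \<times> {..<n})"
    proof (rule PiE_I)
      fix p assume "p \<in> {..<n} \<times> {..<n}"
      then show "?h A p \<in> {-1, 1}" using ent[of "fst p" "snd p"] by auto
    qed simp
    ultimately show "?h A \<in> QN {..<n} (\<lambda>_ _. 0)" by (simp add: QN_def)
  qed
  show "finite (QN {..<n} (\<lambda>_ _. 0))" by (rule finite_QN) simp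
qed

theorem theorem1p18:
  shows "c_DV < 0.698 \<and>
    (\<exists>\<delta>>0. \<exists>\<epsilon> :: nat \<Rightarrow> real. \<epsilon> \<longlonglongrightarrow> 0 \<and>
      (\<forall>\<^sub>F n in sequentially.
         real (card {M \<in> sign_mats n. normal_mat M})
           \<le> 2 powr ((c_DV - \<delta> + \<epsilon> n) * (real n)\<^sup>2)))"
proof
  show "c_DV < 0.698" using dv_alpha_bounds by (simp add: c_DV_def)
  obtain \<beta> C where \<beta>: "\<beta> < c_DV" and C: "1 \<le> C" and
    bd: "\<And>(V :: nat set) N. finite V \<Longrightarrow> real (card (QN V N)) \<le> C * 2 powr (\<beta> * (real (card V))\<^sup>2)"
    using QN_exponent by blast
  \<comment> \<open>The multiplicative constant is moved into the exponent: C = 2^(\<epsilon> n *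
    n^2) for n > 0.\<close>
  define \<epsilon> where "\<epsilon> n = log 2 C / (real n)\<^sup>2" for n :: nat
  have "\<epsilon> \<longlonglongrightarrow> 0" unfolding \<epsilon>_def by real_asymp
  moreover have "\<forall>\<^sub>F n in sequentially. real (card {M \<in> sign_mats n. normal_mat M})
           \<le> 2 powr ((c_DV - (c_DV - \<beta>) + \<epsilon> n) * (real n)\<^sup>2)"
    using eventually_gt_at_top[of "0::nat"]
  proof eventually_elim
    case (elim n)
    have "real (card {M \<in> sign_mats n. normal_mat M}) \<le> real (card (QN {..<n} (\<lambda>_ _. 0)))"
      by (intro of_nat_mono normal_mats_le_QN)
    also have "\<dots> \<le> C * 2 powr (\<beta> * (real n)\<^sup>2)" using bd[of "{..<n}"] by simp
    also have "\<dots> = 2 powr (log 2 C + \<beta> * (real n)\<^sup>2)" using C by (simp add: powr_add)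
    also have "log 2 C + \<beta> * (real n)\<^sup>2 = (c_DV - (c_DV - \<beta>) + \<epsilon> n) * (real n)\<^sup>2"
      using elim by (simp add: \<epsilon>_def distrib_right)
    finally show ?case .
  qed
  ultimately show "\<exists>\<delta>>0. \<exists>\<epsilon> :: nat \<Rightarrow> real. \<epsilon> \<longlonglongrightarrow> 0 \<and>
      (\<forall>\<^sub>F n in sequentially. real (card {M \<in> sign_mats n. normal_mat M})
           \<le> 2 powr ((c_DV - \<delta> + \<epsilon> n) * (real n)\<^sup>2))"
    using \<beta> by (intro exI[of _ "c_DV - \<beta>"] conjI exI[of _ \<epsilon>]) auto
qed

end
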